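(* Let $F\in\mathbb{Z}_2[X]$ be a $*$-symmetric polynomial of even degree $2n$ such that (a) $v_2(F(1))\equiv v_2(F(-1))\equiv0\pmod2$ and (b) if $F(1)F(-1)\ne0$ then $(-1)^nF(1)F(-1)=1$ in $\mathbb{Q}_2^\times/\mathbb{Q}_2^{\times2}$. Let $M$ and $\alpha$ be as described in the context. Then there exists an inner product $b$ on the $\mathbb{Q}_2$-vector space $M$ such that $(M,b)$ contains an $\alpha$-stable even unimodular $\mathbb{Z}_2$-lattice. Furthermore, if $F(1)=F(-1)=0$, then such an inner product can be chosen so that the determinant of the restriction of $b$ to $M^\pm$ equals $u_\pm f(\pm1)$ if $n_+$ is even and $2u_\pm f(\pm1)$ if $n_+$ is odd, for any given $u_+,u_-\in\mathbb{Z}_2^\times$ with $u_+u_-=(-1)^n$.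
   Context: A monic polynomial $F$ with $F(0)\ne0$ is $*$-symmetric if $F=F^*$ where $F^*(X)=F(0)^{-1}X^{\deg F}F(X^{-1})$. Convention $v_2(0)\equiv0\pmod 2$. Write $F(X)=(X-1)^{n_+}(X+1)^{n_-}f(X)$ with $f(1)f(-1)\ne0$, and factor $f=\prod_{w\in\mathcal{W}_{sp}}(f_wf_w^* )^{n_w}\prod_{w\in\mathcal{W}'}f_w^{n_w}$ in $\mathbb{Z}_2[X]$ with each $f_w$ irreducible, $f_w\ne f_w^*$ for $w\in\mathcal{W}_{sp}$ and $f_w=f_w^*$ for $w\in\mathcal{W}'$. Set $M^\pm=(\mathbb{Q}_2[X]/(X\mp1))^{n_\pm}$, $E_w=\mathbb{Q}_2[X]/(f_w)$ if $f_w=f_w^*$ and $E_w=\mathbb{Q}_2[X]/(f_wf_w^* )$ otherwise, $M_w=E_w^{n_w}$, $M=M^+\times M^-\times\prod_w M_w$, and let $\alpha$ be the image of $X$ in $M$, acting on $M$ by multiplication (a semisimple automorphism with characteristic polynomial $F$). A lattice in $M$ is a free $\mathbb{Z}_2$-submodule $\Lambda$ with $\mathbb{Q}_2\Lambda=M$; $\alpha$-stable means $\alpha\Lambda=\Lambda$; unimodular means $\Lambda=\Lambda^\vee$; even means $b(x,x)\in2\mathbb{Z}_2$ for $x\in\Lambda$. Determinants are taken in $\mathbb{Q}_2^\times/\mathbb{Q}_2^{\times2}$. *)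

theory Defs
  imports
    "HOL-Computational_Algebra.Computational_Algebra"
    "HOL-Library.Function_Algebras"
    "HOL-Library.Product_Plus"
    "Jordan_Normal_Form.Determinant"
begin

section \<open>The 2-adic integers and the 2-adic numbers\<close>

text \<open>The ring \<open>\<int>\<^sub>2\<close> is the inverse limit of the rings \<open>\<int>/2\<^sup>n\<close>, each represented by
  \<open>{0..<2\<^sup>n}\<close>.  The defining equation forces \<open>0 \<le> x n < 2 ^ n\<close>.\<close>

typedef two_adic_int = "{x :: nat \<Rightarrow> int. \<forall>n. x n = x (Suc n) mod 2 ^ n}"
  by (rule exI[of _ "\<lambda>_. 0"]) simp

setup_lifting type_definition_two_adic_int

lemma mod_pow2_Suc: "(a :: int) mod 2 ^ Suc n mod 2 ^ n = a mod 2 ^ n"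
  by (rule mod_mod_cancel) simp

instantiation two_adic_int :: comm_ring_1
begin

lift_definition zero_two_adic_int :: two_adic_int is "\<lambda>_. 0" by simp

lift_definition one_two_adic_int :: two_adic_int is "\<lambda>n. 1 mod 2 ^ n"
  by (simp only: mod_pow2_Suc simp_thms)

lift_definition plus_two_adic_int :: "two_adic_int \<Rightarrow> two_adic_int \<Rightarrow> two_adic_int"
  is "\<lambda>x y n. (x n + y n) mod 2 ^ n"
  by (metis mod_add_eq mod_pow2_Suc)

lift_definition minus_two_adic_int :: "two_adic_int \<Rightarrow> two_adic_int \<Rightarrow> two_adic_int"
  is "\<lambda>x y n. (x n - y n) mod 2 ^ n"
  by (metis mod_diff_eq mod_pow2_Suc)

lift_definition uminus_two_adic_int :: "two_adic_int \<Rightarrow> two_adic_int"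
  is "\<lambda>x n. (- x n) mod 2 ^ n"
  by (metis mod_minus_eq mod_pow2_Suc)

lift_definition times_two_adic_int :: "two_adic_int \<Rightarrow> two_adic_int \<Rightarrow> two_adic_int"
  is "\<lambda>x y n. (x n * y n) mod 2 ^ n"
  by (metis mod_mult_eq mod_pow2_Suc)

lemma residue_mod_self:
  assumes "\<forall>n. x n = x (Suc n) mod (2 :: int) ^ n"
  shows "x n mod 2 ^ n = x n"
  by (metis assms mod_mod_trivial)

lemma Rep_mod_self: "Rep_two_adic_int a n mod 2 ^ n = Rep_two_adic_int a n"
  using Rep_two_adic_int[of a] by (intro residue_mod_self) blast

lemmas Rep_simps = Rep_two_adic_int_inject[symmetric] fun_eq_iff zero_two_adic_int.rep_eq
  one_two_adic_int.rep_eq plus_two_adic_int.rep_eq minus_two_adic_int.rep_eq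
  uminus_two_adic_int.rep_eq times_two_adic_int.rep_eq

instance
proof
  fix a b c :: two_adic_int
  show "a * b * c = a * (b * c)"
    by (simp add: Rep_simps mod_simps mult.assoc)
  show "a * b = b * a"
    by (simp add: Rep_simps mult.commute)
  show "1 * a = a"
    using Rep_mod_self[of a 0] by (simp add: Rep_simps mod_simps Rep_mod_self)
  show "a + b + c = a + (b + c)"
    by (simp add: Rep_simps mod_simps add.assoc)
  show "a + b = b + a"
    by (simp add: Rep_simps add.commute)
  show "0 + a = a"
    by (simp add: Rep_simps Rep_mod_self)
  show "- a + a = 0"
    by (simp add: Rep_simps mod_simps)
  show "a - b = a + - b"
    by (simp add: Rep_simps mod_simps)
  show "(a + b) * c = a * c + b * c"
    by (simp add: Rep_simps mod_simps distrib_right)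
  show "(0 :: two_adic_int) \<noteq> 1"
  proof
    assume "(0 :: two_adic_int) = 1"
    from arg_cong[OF this, of "\<lambda>a. Rep_two_adic_int a 1"] show False
      by (simp add: zero_two_adic_int.rep_eq one_two_adic_int.rep_eq)
  qed
qed

end

lemma residue_step:
  assumes "\<forall>n. x n = x (Suc n) mod (2 :: int) ^ n"
  shows "x (n + k) mod 2 ^ n = x n"
proof (induction k)
  case 0
  show ?case by (simp add: residue_mod_self[OF assms])
next
  case (Suc k)
  have "x (n + Suc k) mod 2 ^ n = x (Suc (n + k)) mod 2 ^ (n + k) mod 2 ^ n"
    by (simp add: mod_mod_cancel le_imp_power_dvd)
  also have "\<dots> = x n"
    using Suc assms by metis
  finally show ?case .
qed

lemma pow2_add_dvd_mult:
  fixes a b :: int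
  assumes "2 ^ (n + k) dvd a * b"
  shows "2 ^ n dvd a \<or> 2 ^ k dvd b"
  using assms
proof (induction n arbitrary: a)
  case 0
  then show ?case by simp
next
  case (Suc n)
  show ?case
  proof (cases "even a")
    case True
    then obtain c where c: "a = 2 * c" by blast
    with Suc.prems have "2 ^ (n + k) dvd c * b" by (simp add: mult.assoc)
    from Suc.IH[OF this] show ?thesis by (auto simp: c)
  next
    case False
    then have "coprime (2 ^ (Suc n + k)) a" by simp
    with Suc.prems have "(2 :: int) ^ (Suc n + k) dvd b"
      using coprime_dvd_mult_right_iff by blast
    then show ?thesis
      by (meson dvd_trans le_add2 le_imp_power_dvd)
  qed
qed

instance two_adic_int :: idom
proof
  fix a b :: two_adic_int
  assume "a \<noteq> 0" "b \<noteq> 0"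
  then show "a * b \<noteq> 0"
  proof transfer
    fix x y :: "nat \<Rightarrow> int"
    assume x: "\<forall>n. x n = x (Suc n) mod 2 ^ n" and y: "\<forall>n. y n = y (Suc n) mod 2 ^ n"
      and "x \<noteq> (\<lambda>_. 0)" "y \<noteq> (\<lambda>_. 0)"
    then obtain n k where nk: "x n \<noteq> 0" "y k \<noteq> 0" by blast
    show "(\<lambda>n. x n * y n mod 2 ^ n) \<noteq> (\<lambda>_. 0)"
    proof
      assume "(\<lambda>n. x n * y n mod 2 ^ n) = (\<lambda>_. 0)"
      then have "2 ^ (n + k) dvd x (n + k) * y (n + k)"
        by (metis dvd_eq_mod_eq_0)
      then have "2 ^ n dvd x (n + k) \<or> 2 ^ k dvd y (n + k)"
        by (rule pow2_add_dvd_mult)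
      with nk residue_step[OF x, of n k] residue_step[OF y, of k n] show False
        by (auto simp: dvd_eq_mod_eq_0 add.commute)
    qed
  qed
qed

type_synonym two_adic = "two_adic_int fract"

text \<open>The convention \<open>v\<^sub>2(0) \<equiv> 0 (mod 2)\<close> is realised by \<open>v\<^sub>2(0) = 0\<close>.\<close>

definition v2 :: "two_adic_int \<Rightarrow> nat" where
  "v2 x = (if x = 0 then 0 else Max {k. 2 ^ k dvd x})"

definition two_adic_ints :: "two_adic set" where
  "two_adic_ints = range to_fract"

text \<open>The class of \<open>a\<close> modulo \<open>K\<^sup>\<times>\<^sup>2\<close>, as a coset.\<close>

definition square_class :: "'a::field \<Rightarrow> 'a set" where
  "square_class a = {a * s ^ 2 | s. s \<noteq> 0}"


section \<open>\<open>*\<close>-symmetric polynomials\<close>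

text \<open>\<^const>\<open>reflect_poly\<close> sends \<open>F\<close> to \<open>X\<^bsup>deg F\<^esup> F(X\<^sup>-\<^sup>1)\<close>.\<close>

definition star_poly :: "'a::field poly \<Rightarrow> 'a poly" where
  "star_poly F = Polynomial.smult (inverse (poly F 0)) (reflect_poly F)"

definition star_symmetric :: "'a::field poly \<Rightarrow> bool" where
  "star_symmetric F \<longleftrightarrow> lead_coeff F = 1 \<and> poly F 0 \<noteq> 0 \<and> star_poly F = F"

text \<open>The factorization \<open>f = \<Prod>\<^bsub>w \<in> Wsp\<^esub> (f\<^sub>w f\<^sub>w\<^sup>*)\<^bsup>n\<^sub>w\<^esup> \<Prod>\<^bsub>w \<in> Wsd\<^esub> f\<^sub>w\<^bsup>n\<^sub>w\<^esup>\<close> into powers of pairwise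
  distinct monic irreducible factors.  Irreducibility is meant in \<open>\<int>\<^sub>2[X]\<close>; the equations involving
  \<open>f\<^sub>w\<^sup>*\<close> are stated in \<open>\<rat>\<^sub>2[X]\<close>, where \<^const>\<open>star_poly\<close> lives.\<close>

definition star_factorization ::
  "two_adic_int poly \<Rightarrow> 'w set \<Rightarrow> 'w set \<Rightarrow> ('w \<Rightarrow> two_adic_int poly) \<Rightarrow> ('w \<Rightarrow> nat) \<Rightarrow> bool" where
  "star_factorization f Wsp Wsd fw nw \<longleftrightarrow>
     finite Wsp \<and> finite Wsd \<and> Wsp \<inter> Wsd = {} \<and>
     (\<forall>w \<in> Wsp \<union> Wsd. irreducible (fw w) \<and> lead_coeff (fw w) = 1 \<and> 0 < nw w) \<and>
     (\<forall>w \<in> Wsp. fract_poly (fw w) \<noteq> star_poly (fract_poly (fw w))) \<and>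
     (\<forall>w \<in> Wsd. fract_poly (fw w) = star_poly (fract_poly (fw w))) \<and>
     (\<forall>w \<in> Wsp \<union> Wsd. \<forall>w' \<in> Wsp \<union> Wsd. w \<noteq> w' \<longrightarrow>
        fw w \<noteq> fw w' \<and> fract_poly (fw w) \<noteq> star_poly (fract_poly (fw w'))) \<and>
     fract_poly f =
       (\<Prod>w\<in>Wsp. (fract_poly (fw w) * star_poly (fract_poly (fw w))) ^ nw w) *
       (\<Prod>w\<in>Wsd. fract_poly (fw w) ^ nw w)"


section \<open>The module \<open>M\<close> and the endomorphism \<open>\<alpha>\<close>\<close>

text \<open>The quotient \<open>K[X]/(g)\<close> is represented by its canonical remainders; its addition is that of
  \<open>K[X]\<close>, and the image of \<open>X\<close> acts by \<open>p \<mapsto> X p mod g\<close>.\<close>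

definition quotient_ring :: "'a::field poly \<Rightarrow> 'a poly set" where
  "quotient_ring g = range (\<lambda>p. p mod g)"

definition E_modulus :: "two_adic_int poly \<Rightarrow> two_adic poly" where
  "E_modulus g = (if fract_poly g = star_poly (fract_poly g) then fract_poly g
                  else fract_poly g * star_poly (fract_poly g))"

text \<open>A fixed vector space containing all the modules \<open>M\<close>: its three components hold
  \<open>M\<^sup>+\<close>, \<open>M\<^sup>-\<close> and \<open>\<Prod>\<^sub>w M\<^sub>w\<close>, each vector being extended by zero outside its index range.\<close>

type_synonym 'w ambient =
  "(nat \<Rightarrow> two_adic poly) \<times> (nat \<Rightarrow> two_adic poly) \<times> ('w \<Rightarrow> nat \<Rightarrow> two_adic poly)"

definition scaleQ :: "two_adic \<Rightarrow> 'w ambient \<Rightarrow> 'w ambient" where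
  "scaleQ c = (\<lambda>(x, y, z). (\<lambda>i. Polynomial.smult c (x i), \<lambda>i. Polynomial.smult c (y i), \<lambda>w i. Polynomial.smult c (z w i)))"

definition scaleZ :: "two_adic_int \<Rightarrow> 'w ambient \<Rightarrow> 'w ambient" where
  "scaleZ c = scaleQ (to_fract c)"

global_interpretation QM: vector_space scaleQ
  by unfold_locales
    (simp_all only: scaleQ_def split_beta prod_eq_iff fun_eq_iff fst_conv snd_conv plus_fun_apply
      fst_add snd_add smult_add_right smult_add_left smult_smult smult_1_left simp_thms)

global_interpretation ZM: Modules.module scaleZ
  by unfold_locales
    (simp_all only: scaleZ_def QM.scale_right_distrib QM.scale_left_distrib QM.scale_scale
      QM.scale_one to_fract_add to_fract_mult to_fract_1)

definition power_module :: "two_adic poly \<Rightarrow> nat \<Rightarrow> (nat \<Rightarrow> two_adic poly) set" where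
  "power_module g k = {x. (\<forall>i<k. x i \<in> quotient_ring g) \<and> (\<forall>i\<ge>k. x i = 0)}"

definition M_plus :: "nat \<Rightarrow> 'w ambient set" where
  "M_plus n_plus = {(x, 0, 0) | x. x \<in> power_module [:-1, 1:] n_plus}"

definition M_minus :: "nat \<Rightarrow> 'w ambient set" where
  "M_minus n_minus = {(0, y, 0) | y. y \<in> power_module [:1, 1:] n_minus}"

definition M_module ::
  "nat \<Rightarrow> nat \<Rightarrow> 'w set \<Rightarrow> ('w \<Rightarrow> two_adic_int poly) \<Rightarrow> ('w \<Rightarrow> nat) \<Rightarrow> 'w ambient set" where
  "M_module n_plus n_minus W fw nw =
     {(x, y, z). x \<in> power_module [:-1, 1:] n_plus \<and> y \<in> power_module [:1, 1:] n_minus \<and>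
        (\<forall>w\<in>W. z w \<in> power_module (E_modulus (fw w)) (nw w)) \<and> (\<forall>w. w \<notin> W \<longrightarrow> z w = 0)}"

definition alpha :: "('w \<Rightarrow> two_adic_int poly) \<Rightarrow> 'w ambient \<Rightarrow> 'w ambient" where
  "alpha fw = (\<lambda>(x, y, z).
     (\<lambda>i. ([:0, 1:] * x i) mod [:-1, 1:],
      \<lambda>i. ([:0, 1:] * y i) mod [:1, 1:],
      \<lambda>w i. ([:0, 1:] * z w i) mod E_modulus (fw w)))"


section \<open>Inner products and lattices\<close>

text \<open>Only the values of \<open>b\<close> on \<open>M \<times> M\<close> matter.\<close>

definition inner_product_on :: "'w ambient set \<Rightarrow> ('w ambient \<Rightarrow> 'w ambient \<Rightarrow> two_adic) \<Rightarrow> bool" where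
  "inner_product_on M b \<longleftrightarrow>
     (\<forall>x\<in>M. \<forall>y\<in>M. \<forall>z\<in>M. b (x + y) z = b x z + b y z) \<and>
     (\<forall>c. \<forall>x\<in>M. \<forall>y\<in>M. b (scaleQ c x) y = c * b x y) \<and>
     (\<forall>x\<in>M. \<forall>y\<in>M. b x y = b y x) \<and>
     (\<forall>x\<in>M. (\<forall>y\<in>M. b x y = 0) \<longrightarrow> x = 0)"

definition isometry_on ::
  "'w ambient set \<Rightarrow> ('w ambient \<Rightarrow> 'w ambient \<Rightarrow> two_adic) \<Rightarrow> ('w ambient \<Rightarrow> 'w ambient) \<Rightarrow> bool" where
  "isometry_on M b t \<longleftrightarrow> bij_betw t M M \<and> (\<forall>x\<in>M. \<forall>y\<in>M. b (t x) (t y) = b x y)"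

definition lattice_in :: "'w ambient set \<Rightarrow> 'w ambient set \<Rightarrow> bool" where
  "lattice_in M L \<longleftrightarrow>
     ZM.subspace L \<and> (\<exists>B. ZM.independent B \<and> ZM.span B = L) \<and> QM.span L = M"

definition dual_lattice ::
  "'w ambient set \<Rightarrow> ('w ambient \<Rightarrow> 'w ambient \<Rightarrow> two_adic) \<Rightarrow> 'w ambient set \<Rightarrow> 'w ambient set" where
  "dual_lattice M b L = {y \<in> M. \<forall>x\<in>L. b x y \<in> two_adic_ints}"

definition unimodular ::
  "'w ambient set \<Rightarrow> ('w ambient \<Rightarrow> 'w ambient \<Rightarrow> two_adic) \<Rightarrow> 'w ambient set \<Rightarrow> bool" where
  "unimodular M b L \<longleftrightarrow> L = dual_lattice M b L"

definition even_lattice ::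
  "('w ambient \<Rightarrow> 'w ambient \<Rightarrow> two_adic) \<Rightarrow> 'w ambient set \<Rightarrow> bool" where
  "even_lattice b L \<longleftrightarrow> (\<forall>x\<in>L. b x x \<in> (\<lambda>a. 2 * a) ` two_adic_ints)"

definition ordered_basis :: "'w ambient set \<Rightarrow> 'w ambient list \<Rightarrow> bool" where
  "ordered_basis V vs \<longleftrightarrow> distinct vs \<and> QM.independent (set vs) \<and> QM.span (set vs) = V"

definition gram_matrix ::
  "('w ambient \<Rightarrow> 'w ambient \<Rightarrow> two_adic) \<Rightarrow> 'w ambient list \<Rightarrow> two_adic mat" where
  "gram_matrix b vs = mat (length vs) (length vs) (\<lambda>(i, j). b (vs ! i) (vs ! j))"

text \<open>The determinant of \<open>b\<close> restricted to \<open>V\<close>, as a coset in \<open>\<rat>\<^sub>2\<^sup>\<times>/\<rat>\<^sub>2\<^sup>\<times>\<^sup>2\<close>.  The union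
  runs over all bases of \<open>V\<close>, which all contribute the same coset.\<close>

definition form_det ::
  "'w ambient set \<Rightarrow> ('w ambient \<Rightarrow> 'w ambient \<Rightarrow> two_adic) \<Rightarrow> two_adic set" where
  "form_det V b = (\<Union>vs \<in> Collect (ordered_basis V). square_class (det (gram_matrix b vs)))"

text \<open>As usual for spaces carrying an automorphism, the inner products considered on \<open>M\<close> are those
  for which \<open>\<alpha>\<close> is an isometry; without this requirement \<open>b\<close> and \<open>\<alpha>\<close> would be unrelated.\<close>

definition has_stable_even_unimodular ::
  "'w ambient set \<Rightarrow> ('w ambient \<Rightarrow> 'w ambient) \<Rightarrow> ('w ambient \<Rightarrow> 'w ambient \<Rightarrow> two_adic) \<Rightarrow> bool" where
  "has_stable_even_unimodular M t b \<longleftrightarrow>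
     inner_product_on M b \<and> isometry_on M b t \<and>
     (\<exists>L. lattice_in M L \<and> t ` L = L \<and> even_lattice b L \<and> unimodular M b L)"

end

(* Let K be the field of 2-adic numbers and R the ring of 2-adic integers.  If F is symmetric of
   degree 2n with F(1)F(-1) nonzero, then K[X]/(F) carries the X-invariant form
   b(g, h) = lam ((X - 1/X) g(X) h(1/X)), where lam y is the coefficient of X^(2n-1) in X^(n-1) y mod F.
   The lattice R[X]/(F) is stable and even for b, and its dual is only slightly larger: it is
   spanned by R[X]/(F) and the vectors u s + v s' with 2u and u - v integral, where s = 1/(X-1) and
   s' = 1/(X+1).  The two poles are orthogonal, are eigenvectors of X modulo R[X]/(F) for 1 and -1,
   and satisfy b(s, s) = 2/F(1) and b(s', s') = 2(-1)^(n-1)/F(-1).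

   So constructing an even unimodular lattice means killing this small discriminant group by
   gluing.  Two copies of K[X]/(g) with opposite forms glue to a unimodular lattice, so the
   multiplicities of the factors matter only modulo 2, and the factors of odd multiplicity are
   collected in one squarefree F.  For this F the discriminant group is removed in one of two ways:
   by an isotropic subgroup spanned by multiples of the poles, where (a) and (b) are used, or by
   gluing the poles to lines of M^+ and M^- with opposite values of the form.  The lines that are
   left over pair up to hyperbolic planes. *)
theory Submission
  imports Defs
begin

text \<open>The pairing lam (g h(1/X)) is unimodular on R[X]/(F) but skew: in the basis X^(1-n),
  ..., X^n the functional lam is the coordinate of X^n, and X^(-n) has coordinate -1 there because F
  is monic with F(0) = 1. The factor X - 1/X makes the form symmetric and even, and it is also what
  spoils unimodularity: its inverse is (s + s')/2, so the dual grows exactly by halves of poles.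

  A multiple t s for which t^2 b(s, s)/2 is a unit exists when F(1) has even valuation; this is how
  (a) enters. The half sum (t s + t' s')/2 must also have even norm, a congruence modulo 4; it
  follows from (b) because squares of units are 1 modulo 4.

  If F(1) = F(-1) = 0, the poles are glued to lines instead and one unit stays free: for odd n_+ it
  is the scale of the form on the squarefree part, for even n_+ the value on an extra hyperbolic
  plane made of one line of M^+ and one of M^-. Adjusting it to u_+ gives the determinant on M^+,
  and u_+ u_- = (-1)^n then gives the one on M^-.\<close>

hide_const (open) Module.smult

section \<open>The 2-adic integers: a local domain of characteristic 0 with uniformizer 2\<close>

lemma two_adic_int_dvd_2I:
  assumes True: "Rep_two_adic_int x 1 = 0"
  shows "2 dvd x"
proof -
  define r where "r = Rep_two_adic_int x"
  have r: "\<forall>n. r n = r (Suc n) mod 2 ^ n"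
    using Rep_two_adic_int[of x] unfolding r_def by (rule CollectD)
  have even: "even (r (Suc n))" for n
    using residue_step[OF r, of 1 n] True by (simp add: r_def dvd_eq_mod_eq_0)
  \<comment> \<open>Halving costs one digit: the half modulo 2^n is read off from the residue modulo
    2^(n+1).\<close>
  define h where "h n = r (Suc n) div 2" for n
  have "h n = h (Suc n) mod 2 ^ n" for n
  proof -
    have "2 * h n = r (Suc n)" "2 * h (Suc n) = r (Suc (Suc n))"
      using even by (auto simp: h_def)
    moreover have "r (Suc n) = r (Suc (Suc n)) mod 2 ^ Suc n" by (rule r[rule_format])
    ultimately have "2 * h n = (2 * h (Suc n)) mod (2 * 2 ^ n)" by (simp only: power_Suc)
    also have "\<dots> = 2 * (h (Suc n) mod 2 ^ n)" by (simp only: mult_mod_right)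
    finally show ?thesis by simp
  qed
  then have h: "h \<in> {x. \<forall>n. x n = x (Suc n) mod 2 ^ n}" by blast
  have "(h n + h n) mod 2 ^ n = r n" for n
  proof -
    have "h n + h n = r (Suc n)" using even[of n] by (auto simp: h_def)
    then show ?thesis using r[rule_format, of n] by (simp only:)
  qed
  then have "x = Abs_two_adic_int h + Abs_two_adic_int h"
    unfolding Rep_two_adic_int_inject[symmetric] plus_two_adic_int.rep_eq fun_eq_iff
      Abs_two_adic_int_inverse[OF h] r_def by simp
  then have "x = 2 * Abs_two_adic_int h" by simp
  then show ?thesis by (metis dvd_triv_left)
qed

lemma two_adic_int_even_or_odd: "2 dvd (x :: two_adic_int) \<or> 2 dvd x - 1"
proof -
  have "Rep_two_adic_int x 1 mod 2 ^ 1 = Rep_two_adic_int x 1" by (rule Rep_mod_self)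
  then have "Rep_two_adic_int x 1 = 0 \<or> Rep_two_adic_int (x - 1) 1 = 0"
    unfolding minus_two_adic_int.rep_eq one_two_adic_int.rep_eq power_one_right by presburger
  then show ?thesis using two_adic_int_dvd_2I by blast
qed

text \<open>An odd integer a satisfies a^(2^n) = 1 modulo 2^n, so an element with odd residues is
  inverted level by level by the power 2^n - 1.\<close>

lemma two_adic_int_dvd_2_or_unit: "2 dvd (x :: two_adic_int) \<or> x dvd 1"
proof (cases "Rep_two_adic_int x 1 = 0")
  case True
  then show ?thesis using two_adic_int_dvd_2I by blast
next
  case False
  define r where "r = Rep_two_adic_int x"
  have r: "\<forall>n. r n = r (Suc n) mod 2 ^ n"
    using Rep_two_adic_int[of x] unfolding r_def by (rule CollectD)
  have r1: "r 1 = 1"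
    using False residue_mod_self[OF r, of 1] by (auto simp: r_def)
  have odd: "odd (r (Suc n))" for n
    using residue_step[OF r, of 1 n] r1 by (simp add: odd_iff_mod_2_eq_one)
  have pow: "r n ^ (2 ^ n) mod 2 ^ n = 1 mod 2 ^ n" for n
  proof (cases n)
    case (Suc k)
    \<comment> \<open>Each squaring gains a factor 2, namely from a^(2^m) + 1.\<close>
    have "2 ^ m dvd (a :: int) ^ (2 ^ m) - 1" if "odd a" for a m
    proof (induction m)
      case (Suc m)
      have "a ^ 2 ^ Suc m = (a ^ 2 ^ m) ^ 2"
        unfolding power_Suc2[of 2 m] by (rule power_mult)
      also have "\<dots> - 1 = (a ^ 2 ^ m - 1) * (a ^ 2 ^ m + 1)"
        by (simp add: power2_eq_square algebra_simps)
      finally have "a ^ 2 ^ Suc m - 1 = (a ^ 2 ^ m - 1) * (a ^ 2 ^ m + 1)" .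
      moreover have "2 dvd a ^ 2 ^ m + 1" using that by simp
      ultimately show ?case
        using mult_dvd_mono[OF Suc] by (simp only: power_Suc2)
    qed simp
    from this[OF odd[of k]] Suc show ?thesis by (simp only: mod_eq_dvd_iff)
  qed simp
  define i where "i n = r n ^ (2 ^ n - 1) mod 2 ^ n" for n
  \<comment> \<open>The exponents of two consecutive levels differ by 2^n, and the residue raised to
    that power is 1; hence the inverses are coherent.\<close>
  have "i n = i (Suc n) mod 2 ^ n" for n
  proof -
    have "i (Suc n) mod 2 ^ n = r (Suc n) ^ (2 ^ Suc n - 1) mod 2 ^ n"
      unfolding i_def by (rule mod_pow2_Suc)
    also have "\<dots> = (r (Suc n) mod 2 ^ n) ^ (2 ^ Suc n - 1) mod 2 ^ n"
      by (simp only: power_mod)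
    also have "r (Suc n) mod 2 ^ n = r n" by (rule r[rule_format, symmetric])
    also have "(2::nat) ^ Suc n - 1 = 2 ^ n + (2 ^ n - 1)" by simp
    also have "r n ^ (2 ^ n + (2 ^ n - 1)) mod 2 ^ n = (r n ^ 2 ^ n mod 2 ^ n * r n ^ (2 ^ n - 1)) mod 2 ^ n"
      by (simp only: power_add mod_mult_left_eq)
    also have "\<dots> = i n" by (simp only: pow i_def mod_mult_left_eq mult_1)
    finally show ?thesis ..
  qed
  then have i: "i \<in> {x. \<forall>n. x n = x (Suc n) mod 2 ^ n}" by blast
  have "r n * i n mod 2 ^ n = 1 mod 2 ^ n" for n
  proof -
    have "r n * i n mod 2 ^ n = r n * r n ^ (2 ^ n - 1) mod 2 ^ n"
      by (simp only: i_def mod_mult_right_eq)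
    also have "r n * r n ^ (2 ^ n - 1) = r n ^ 2 ^ n"
      by (metis One_nat_def Suc_pred power_Suc zero_less_numeral zero_less_power)
    finally show ?thesis using pow by simp
  qed
  then have "x * Abs_two_adic_int i = 1"
    by (simp add: Rep_two_adic_int_inject[symmetric] times_two_adic_int.rep_eq
        one_two_adic_int.rep_eq fun_eq_iff Abs_two_adic_int_inverse[OF i] r_def)
  then show ?thesis by (metis dvd_triv_left)
qed

lemma Rep_of_nat: "Rep_two_adic_int (of_nat k) n = int k mod 2 ^ n"
  by (induction k)
    (simp_all add: zero_two_adic_int.rep_eq one_two_adic_int.rep_eq plus_two_adic_int.rep_eq mod_simps)

text \<open>Both a and b lie below 2^(a+b), so level a + b tells them apart. Characteristic 0 makes
  the halves and quarters in \<open>two_adic\<close> meaningful.\<close>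

instance two_adic_int :: ring_char_0
proof
  show "inj (of_nat :: nat \<Rightarrow> two_adic_int)"
  proof (rule injI)
    fix a b :: nat assume "(of_nat a :: two_adic_int) = of_nat b"
    then have "int a mod 2 ^ (a + b) = int b mod 2 ^ (a + b)"
      by (metis Rep_of_nat)
    moreover have "int a < 2 ^ (a + b)" "int b < 2 ^ (a + b)"
    proof -
      have "a + b < 2 ^ (a + b)" by (rule less_exp)
      then have "int (a + b) < 2 ^ (a + b)" by (metis of_nat_less_iff of_nat_numeral of_nat_power)
      then show "int a < 2 ^ (a + b)" "int b < 2 ^ (a + b)" by linarith+
    qed
    ultimately show "a = b" by simp
  qed
qed

instance fract :: ("{idom, ring_char_0}") field_char_0
proof
  have "(of_nat k :: 'a fract) = to_fract (of_nat k)" for k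
    by (induction k) simp_all
  then show "inj (of_nat :: nat \<Rightarrow> 'a fract)"
    by (auto intro!: injI)
qed

lemma not_two_adic_unit_2: "\<not> (2 :: two_adic_int) dvd 1"
proof
  assume "(2 :: two_adic_int) dvd 1"
  then obtain y :: two_adic_int where "1 = 2 * y" by (elim dvdE)
  then have "1 = y + y" by (simp only: mult_2)
  then have "Rep_two_adic_int 1 1 = Rep_two_adic_int (y + y) 1" by (rule arg_cong)
  then show False
    unfolding one_two_adic_int.rep_eq plus_two_adic_int.rep_eq power_one_right by presburger
qed

lemma Rep_dvd_pow2:
  assumes "2 ^ k dvd x"
  shows "Rep_two_adic_int x k = 0"
proof -
  obtain y where y: "x = of_nat (2 ^ k) * y" using assms by auto
  show ?thesis
    unfolding y times_two_adic_int.rep_eq Rep_of_nat by simp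
qed

text \<open>If every power of 2 divided \<open>x\<close>, all its residues would vanish. So there is
  a largest one, and the cofactor is odd, hence a unit.\<close>

lemma two_adic_int_decompose:
  assumes "x \<noteq> 0"
  obtains k u where "x = 2 ^ k * u" "u dvd (1 :: two_adic_int)"
proof -
  obtain N where N: "Rep_two_adic_int x N \<noteq> 0"
    using assms by (auto simp: Rep_two_adic_int_inject[symmetric] zero_two_adic_int.rep_eq fun_eq_iff)
  have "\<exists>k. 2 ^ k dvd x \<and> \<not> 2 ^ Suc k dvd x"
  proof (rule ccontr)
    assume a: "\<not> ?thesis"
    have "2 ^ k dvd x" for k by (induction k) (use a in auto)
    then show False using Rep_dvd_pow2 N by blast
  qed
  then obtain k u where k: "x = 2 ^ k * u" "\<not> 2 ^ Suc k dvd x" by (auto elim: dvdE)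
  then have "\<not> 2 dvd u" by (auto simp: mult_dvd_mono mult.commute)
  then have "u dvd 1" using two_adic_int_dvd_2_or_unit by blast
  with k that show ?thesis by blast
qed

text \<open>One more factor 2 would have to divide the unit. With
  \<open>two_adic_int_decompose\<close>, the parity of \<open>v2\<close> becomes the parity of an
  exponent.\<close>

lemma v2_pow2_unit:
  assumes "u dvd 1"
  shows "v2 (2 ^ k * u) = k"
proof -
  have u0: "u \<noteq> 0" using assms by auto
  have "2 ^ j dvd 2 ^ k * u \<longleftrightarrow> j \<le> k" for j
  proof
    assume a: "2 ^ j dvd 2 ^ k * u"
    show "j \<le> k"
    proof (rule ccontr)
      assume "\<not> j \<le> k"
      then have "(2::two_adic_int) ^ Suc k dvd 2 ^ j" by (intro le_imp_power_dvd) simp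
      with a have "2 ^ Suc k dvd 2 ^ k * u" using dvd_trans by blast
      then have "2 ^ k * 2 dvd 2 ^ k * u" by (simp add: mult.commute)
      then have "2 dvd u" by (subst (asm) dvd_mult_cancel_left) simp
      with assms have "(2 :: two_adic_int) dvd 1" using dvd_trans by blast
      then show False using not_two_adic_unit_2 by simp
    qed
  qed (simp add: dvd_mult2 le_imp_power_dvd)
  then have "{j. 2 ^ j dvd 2 ^ k * u} = {..k}" by auto
  then show ?thesis using u0 by (auto simp: v2_def intro!: Max_eqI)
qed

section \<open>Integrality in \<open>\<rat>\<^sub>2\<close>\<close>

abbreviation Z2 :: "two_adic set" where "Z2 \<equiv> two_adic_ints"

lemma to_fract_in_Z2 [simp, intro]: "to_fract x \<in> Z2"
  by (simp add: two_adic_ints_def)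

lemma Z2_0 [simp, intro]: "0 \<in> Z2" and Z2_1 [simp, intro]: "1 \<in> Z2"
  using to_fract_in_Z2[of 0] to_fract_in_Z2[of 1] by simp_all

lemma Z2_add [intro]: "x \<in> Z2 \<Longrightarrow> y \<in> Z2 \<Longrightarrow> x + y \<in> Z2"
  unfolding two_adic_ints_def by (auto simp flip: to_fract_add)

lemma Z2_mult [intro]: "x \<in> Z2 \<Longrightarrow> y \<in> Z2 \<Longrightarrow> x * y \<in> Z2"
  unfolding two_adic_ints_def by (auto simp flip: to_fract_mult)

lemma Z2_minus [intro]: "x \<in> Z2 \<Longrightarrow> - x \<in> Z2"
  unfolding two_adic_ints_def by (auto simp flip: to_fract_uminus)

lemma Z2_diff [intro]: "x \<in> Z2 \<Longrightarrow> y \<in> Z2 \<Longrightarrow> x - y \<in> Z2"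
  unfolding two_adic_ints_def by (auto simp flip: to_fract_diff)

lemma Z2_power [intro]: "x \<in> Z2 \<Longrightarrow> x ^ n \<in> Z2"
  by (induction n) auto

lemma to_fract_numeral [simp]: "to_fract (numeral n) = numeral n"
  by (induction n) (simp_all only: numeral.simps to_fract_add to_fract_1)

lemma Z2_numeral [simp, intro]: "numeral n \<in> Z2"
  using to_fract_in_Z2[of "numeral n"] by simp

lemma Z2_neg_1 [simp]: "- 1 \<in> Z2"
  using Z2_minus[OF Z2_1] .

lemma Z2_sum: "(\<And>i. i \<in> I \<Longrightarrow> f i \<in> Z2) \<Longrightarrow> sum f I \<in> Z2"
  by (induction I rule: infinite_finite_induct) auto

definition Z2_unit :: "two_adic \<Rightarrow> bool" where
  "Z2_unit x \<longleftrightarrow> x \<noteq> 0 \<and> x \<in> Z2 \<and> inverse x \<in> Z2"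

lemma Z2_unit_to_fract: "u dvd 1 \<Longrightarrow> Z2_unit (to_fract u)"
proof -
  assume "u dvd 1"
  then obtain v where v: "1 = u * v" by (elim dvdE)
  then have "to_fract u * to_fract v = 1" by (simp flip: to_fract_mult)
  then have "inverse (to_fract u) = to_fract v" by (rule inverse_unique)
  then show ?thesis using v by (auto simp: Z2_unit_def)
qed

lemma Z2_half_notin: "1 / 2 \<notin> Z2"
proof
  assume "1 / 2 \<in> Z2"
  then obtain x :: two_adic_int where "1 / 2 = to_fract x" by (auto simp: two_adic_ints_def)
  then have "1 = to_fract x + to_fract x" by (simp add: field_simps)
  then have "1 = x + x" by (metis to_fract_1 to_fract_add to_fract_eq_iff)
  then have "2 * x = 1" by simp
  then have "(2 :: two_adic_int) dvd 1" by (metis dvd_triv_left)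
  then show False using not_two_adic_unit_2 by simp
qed

lemma Z2_half_or_unit: "x \<in> Z2 \<Longrightarrow> x / 2 \<in> Z2 \<or> Z2_unit x"
proof -
  assume "x \<in> Z2"
  then obtain a where a: "x = to_fract a" by (auto simp: two_adic_ints_def)
  from two_adic_int_dvd_2_or_unit[of a] show ?thesis
  proof
    assume "2 dvd a"
    then obtain c where "a = c + c" by (auto elim: dvdE)
    then have "x / 2 = to_fract c" by (simp add: a)
    then show ?thesis by simp
  qed (use a Z2_unit_to_fract in auto)
qed

lemma Z2_unit_not_half: "Z2_unit x \<Longrightarrow> x / 2 \<notin> Z2"
proof
  assume "Z2_unit x" "x / 2 \<in> Z2"
  then have "inverse x * (x / 2) \<in> Z2" by (intro Z2_mult) (auto simp: Z2_unit_def)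
  moreover have "inverse x * (x / 2) = 1 / 2" using \<open>Z2_unit x\<close> by (simp add: Z2_unit_def)
  ultimately show False using Z2_half_notin by simp
qed

lemma Z2_unit_mult: "Z2_unit x \<Longrightarrow> Z2_unit y \<Longrightarrow> Z2_unit (x * y)"
  by (auto simp: Z2_unit_def)

lemma Z2_unit_minus [simp]: "Z2_unit (- x) \<longleftrightarrow> Z2_unit x"
  unfolding Z2_unit_def by (metis Z2_minus add.inverse_inverse inverse_minus_eq neg_equal_0_iff_equal)

lemma Z2_unit_1 [simp]: "Z2_unit 1" by (simp add: Z2_unit_def)

lemma Z2_unit_inverse [simp]: "Z2_unit (inverse x) \<longleftrightarrow> Z2_unit x"
  by (auto simp: Z2_unit_def)

lemma Z2_unit_in: "Z2_unit x \<Longrightarrow> x \<in> Z2" by (simp add: Z2_unit_def)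

lemma two_adic_decompose:
  assumes "x \<noteq> 0"
  obtains k :: int and u where "x = 2 powi k * u" "Z2_unit u"
proof -
  obtain a b where ab: "x = Fract a b" "b \<noteq> 0" by (cases x) auto
  then have x: "x = to_fract a / to_fract b" by (simp add: Fract_conv_to_fract)
  with assms have "a \<noteq> 0" by auto
  then obtain i u j v where "a = 2 ^ i * u" "u dvd 1" "b = 2 ^ j * v" "v dvd 1"
    using two_adic_int_decompose ab(2) by metis
  moreover have "to_fract (2 ^ i) = (2 :: two_adic) ^ i" for i
    by (induction i) simp_all
  ultimately have "x = 2 powi (int i - int j) * (to_fract u * inverse (to_fract v))"
    "Z2_unit (to_fract u * inverse (to_fract v))"
    by (simp add: x power_int_diff field_simps)
      (simp only: Z2_unit_mult Z2_unit_to_fract Z2_unit_inverse \<open>u dvd 1\<close> \<open>v dvd 1\<close>)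
  then show ?thesis using that by blast
qed

lemma Z2_valuation: "x \<in> Z2 \<or> inverse x \<in> Z2"
proof (cases "x = 0")
  case False
  then obtain k u where ku: "x = 2 powi k * u" "Z2_unit u" by (rule two_adic_decompose)
  show ?thesis
  proof (cases "k \<ge> 0")
    case True
    then have "x = 2 ^ nat k * u" by (simp add: ku power_int_def)
    then show ?thesis using ku by (auto simp: Z2_unit_def)
  next
    case False
    then have "inverse x = 2 ^ nat (- k) * inverse u"
      by (simp add: ku power_int_def field_simps)
    then show ?thesis using ku by (auto simp: Z2_unit_def)
  qed
qed simp

text \<open>If \<open>x\<close> were not integral, its inverse would be, and dividing x^2 u by x u
  would show that \<open>x\<close> is integral after all.\<close>

lemma Z2_square_unit_mult:
  assumes "x ^ 2 * u \<in> Z2" "Z2_unit u"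
  shows "x \<in> Z2"
proof (rule ccontr)
  assume x: "x \<notin> Z2"
  then have "inverse x \<in> Z2" using Z2_valuation by blast
  moreover have "inverse u \<in> Z2" "u \<noteq> 0" using assms(2) by (simp_all add: Z2_unit_def)
  ultimately have "(x ^ 2 * u) * inverse u * inverse x \<in> Z2" by (intro Z2_mult[OF Z2_mult[OF assms(1)]])
  also have "(x ^ 2 * u) * inverse u * inverse x = x"
    using \<open>u \<noteq> 0\<close> by (cases "x = 0") (simp_all add: power2_eq_square field_simps)
  finally show False using x by simp
qed

lemma Z2_half_or_half_pred:
  assumes "x \<in> Z2"
  shows "x / 2 \<in> Z2 \<or> (x - 1) / 2 \<in> Z2"
proof -
  obtain a where a: "x = to_fract a" using assms by (auto simp: two_adic_ints_def)
  from two_adic_int_even_or_odd[of a] show ?thesis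
  proof
    assume "2 dvd a"
    then obtain c where "a = c + c" by (auto elim: dvdE)
    then have "x / 2 = to_fract c" by (simp add: a)
    then show ?thesis by simp
  next
    assume "2 dvd a - 1"
    then obtain c where "a - 1 = c + c" by (auto elim: dvdE)
    then have "a = c + c + 1" by (simp add: algebra_simps)
    then have "(x - 1) / 2 = to_fract c" by (simp add: a)
    then show ?thesis by simp
  qed
qed

text \<open>The residue field has two elements, so two elements that are not divisible by 2 are both
  1 modulo 2.\<close>

lemma Z2_parity:
  assumes "x \<in> Z2" "y \<in> Z2"
  shows "(x - y) / 2 \<in> Z2 \<longleftrightarrow> (x / 2 \<in> Z2 \<longleftrightarrow> y / 2 \<in> Z2)"
proof -
  have *: "(x - y) / 2 = x / 2 - y / 2" "x / 2 = (x - y) / 2 + y / 2" "y / 2 = x / 2 - (x - y) / 2"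
    "(x - y) / 2 = (x - 1) / 2 - (y - 1) / 2"
    by (simp_all add: field_simps)
  show ?thesis
  proof (cases "x / 2 \<in> Z2"; cases "y / 2 \<in> Z2")
    assume "x / 2 \<notin> Z2" "y / 2 \<notin> Z2"
    then show ?thesis using assms Z2_half_or_half_pred *(4) Z2_diff by metis
  next
    assume "x / 2 \<in> Z2" "y / 2 \<notin> Z2"
    then show ?thesis using *(3) Z2_diff by metis
  next
    assume "x / 2 \<notin> Z2" "y / 2 \<in> Z2"
    then show ?thesis using *(2) Z2_add by metis
  next
    assume "x / 2 \<in> Z2" "y / 2 \<in> Z2"
    then show ?thesis using *(1) Z2_diff by metis
  qed
qed

lemma Z2_unit_parity: "x \<in> Z2 \<Longrightarrow> Z2_unit x \<longleftrightarrow> x / 2 \<notin> Z2"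
  using Z2_half_or_unit Z2_unit_not_half by blast

text \<open>For y = (x - 1)/2 the quotient is y (y + 1). Through this congruence a condition on
  square classes becomes one modulo 4.\<close>

lemma Z2_unit_square:
  assumes "Z2_unit x"
  shows "(x ^ 2 - 1) / 4 \<in> Z2"
proof -
  have "(x - 1) / 2 \<in> Z2"
    using Z2_half_or_half_pred[OF Z2_unit_in[OF assms]] Z2_unit_not_half[OF assms] by blast
  then have "(x - 1) / 2 * ((x - 1) / 2 + 1) \<in> Z2" by (intro Z2_mult Z2_add) simp_all
  also have "(x - 1) / 2 * ((x - 1) / 2 + 1) = (x ^ 2 - 1) / 4"
    by (simp add: field_simps power2_eq_square)
  finally show ?thesis .
qed

section \<open>Integral polynomials\<close>

text \<open>Divisibility in a valuation ring is total, so some element has least valuation. It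
  serves as the content in Gauss's lemma and as the pivot when a dependent generator of a lattice is
  removed.\<close>

lemma Z2_finite_generator:
  assumes "finite S" "x \<in> S" "x \<noteq> 0"
  obtains c where "c \<in> S" "c \<noteq> 0" "\<And>y. y \<in> S \<Longrightarrow> y / c \<in> Z2"
proof -
  have "\<exists>c\<in>S. c \<noteq> 0 \<and> (\<forall>y\<in>S. y / c \<in> Z2)" if "S - {0} \<noteq> {}" "finite S"
    using that(2,1)
  proof (induction S)
    case (insert a S)
    show ?case
    proof (cases "S - {0} = {}")
      case True
      with insert.prems have "a \<noteq> 0" by auto
      moreover have "y / a \<in> Z2" if "y \<in> S" for y using True that by auto
      ultimately show ?thesis by (intro bexI[of _ a]) auto
    next
      case False
      with insert.IH obtain c where c: "c \<in> S" "c \<noteq> 0" "\<forall>y\<in>S. y / c \<in> Z2" by blast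
      show ?thesis
      proof (cases "a / c \<in> Z2")
        case True
        then show ?thesis using c by (intro bexI[of _ c]) auto
      next
        case False
        then have a: "c / a \<in> Z2" "a \<noteq> 0" using Z2_valuation[of "a / c"] by auto
        have "y / a \<in> Z2" if "y \<in> S" for y
        proof -
          have "(y / c) * (c / a) \<in> Z2" using that c a by (intro Z2_mult) auto
          then show ?thesis using c by simp
        qed
        then show ?thesis using a by (intro bexI[of _ a]) auto
      qed
    qed
  qed simp
  with assms that show ?thesis by blast
qed

definition zpoly :: "two_adic poly \<Rightarrow> bool" where
  "zpoly p \<longleftrightarrow> (\<forall>i. coeff p i \<in> Z2)"

lemma zpoly_coeff: "zpoly p \<Longrightarrow> coeff p i \<in> Z2"
  by (simp add: zpoly_def)

lemma zpoly_0 [simp]: "zpoly 0" and zpoly_1 [simp]: "zpoly 1"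
  by (auto simp: zpoly_def coeff_1)

lemma zpoly_pCons [simp]: "zpoly (pCons a p) \<longleftrightarrow> a \<in> Z2 \<and> zpoly p"
  unfolding zpoly_def coeff_pCons by (auto split: nat.splits simp: all_conj_distrib)

lemma zpoly_add: "zpoly p \<Longrightarrow> zpoly q \<Longrightarrow> zpoly (p + q)"
  and zpoly_diff: "zpoly p \<Longrightarrow> zpoly q \<Longrightarrow> zpoly (p - q)"
  and zpoly_minus: "zpoly p \<Longrightarrow> zpoly (- p)"
  and zpoly_smult: "c \<in> Z2 \<Longrightarrow> zpoly p \<Longrightarrow> zpoly (smult c p)"
  by (auto simp: zpoly_def)

lemma zpoly_mult: "zpoly p \<Longrightarrow> zpoly q \<Longrightarrow> zpoly (p * q)"
  unfolding zpoly_def coeff_mult by (intro allI Z2_sum Z2_mult) auto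

lemma zpoly_power: "zpoly p \<Longrightarrow> zpoly (p ^ n)"
  by (induction n) (auto intro: zpoly_mult)

lemma zpoly_monom: "c \<in> Z2 \<Longrightarrow> zpoly (Polynomial.monom c n)"
  by (auto simp: zpoly_def coeff_monom)

lemma zpoly_poly: "zpoly p \<Longrightarrow> x \<in> Z2 \<Longrightarrow> poly p x \<in> Z2"
  unfolding poly_altdef by (intro Z2_sum Z2_mult Z2_power) (auto simp: zpoly_def)

lemma zpoly_pcompose: "zpoly p \<Longrightarrow> zpoly q \<Longrightarrow> zpoly (pcompose p q)"
  by (induction p) (auto simp: pcompose_pCons intro: zpoly_add zpoly_mult)

lemma zpoly_fract_poly [simp]: "zpoly (fract_poly p)"
  by (simp add: zpoly_def coeff_map_poly)

lemma zpoly_imp_fract_poly: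
  assumes "zpoly p"
  obtains q where "p = fract_poly q"
proof -
  define c where "c x = (SOME y. x = to_fract y)" for x :: two_adic
  have c: "to_fract (c x) = x" if "x \<in> Z2" for x
    using that someI[of "\<lambda>y. x = to_fract y"] unfolding c_def two_adic_ints_def by auto
  have "c 0 = 0" using c[of 0] by simp
  then have "p = fract_poly (map_poly c p)"
    using assms by (intro poly_eqI) (simp add: coeff_map_poly c zpoly_def)
  then show ?thesis by (rule that)
qed

lemma zpoly_mod_monic:
  assumes "zpoly F" "lead_coeff F = 1" "zpoly p"
  shows "zpoly (p mod F)"
  using assms(3)
proof (induction "degree p" arbitrary: p rule: less_induct)
  case less
  show ?case
  proof (cases "degree p < degree F \<or> p = 0")
    case True
    then show ?thesis using less by (auto simp: mod_poly_less)
  next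
    case False
    show ?thesis
    proof (cases "degree F = 0")
      case True
      then obtain c where "F = [:c:]" by (rule degree_eq_zeroE)
      then have "F = 1" using assms(2) by (simp add: one_pCons)
      then show ?thesis by simp
    next
      case False2: False
      define q where "q = p - Polynomial.monom (lead_coeff p) (degree p - degree F) * F"
      have "zpoly q" unfolding q_def
        using less.prems assms(1) by (intro zpoly_diff zpoly_mult zpoly_monom) (auto simp: zpoly_def)
      have "degree q < degree p"
      proof -
        let ?m = "Polynomial.monom (lead_coeff p) (degree p - degree F) * F"
        have nz: "F \<noteq> 0" "lead_coeff p \<noteq> 0" using assms(2) False by auto
        have m: "degree (Polynomial.monom (lead_coeff p) (degree p - degree F)) = degree p - degree F"
          using nz(2) by (rule Polynomial.degree_monom_eq)
        have "Polynomial.monom (lead_coeff p) (degree p - degree F) \<noteq> 0"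
          using nz(2) by (simp only: monom_eq_0_iff not_False_eq_True)
        then have "degree ?m = (degree p - degree F) + degree F"
          using degree_mult_eq nz(1) m by metis
        then have "degree ?m = degree p" using False by simp
        moreover have "lead_coeff ?m = lead_coeff p"
          by (simp only: lead_coeff_mult assms(2) lead_coeff_monom mult_1_right)
        ultimately have "degree q \<le> degree p" "coeff q (degree p) = 0"
          unfolding q_def by (auto intro: degree_diff_le)
        moreover have "degree p > 0" using False False2 by auto
        ultimately show ?thesis
          by (metis degree_0 eq_zero_or_degree_less)
      qed
      then have "zpoly (q mod F)" using less.hyps \<open>zpoly q\<close> by blast
      also have "q mod F = p mod F" unfolding q_def
        by (simp add: mod_eq_dvd_iff)
      finally show ?thesis .
    qed
  qed
qed

text \<open>Gauss's lemma. If i and j are the first positions of a unit coefficient, every other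
  summand of the coefficient of the product at i + j contains a factor divisible by 2.\<close>

lemma zpoly_primitive_mult:
  assumes "zpoly p" "zpoly q" "\<exists>i. Z2_unit (coeff p i)" "\<exists>j. Z2_unit (coeff q j)"
  shows "\<exists>k. Z2_unit (coeff (p * q) k)"
proof -
  define i where "i = (LEAST i. Z2_unit (coeff p i))"
  define j where "j = (LEAST j. Z2_unit (coeff q j))"
  have i: "Z2_unit (coeff p i)" "\<And>k. k < i \<Longrightarrow> coeff p k / 2 \<in> Z2"
    using LeastI_ex[OF assms(3)] not_less_Least zpoly_coeff[OF assms(1)] Z2_half_or_unit
    unfolding i_def by blast+
  have j: "Z2_unit (coeff q j)" "\<And>k. k < j \<Longrightarrow> coeff q k / 2 \<in> Z2"
    using LeastI_ex[OF assms(4)] not_less_Least zpoly_coeff[OF assms(2)] Z2_half_or_unit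
    unfolding j_def by blast+
  define t where "t k = coeff p k * coeff q (i + j - k)" for k
  have t: "t k / 2 \<in> Z2" if "k \<le> i + j" "k \<noteq> i" for k
  proof (cases "k < i")
    case True
    then have "(coeff p k / 2) * coeff q (i + j - k) \<in> Z2"
      using i assms by (intro Z2_mult) (auto simp: zpoly_def)
    then show ?thesis by (simp add: t_def)
  next
    case False
    then have "coeff p k * (coeff q (i + j - k) / 2) \<in> Z2"
      using j that assms by (intro Z2_mult) (auto simp: zpoly_def)
    then show ?thesis by (simp add: t_def)
  qed
  have "coeff (p * q) (i + j) = t i + (\<Sum>k\<in>{..i+j} - {i}. t k)"
    unfolding coeff_mult t_def by (subst sum.remove[of _ i]) auto
  also have "\<dots> = t i + 2 * (\<Sum>k\<in>{..i+j} - {i}. t k / 2)"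
    by (simp add: sum_divide_distrib[symmetric])
  finally have eq: "coeff (p * q) (i + j) = t i + 2 * (\<Sum>k\<in>{..i+j} - {i}. t k / 2)" .
  have s: "(\<Sum>k\<in>{..i+j} - {i}. t k / 2) \<in> Z2" using t by (intro Z2_sum) auto
  have "Z2_unit (t i)" using i j by (simp add: t_def Z2_unit_mult)
  then have ti: "t i / 2 \<notin> Z2" by (rule Z2_unit_not_half)
  have "coeff (p * q) (i + j) / 2 \<notin> Z2"
  proof
    assume "coeff (p * q) (i + j) / 2 \<in> Z2"
    then have "coeff (p * q) (i + j) / 2 - (\<Sum>k\<in>{..i+j} - {i}. t k / 2) \<in> Z2" using s by blast
    then show False using ti by (simp add: eq add_divide_distrib)
  qed
  then show ?thesis using Z2_half_or_unit zpoly_coeff[OF zpoly_mult[OF assms(1,2)]] by blast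
qed

lemma zpoly_primitive_multiple:
  assumes "p \<noteq> 0"
  obtains c where "c \<noteq> 0" "zpoly (smult c p)" "\<exists>i. Z2_unit (coeff (smult c p) i)"
proof -
  obtain d where d: "d \<in> coeff p ` {..degree p}" "d \<noteq> 0"
    "\<And>y. y \<in> coeff p ` {..degree p} \<Longrightarrow> y / d \<in> Z2"
    by (rule Z2_finite_generator[of "coeff p ` {..degree p}" "lead_coeff p"]) (use assms in auto)
  have "coeff p i / d \<in> Z2" for i
    by (cases "i \<le> degree p") (auto intro: d(3) simp: coeff_eq_0)
  then have "zpoly (smult (inverse d) p)"
    by (auto simp: zpoly_def field_simps)
  moreover from d(1) obtain i where "coeff p i = d" by auto
  then have "coeff (smult (inverse d) p) i = 1" using d(2) by simp
  ultimately show ?thesis using that[of "inverse d"] d(2) by (metis Z2_unit_1 inverse_nonzero_iff_nonzero)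
qed

text \<open>Rescale the factors to primitive c p and d q. As q is monic, d is integral. The product
  is primitive, so c d x is a unit for some coefficient x of p q, and 1/c = d x / (c d x) is
  integral.\<close>

lemma zpoly_monic_factor:
  assumes "lead_coeff p = 1" "lead_coeff q = 1" "zpoly (p * q)"
  shows "zpoly p"
proof -
  have "p \<noteq> 0" "q \<noteq> 0" using assms by auto
  then obtain c d where c: "c \<noteq> 0" "zpoly (smult c p)" "\<exists>i. Z2_unit (coeff (smult c p) i)"
    and d: "d \<noteq> 0" "zpoly (smult d q)" "\<exists>i. Z2_unit (coeff (smult d q) i)"
    by (metis zpoly_primitive_multiple)
  obtain k where k: "Z2_unit (coeff (smult c p * smult d q) k)"
    using zpoly_primitive_mult[OF c(2) d(2) c(3) d(3)] by blast
  define x where "x = coeff (p * q) k"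
  have "coeff (smult d q) (degree q) \<in> Z2" using d(2) by (rule zpoly_coeff)
  then have "d \<in> Z2" using assms(2) by simp
  moreover have "x \<in> Z2" using assms(3) by (simp add: x_def zpoly_coeff)
  moreover have u: "Z2_unit (c * (d * x))" using k by (simp add: x_def mult_ac)
  ultimately have "(d * x) * inverse (c * (d * x)) \<in> Z2" by (auto simp: Z2_unit_def)
  also have "(d * x) * inverse (c * (d * x)) = inverse c"
    using u by (auto simp: Z2_unit_def field_simps)
  finally have "zpoly (smult (inverse c) (smult c p))"
    using c(2) by (rule zpoly_smult)
  then show ?thesis using c(1) by simp
qed

text \<open>The factors of f are irreducible over the integers, while the coprimality arguments run
  over the field. Factors over the field are made monic and are then integral by
  \<open>zpoly_monic_factor\<close>.\<close>

lemma irreducible_fract_poly: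
  assumes "irreducible p" "lead_coeff p = (1 :: two_adic_int)"
  shows "irreducible (fract_poly p)"
proof (rule irreducibleI)
  show "fract_poly p \<noteq> 0" using assms by auto
  have deg: "degree (fract_poly p) = degree p" by (rule degree_map_poly) simp
  show "\<not> fract_poly p dvd 1"
  proof
    assume "fract_poly p dvd 1"
    then have "degree p = 0" using deg by (auto simp: is_unit_poly_iff)
    then obtain c where "p = [:c:]" by (rule degree_eq_zeroE)
    then have "p = 1" using assms(2) by (simp add: one_pCons)
    then show False using assms(1) by simp
  qed
  fix a b assume ab: "fract_poly p = a * b"
  have lc: "lead_coeff a * lead_coeff b = 1"
    using assms(2) deg lead_coeff_mult[of a b] unfolding ab[symmetric] by (simp add: coeff_map_poly)
  then have nz: "lead_coeff a \<noteq> 0" "lead_coeff b \<noteq> 0" by auto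
  define a' b' where "a' = smult (inverse (lead_coeff a)) a"
    and "b' = smult (inverse (lead_coeff b)) b"
  have ab': "fract_poly p = a' * b'"
    using lc by (simp add: a'_def b'_def ab inverse_mult_distrib[symmetric] mult.commute)
  have monic: "lead_coeff a' = 1" "lead_coeff b' = 1" using nz by (simp_all add: a'_def b'_def)
  have "zpoly a'" using zpoly_monic_factor[OF monic] ab' by (metis zpoly_fract_poly)
  moreover have "zpoly b'" using zpoly_monic_factor[OF monic(2,1)] ab' by (metis zpoly_fract_poly mult.commute)
  ultimately obtain A B where AB: "a' = fract_poly A" "b' = fract_poly B"
    by (metis zpoly_imp_fract_poly)
  then have "fract_poly p = fract_poly (A * B)" using ab' by simp
  then have "p = A * B" by (simp only: fract_poly_eq_iff)
  then have "A dvd 1 \<or> B dvd 1" using assms(1) irreducibleD by blast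
  then have "degree A = 0 \<or> degree B = 0" by (auto simp: is_unit_poly_iff)
  moreover have "degree A = degree a" "degree B = degree b"
    using AB nz by (auto simp: a'_def b'_def degree_map_poly dest!: arg_cong[of _ _ degree])
  ultimately show "a dvd 1 \<or> b dvd 1"
    using nz by (metis is_unit_iff_degree leading_coeff_0_iff)
qed

section \<open>The cyclic module \<open>K[X]/(F)\<close>\<close>

abbreviation Xp :: "two_adic poly" where "Xp \<equiv> [:0, 1:]"

text \<open>Products with \<open>Xp\<close> must stay products, because the congruence rules modulo
  F match on them.\<close>

declare mult_pCons_left [simp del] mult_pCons_right [simp del]

lemma smult_half_two [simp]:
  "smult (1/2) (2 * p) = (p :: two_adic poly)" "smult (1/2) (2 :: two_adic poly) = 1"
proof -
  show *: "smult (1/2) (2 * p) = p" for p :: "two_adic poly"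
    unfolding mult_2 smult_add_right by (subst smult_add_left[symmetric]) simp
  show "smult (1/2) (2 :: two_adic poly) = 1" using *[of 1] by simp
qed

lemma zpoly_synthetic_div: "zpoly p \<Longrightarrow> c \<in> Z2 \<Longrightarrow> zpoly (synthetic_div p c)"
  by (induction p) (auto intro: zpoly_poly)

text \<open>The points 1 and -1 agree modulo 2, hence so do the two quotients. This is the source of
  the lattice vectors that involve halves of both poles.\<close>

lemma zpoly_half_synthetic_div_diff:
  assumes "zpoly p"
  shows "zpoly (smult (1/2) (synthetic_div p 1 - synthetic_div p (- 1)))"
  using assms
proof (induction p)
  case (pCons a p)
  have half: "zpoly p \<Longrightarrow> (poly p 1 - poly p (- 1)) / 2 \<in> Z2" for p
  proof (induction p)
    case (pCons a p)
    have "(poly p 1 - poly p (- 1)) / 2 + poly p (- 1) \<in> Z2"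
      using pCons by (intro Z2_add zpoly_poly) auto
    then show ?case by (simp add: field_simps)
  qed simp
  then show ?case using pCons by (simp add: field_simps)
qed simp

text \<open>Since F(1) is nonzero, \<open>*\<close>-symmetry forces F(0) = 1, so it amounts to being
  palindromic; F(-1) nonzero makes the degree even (see \<open>star_fixed_reflect\<close>).\<close>

locale sym_poly =
  fixes F :: "two_adic poly" and n :: nat
  assumes zF: "zpoly F" and monic: "lead_coeff F = 1" and deg: "degree F = 2 * n" and n0: "n > 0"
    and reflect: "reflect_poly F = F" and F1: "poly F 1 \<noteq> 0" and Fm1: "poly F (- 1) \<noteq> 0"
begin

section \<open>Congruence modulo F, the inverse of X and the involution X -> 1/X\<close>

definition eqv (infix "\<approx>" 50) where "a \<approx> b \<longleftrightarrow> a mod F = b mod F"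

lemma eqv_refl [simp]: "a \<approx> a"
  and eqv_sym: "a \<approx> b \<Longrightarrow> b \<approx> a"
  and eqv_trans [trans]: "a \<approx> b \<Longrightarrow> b \<approx> c \<Longrightarrow> a \<approx> c"
  by (simp_all add: eqv_def)

lemma eqv_add: "a \<approx> a' \<Longrightarrow> b \<approx> b' \<Longrightarrow> a + b \<approx> a' + b'"
  and eqv_diff: "a \<approx> a' \<Longrightarrow> b \<approx> b' \<Longrightarrow> a - b \<approx> a' - b'"
  and eqv_mult: "a \<approx> a' \<Longrightarrow> b \<approx> b' \<Longrightarrow> a * b \<approx> a' * b'"
  and eqv_minus: "a \<approx> a' \<Longrightarrow> - a \<approx> - a'"
  unfolding eqv_def by (fact mod_add_cong mod_diff_cong mod_mult_cong mod_minus_cong)+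

lemma eqv_smult: "a \<approx> b \<Longrightarrow> smult c a \<approx> smult c b"
  by (simp add: eqv_def mod_smult_left)

lemma eqv_pow: "a \<approx> b \<Longrightarrow> a ^ k \<approx> b ^ k"
  by (induction k) (simp_all add: eqv_mult)

lemma eqv_sum: "(\<And>i. i \<in> I \<Longrightarrow> f i \<approx> g i) \<Longrightarrow> sum f I \<approx> sum g I"
  by (induction I rule: infinite_finite_induct) (simp_all add: eqv_add)

lemma eqv_iff_dvd: "a \<approx> b \<longleftrightarrow> F dvd a - b"
  by (simp add: eqv_def mod_eq_dvd_iff)

lemma eqv_F: "F \<approx> 0" by (simp add: eqv_def)

lemma eqv_mod: "a mod F \<approx> a" by (simp add: eqv_def)

lemma coeff_F_0: "coeff F 0 = 1"
  using coeff_reflect_poly[of F 0] monic by (simp add: reflect)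

text \<open>With constant term 1, F = 1 + X G, and -G inverts X modulo F. As the inverse is an
  integral polynomial, the involution \<open>bar\<close> is a substitution that preserves
  integrality.\<close>

definition Xi :: "two_adic poly" where "Xi = - (poly_shift 1 F)"

lemma X_mult_Xi_eq: "Xp * Xi = 1 - F"
proof -
  obtain c G where G: "F = pCons c G" by (cases F)
  then have c: "c = 1" using coeff_F_0 by simp
  have "poly_shift 1 F = G" by (intro poly_eqI) (simp add: coeff_poly_shift G)
  then have Xi: "Xi = - G" unfolding Xi_def by (rule arg_cong)
  show ?thesis unfolding Xi unfolding G c by (simp add: one_pCons mult_pCons_left)
qed

lemma X_Xi: "Xp * Xi \<approx> 1"
  unfolding X_mult_Xi_eq using eqv_diff[OF eqv_refl eqv_F, of 1] by simp

lemma zpoly_Xi: "zpoly Xi"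
  using zF by (auto simp: Xi_def zpoly_def coeff_poly_shift)

lemma X_Xi_power: "Xp ^ k * Xi ^ k \<approx> 1"
  using eqv_pow[OF X_Xi, of k] by (simp only: power_mult_distrib power_one)

lemma Xi_power_X_power:
  assumes "i \<le> m"
  shows "Xp ^ m * Xi ^ i \<approx> Xp ^ (m - i)"
proof -
  have "Xp ^ m * Xi ^ i = Xp ^ (m - i) * (Xp ^ i * Xi ^ i)"
    using assms by (simp add: mult.assoc[symmetric] flip: power_add)
  also have "\<dots> \<approx> Xp ^ (m - i) * 1" by (intro eqv_mult X_Xi_power eqv_refl)
  finally show ?thesis by simp
qed

lemma Xi_power_X_power':
  assumes "i \<le> m"
  shows "Xp ^ i * Xi ^ m \<approx> Xi ^ (m - i)"
proof -
  have "Xp ^ i * Xi ^ m = Xi ^ (m - i) * (Xp ^ i * Xi ^ i)"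
    using assms by (simp add: mult.left_commute flip: power_add)
  also have "\<dots> \<approx> Xi ^ (m - i) * 1" by (intro eqv_mult X_Xi_power eqv_refl)
  finally show ?thesis by simp
qed

definition bar :: "two_adic poly \<Rightarrow> two_adic poly" where "bar h = pcompose h Xi"

lemma bar_simps [simp]: "bar (a + b) = bar a + bar b" "bar (a - b) = bar a - bar b"
  "bar (- a) = - bar a" "bar (a * b) = bar a * bar b" "bar 0 = 0"
  "bar (smult c a) = smult c (bar a)" "bar Xp = Xi" "bar 1 = 1"
  by (simp_all add: bar_def pcompose_add pcompose_diff pcompose_uminus pcompose_mult pcompose_smult
      pcompose_pCons) (simp add: bar_def one_pCons pcompose_pCons)

lemma bar_const [simp]: "bar [:c:] = [:c:]"
  by (simp add: bar_def pcompose_pCons)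

lemma bar_power [simp]: "bar (a ^ k) = bar a ^ k"
  by (induction k) simp_all

lemma zpoly_bar: "zpoly h \<Longrightarrow> zpoly (bar h)"
  by (simp add: bar_def zpoly_pcompose zpoly_Xi)

text \<open>X^(2n) F(1/X) is the reversal of F, that is F itself; cancelling the unit X^(2n) gives
  the claim. It makes \<open>bar\<close> well defined modulo F.\<close>

lemma bar_F: "bar F \<approx> 0"
proof -
  have Fs: "F = (\<Sum>i\<le>2*n. [:coeff F i:] * Xp ^ i)"
    using poly_as_sum_of_monoms[of F] by (simp add: monom_altdef deg mult_pCons_left)
  have bs: "bar (\<Sum>i\<in>I. [:c i:] * Xp ^ i) = (\<Sum>i\<in>I. [:c i:] * Xi ^ i)" for c and I :: "nat set"
    by (induction I rule: infinite_finite_induct) simp_all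
  have bF: "bar F = (\<Sum>i\<le>2*n. [:coeff F i:] * Xi ^ i)"
    using arg_cong[OF Fs, of bar] unfolding bs .
  have 1: "Xp ^ (2 * n) * bar F = (\<Sum>i\<le>2*n. [:coeff F i:] * (Xp ^ (2 * n) * Xi ^ i))"
    unfolding bF sum_distrib_left by (intro sum.cong refl) (simp only: mult_ac)
  have 2: "(\<Sum>i\<le>2*n. [:coeff F i:] * (Xp ^ (2 * n) * Xi ^ i)) \<approx> (\<Sum>i\<le>2*n. [:coeff F i:] * Xp ^ (2 * n - i))"
    by (intro eqv_sum eqv_mult Xi_power_X_power eqv_refl) auto
  have 3: "(\<Sum>i\<le>2*n. [:coeff F i:] * Xp ^ (2 * n - i)) = (\<Sum>i\<le>2*n. [:coeff F i:] * Xp ^ i)"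
  proof -
    have c: "coeff F (2 * n - i) = coeff F i" if "i \<le> 2 * n" for i
      using coeff_reflect_poly[of F i] that unfolding reflect deg by simp
    show ?thesis
      by (rule sum.reindex_bij_witness[of _ "\<lambda>i. 2 * n - i" "\<lambda>i. 2 * n - i"])
        (simp_all add: c)
  qed
  have *: "Xp ^ (2 * n) * bar F \<approx> 0"
    unfolding 1 by (rule eqv_trans[OF 2]) (simp only: 3 Fs[symmetric] eqv_F)
  have "bar F = 1 * bar F" by simp
  also have "\<dots> \<approx> (Xp ^ (2 * n) * Xi ^ (2 * n)) * bar F"
    by (intro eqv_mult eqv_sym[OF X_Xi_power] eqv_refl)
  also have "\<dots> = Xi ^ (2 * n) * (Xp ^ (2 * n) * bar F)" by (simp add: mult_ac)
  also have "\<dots> \<approx> Xi ^ (2 * n) * 0" by (intro eqv_mult * eqv_refl)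
  finally show ?thesis by simp
qed

lemma bar_cong: "a \<approx> b \<Longrightarrow> bar a \<approx> bar b"
proof -
  assume "a \<approx> b"
  then obtain c where "a - b = F * c" unfolding eqv_iff_dvd by (elim dvdE)
  then have "a = b + F * c" by (simp add: algebra_simps)
  then have "bar a = bar b + bar F * bar c" by simp
  also have "\<dots> \<approx> bar b + 0 * bar c" by (intro eqv_add eqv_mult bar_F eqv_refl)
  finally show ?thesis by simp
qed

lemma bar_Xi: "bar Xi \<approx> Xp"
proof -
  have "Xi * bar Xi = 1 - bar F" using arg_cong[OF X_mult_Xi_eq, of bar] by simp
  also have "\<dots> \<approx> 1 - 0" by (intro eqv_diff bar_F eqv_refl)
  finally have *: "Xi * bar Xi \<approx> 1" by simp
  have "bar Xi = 1 * bar Xi" by simp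
  also have "\<dots> \<approx> (Xp * Xi) * bar Xi" by (intro eqv_mult eqv_sym[OF X_Xi] eqv_refl)
  also have "\<dots> = Xp * (Xi * bar Xi)" by (simp add: mult_ac)
  also have "\<dots> \<approx> Xp * 1" by (intro eqv_mult * eqv_refl)
  finally show ?thesis by simp
qed

lemma bar_bar: "bar (bar h) \<approx> h"
proof (induction h)
  case (pCons a h)
  have eq: "pCons a h = [:a:] + Xp * h" by (simp add: mult_pCons_left)
  have "bar (bar (pCons a h)) = [:a:] + bar Xi * bar (bar h)" unfolding eq by simp
  also have "\<dots> \<approx> [:a:] + Xp * h" by (intro eqv_add eqv_mult bar_Xi pCons eqv_refl)
  finally show ?case unfolding eq .
qed simp

section \<open>The functional \<open>lam\<close> and the even form \<open>bil\<close>\<close>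

definition top_coeff :: "two_adic poly \<Rightarrow> two_adic" where
  "top_coeff y = coeff (y mod F) (2 * n - 1)"

lemma top_coeff_simps [simp]:
  "top_coeff (a + b) = top_coeff a + top_coeff b" "top_coeff (a - b) = top_coeff a - top_coeff b"
  "top_coeff (- a) = - top_coeff a" "top_coeff (smult c a) = c * top_coeff a" "top_coeff 0 = 0"
  by (simp_all add: top_coeff_def poly_mod_add_left poly_mod_diff_left mod_smult_left poly_mod_minus_left)

lemma top_coeff_cong: "a \<approx> b \<Longrightarrow> top_coeff a = top_coeff b"
  by (simp add: top_coeff_def eqv_def)

lemma top_coeff_zpoly: "zpoly a \<Longrightarrow> top_coeff a \<in> Z2"
  by (simp add: top_coeff_def zpoly_coeff zpoly_mod_monic zF monic)

lemma top_coeff_small: "degree a < 2 * n \<Longrightarrow> top_coeff a = coeff a (2 * n - 1)"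
  by (simp add: top_coeff_def mod_poly_less deg)

lemma top_coeff_X_power: "k < 2 * n \<Longrightarrow> top_coeff (Xp ^ k) = (if k = 2 * n - 1 then 1 else 0)"
proof -
  assume "k < 2 * n"
  moreover have "Xp ^ k = Polynomial.monom 1 k" by (simp add: monom_altdef)
  ultimately show ?thesis by (simp add: top_coeff_small Polynomial.degree_monom_eq)
qed

definition lam :: "two_adic poly \<Rightarrow> two_adic" where "lam y = top_coeff (Xp ^ (n - 1) * y)"

lemma lam_simps [simp]: "lam (a + b) = lam a + lam b" "lam (a - b) = lam a - lam b"
  "lam (- a) = - lam a" "lam (smult c a) = c * lam a" "lam 0 = 0"
  by (simp_all add: lam_def algebra_simps)

lemma lam_sum: "lam (sum f I) = (\<Sum>i\<in>I. lam (f i))"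
  by (induction I rule: infinite_finite_induct) simp_all

lemma lam_cong: "a \<approx> b \<Longrightarrow> lam a = lam b"
  unfolding lam_def by (intro top_coeff_cong eqv_mult eqv_refl)

lemma lam_zpoly: "zpoly a \<Longrightarrow> lam a \<in> Z2"
  unfolding lam_def by (intro top_coeff_zpoly zpoly_mult zpoly_power) auto

lemma top_coeff_Xi: "top_coeff Xi = - 1"
proof -
  have "degree Xi \<le> 2 * n - 1"
    by (rule degree_le) (auto simp: Xi_def coeff_poly_shift deg intro!: coeff_eq_0)
  then have "degree Xi < 2 * n" using n0 by simp
  moreover have "coeff Xi (2 * n - 1) = - 1"
    using n0 monic by (simp add: Xi_def coeff_poly_shift deg)
  ultimately show ?thesis by (simp add: top_coeff_small)
qed

text \<open>These vectors are X^(1-n), ..., X^n, and \<open>lam\<close> vanishes on all but the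
  last. Inversion permutes all but X^n among themselves and sends X^n to X^(-n), where
  \<open>top_coeff_Xi\<close> gives -1.\<close>

lemma lam_bar_X_power:
  assumes "j < 2 * n"
  shows "lam (bar (Xi ^ (n - 1) * Xp ^ j)) = - lam (Xi ^ (n - 1) * Xp ^ j)"
proof -
  have "Xp ^ (n - 1) * (Xi ^ (n - 1) * Xp ^ j) = (Xp ^ (n - 1) * Xi ^ (n - 1)) * Xp ^ j"
    by (simp only: mult.assoc)
  also have "\<dots> \<approx> 1 * Xp ^ j" by (intro eqv_mult X_Xi_power eqv_refl)
  finally have 1: "lam (Xi ^ (n - 1) * Xp ^ j) = (if j = 2 * n - 1 then 1 else 0)"
    unfolding lam_def using top_coeff_X_power[OF assms] top_coeff_cong by simp
  have "Xp ^ (n - 1) * bar (Xi ^ (n - 1) * Xp ^ j) = Xp ^ (n - 1) * (bar Xi ^ (n - 1) * Xi ^ j)"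
    by simp
  also have "\<dots> \<approx> Xp ^ (n - 1) * (Xp ^ (n - 1) * Xi ^ j)"
    by (intro eqv_mult eqv_pow bar_Xi eqv_refl)
  also have "\<dots> = Xp ^ (2 * n - 2) * Xi ^ j"
    using n0 by (simp add: mult.assoc[symmetric] flip: power_add) (simp add: mult_2 numeral_2_eq_2)
  finally have 2: "lam (bar (Xi ^ (n - 1) * Xp ^ j)) = top_coeff (Xp ^ (2 * n - 2) * Xi ^ j)"
    unfolding lam_def by (rule top_coeff_cong)
  show ?thesis
  proof (cases "j = 2 * n - 1")
    case True
    have "Xp ^ (2 * n - 2) * Xi ^ j \<approx> Xi ^ (j - (2 * n - 2))"
      using True by (intro Xi_power_X_power') auto
    also have "j - (2 * n - 2) = 1" using True n0 by simp
    finally show ?thesis using 1 2 True top_coeff_cong top_coeff_Xi by fastforce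
  next
    case False
    have "Xp ^ (2 * n - 2) * Xi ^ j \<approx> Xp ^ (2 * n - 2 - j)"
      using False assms by (intro Xi_power_X_power) auto
    then have "top_coeff (Xp ^ (2 * n - 2) * Xi ^ j) = 0"
      using top_coeff_cong top_coeff_X_power[of "2 * n - 2 - j"] n0 by auto
    then show ?thesis using 1 2 False by simp
  qed
qed

lemma lam_bar: "lam (bar y) = - lam y"
proof -
  define z where "z = (Xp ^ (n - 1) * y) mod F"
  have "degree z < 2 * n"
    using degree_mod_less'[of F "Xp ^ (n - 1) * y"] deg n0 unfolding z_def by fastforce
  then have z: "z = (\<Sum>j<2*n. smult (coeff z j) (Xp ^ j))"
    using n0 by (subst poly_as_sum_of_monoms'[of z "2 * n - 1", symmetric])
      (auto simp: monom_altdef lessThan_Suc_atMost[symmetric] intro!: sum.cong)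
  have "y = 1 * y" by simp
  also have "\<dots> \<approx> (Xp ^ (n - 1) * Xi ^ (n - 1)) * y" by (intro eqv_mult eqv_sym[OF X_Xi_power] eqv_refl)
  also have "\<dots> = Xi ^ (n - 1) * (Xp ^ (n - 1) * y)" by (simp add: mult_ac)
  also have "\<dots> \<approx> Xi ^ (n - 1) * z" by (intro eqv_mult eqv_refl) (simp add: z_def eqv_def)
  finally have y: "y \<approx> Xi ^ (n - 1) * z" .
  define g where "g j = Xi ^ (n - 1) * Xp ^ j" for j
  have s: "Xi ^ (n - 1) * z = (\<Sum>j<2*n. smult (coeff z j) (g j))"
    by (subst z) (simp add: sum_distrib_left g_def)
  have bs: "bar (\<Sum>j\<in>J. smult (c j) (g j)) = (\<Sum>j\<in>J. smult (c j) (bar (g j)))" for J and c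
    by (induction J rule: infinite_finite_induct) simp_all
  have "lam (bar y) = lam (bar (Xi ^ (n - 1) * z))" by (intro lam_cong bar_cong y)
  also have "\<dots> = (\<Sum>j<2*n. coeff z j * lam (bar (g j)))" by (simp only: s bs lam_sum lam_simps)
  also have "\<dots> = (\<Sum>j<2*n. coeff z j * - lam (g j))"
    by (intro sum.cong refl) (simp only: g_def lam_bar_X_power lessThan_iff)
  also have "\<dots> = - lam (Xi ^ (n - 1) * z)" by (simp only: s lam_sum lam_simps sum_negf mult_minus_right)
  also have "\<dots> = - lam y" using lam_cong[OF y] by simp
  finally show ?thesis .
qed

lemma lam_1: "lam 1 = 0"
  using lam_bar[of 1] by simp

definition bil :: "two_adic poly \<Rightarrow> two_adic poly \<Rightarrow> two_adic" where
  "bil g h = lam ((Xp - Xi) * g * bar h)"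

lemma bil_add_left: "bil (a + b) c = bil a c + bil b c"
  and bil_add_right: "bil c (a + b) = bil c a + bil c b"
  and bil_smult_left: "bil (smult k a) c = k * bil a c"
  and bil_smult_right: "bil c (smult k a) = k * bil c a"
  by (simp_all only: bil_def bar_simps distrib_left distrib_right mult_smult_left mult_smult_right lam_simps)

text \<open>Both \<open>lam\<close> and the factor X - 1/X change sign under
  \<open>bar\<close>.\<close>

lemma bil_sym: "bil g h = bil h g"
proof -
  have "lam ((Xp - Xi) * g * bar h) = - lam (bar ((Xp - Xi) * g * bar h))" by (simp only: lam_bar minus_minus)
  also have "\<dots> = lam (- ((Xi - bar Xi) * bar g * bar (bar h)))" by simp
  also have "\<dots> = lam (- ((Xi - Xp) * bar g * h))"
    by (intro lam_cong eqv_minus eqv_mult eqv_diff bar_Xi bar_bar eqv_refl)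
  also have "- ((Xi - Xp) * bar g * h) = (Xp - Xi) * h * bar g" by (simp add: algebra_simps)
  finally show ?thesis by (simp only: bil_def)
qed

lemma bil_cong: "a \<approx> a' \<Longrightarrow> b \<approx> b' \<Longrightarrow> bil a b = bil a' b'"
  unfolding bil_def by (intro lam_cong eqv_mult bar_cong eqv_refl)

lemma bil_X: "bil (Xp * g) (Xp * h) = bil g h"
proof -
  have "(Xp - Xi) * (Xp * g) * bar (Xp * h) = (Xp * Xi) * ((Xp - Xi) * g * bar h)"
    by (simp only: bar_simps mult_ac)
  also have "\<dots> \<approx> 1 * ((Xp - Xi) * g * bar h)" by (intro eqv_mult X_Xi eqv_refl)
  finally show ?thesis unfolding bil_def by (simp only: lam_cong mult_1)
qed

lemma bil_zpoly: "zpoly g \<Longrightarrow> zpoly h \<Longrightarrow> bil g h \<in> Z2"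
  unfolding bil_def by (intro lam_zpoly zpoly_mult zpoly_diff zpoly_Xi zpoly_bar) auto

text \<open>Horner's scheme: by invariance under X, writing g as a + X g' adds only a^2 bil 1 1 and
  twice an integral value, and bil 1 1 = lam X - lam (1/X) = 2 lam X.\<close>

lemma bil_even: "zpoly g \<Longrightarrow> bil g g / 2 \<in> Z2"
proof (induction g)
  case (pCons a g)
  have eq: "pCons a g = smult a 1 + Xp * g" by (simp add: one_pCons mult_pCons_left)
  have "bil 1 1 = lam Xp - lam (bar Xp)" by (simp add: bil_def)
  also have "\<dots> = 2 * lam Xp" by (simp only: lam_bar) simp
  finally have 11: "bil 1 1 = 2 * lam Xp" .
  have "bil (pCons a g) (pCons a g) / 2 = a * a * lam Xp + a * bil 1 (Xp * g) + bil g g / 2"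
    unfolding eq bil_add_left bil_add_right bil_smult_left bil_smult_right bil_X
      bil_sym[of "Xp * g" 1] 11 by (simp add: field_simps)
  also have "\<dots> \<in> Z2"
    using pCons by (intro Z2_add Z2_mult bil_zpoly lam_zpoly) (auto simp: zpoly_mult)
  finally show ?case .
qed (simp add: bil_def)


section \<open>The poles 1/(X - 1) and 1/(X + 1)\<close>

text \<open>This is 1/(X - \<rho>) modulo F: synthetic division gives (X - \<rho>) q = F -
  F(\<rho>), so -q/F(\<rho>) is the inverse. It also shows that F(\<rho>) is a denominator.\<close>

definition pole :: "two_adic \<Rightarrow> two_adic poly" where
  "pole \<rho> = smult (- inverse (poly F \<rho>)) (synthetic_div F \<rho>)"

lemma pole_inverse:
  assumes "poly F \<rho> \<noteq> 0"
  shows "(Xp - [:\<rho>:]) * pole \<rho> \<approx> 1"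
proof -
  have "[:-\<rho>, 1:] * synthetic_div F \<rho> = F - [:poly F \<rho>:]"
    using synthetic_div_correct'[of \<rho> F] by (simp add: algebra_simps)
  then have "(Xp - [:\<rho>:]) * pole \<rho> = smult (- inverse (poly F \<rho>)) (F - [:poly F \<rho>:])"
    by (simp add: pole_def)
  also have "\<dots> \<approx> smult (- inverse (poly F \<rho>)) (0 - [:poly F \<rho>:])"
    by (intro eqv_smult eqv_diff eqv_F eqv_refl)
  also have "\<dots> = 1" using assms by (simp add: one_pCons)
  finally show ?thesis .
qed

lemma X_pole:
  assumes "poly F \<rho> \<noteq> 0"
  shows "Xp * pole \<rho> \<approx> smult \<rho> (pole \<rho>) + 1"
proof -
  have "Xp * pole \<rho> = (Xp - [:\<rho>:]) * pole \<rho> + smult \<rho> (pole \<rho>)"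
    by (simp add: left_diff_distrib mult_pCons_left)
  also have "\<dots> \<approx> 1 + smult \<rho> (pole \<rho>)"
    by (intro eqv_add pole_inverse assms eqv_refl)
  finally show ?thesis by (simp add: add.commute)
qed

text \<open>For \<rho>^2 = 1 one has 1/X - \<rho> = -\<rho> (X - \<rho>)/X; invert both
  sides.\<close>

lemma bar_pole:
  assumes "poly F \<rho> \<noteq> 0" "\<rho> * \<rho> = 1"
  shows "bar (pole \<rho>) \<approx> smult (- \<rho>) (Xp * pole \<rho>)"
proof -
  have inv: "(Xi - [:\<rho>:]) * bar (pole \<rho>) \<approx> 1"
    using bar_cong[OF pole_inverse[OF assms(1)]] by (simp only: bar_simps bar_const)
  have flip: "B * (A * C) = smult (- \<rho>) (((0 - smult \<rho> A) * B) * C)"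
    for A B C :: "two_adic poly"
    using assms(2) by (simp add: mult_ac)
  have eq: "Xp * (Xi - [:\<rho>:]) = (Xp * Xi - 1) - smult \<rho> (Xp - [:\<rho>:])"
    using assms(2) by (simp add: right_diff_distrib one_pCons smult_diff_right mult_pCons_right)
  have "bar (pole \<rho>) = bar (pole \<rho>) * 1" by simp
  also have "\<dots> \<approx> bar (pole \<rho>) * ((Xp - [:\<rho>:]) * pole \<rho>)"
    by (intro eqv_mult eqv_sym[OF pole_inverse] assms eqv_refl)
  also have "\<dots> = smult (- \<rho>) (((0 - smult \<rho> (Xp - [:\<rho>:])) * bar (pole \<rho>)) * pole \<rho>)"
    by (rule flip)
  also have "\<dots> \<approx> smult (- \<rho>) ((((Xp * Xi - 1) - smult \<rho> (Xp - [:\<rho>:])) * bar (pole \<rho>)) * pole \<rho>)"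
    using eqv_diff[OF eqv_sym[OF X_Xi] eqv_refl, of 1]
    by (intro eqv_smult eqv_mult eqv_diff eqv_refl) simp
  also have "\<dots> = smult (- \<rho>) (Xp * pole \<rho> * ((Xi - [:\<rho>:]) * bar (pole \<rho>)))"
    unfolding eq[symmetric] by (simp only: mult_ac)
  also have "\<dots> \<approx> smult (- \<rho>) (Xp * pole \<rho> * 1)"
    by (intro eqv_smult eqv_mult inv eqv_refl)
  finally show ?thesis by simp
qed

text \<open>Each multiplication by X multiplies the pole by \<rho> and adds 1. The extra terms are
  powers of X below 2n - 1, which do not reach the top coefficient; at k = 0 the quotient of F is
  monic of degree 2n - 1.\<close>

lemma top_coeff_pole:
  assumes "poly F \<rho> \<noteq> 0" "k < 2 * n"
  shows "top_coeff (Xp ^ k * pole \<rho>) = - (\<rho> ^ k) / poly F \<rho>"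
  using assms(2)
proof (induction k)
  case 0
  have "degree (synthetic_div F \<rho>) < 2 * n" using n0 by (simp add: degree_synthetic_div deg)
  moreover have "coeff (synthetic_div F \<rho>) (2 * n - 1) = 1"
  proof -
    have "coeff F (2 * n) = coeff (synthetic_div F \<rho>) (2 * n - 1)"
      using arg_cong[OF synthetic_div_correct[of F \<rho>], of "\<lambda>p. coeff p (2 * n)"] n0
        \<open>degree (synthetic_div F \<rho>) < 2 * n\<close>
      by (cases "2 * n") (auto simp: coeff_eq_0)
    then show ?thesis using monic deg by simp
  qed
  ultimately show ?case by (simp add: pole_def top_coeff_small divide_inverse)
next
  case (Suc k)
  have "Xp ^ Suc k * pole \<rho> = Xp ^ k * (Xp * pole \<rho>)" by (simp only: power_Suc2 mult.assoc)
  also have "\<dots> \<approx> Xp ^ k * (smult \<rho> (pole \<rho>) + 1)"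
    by (intro eqv_mult X_pole assms eqv_refl)
  also have "\<dots> = smult \<rho> (Xp ^ k * pole \<rho>) + Xp ^ k" by (simp add: distrib_left)
  finally have e: "Xp ^ Suc k * pole \<rho> \<approx> smult \<rho> (Xp ^ k * pole \<rho>) + Xp ^ k" .
  have "top_coeff (Xp ^ Suc k * pole \<rho>) = \<rho> * top_coeff (Xp ^ k * pole \<rho>) + top_coeff (Xp ^ k)"
    using top_coeff_cong[OF e] by (simp only: top_coeff_simps)
  then show ?case using Suc top_coeff_X_power[of k] by simp
qed

text \<open>Modulo F, (X - 1/X) X = (X - \<rho>)(X + \<rho>). The argument of \<open>lam\<close>
  thus becomes -\<rho> (X + \<rho>)/(X - \<rho>) = -\<rho> (1 + 2 \<rho>/(X - \<rho>)), and
  \<open>lam\<close> kills constants.\<close>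

lemma bil_pole_pole:
  assumes "poly F \<rho> \<noteq> 0" "\<rho> * \<rho> = 1"
  shows "bil (pole \<rho>) (pole \<rho>) = 2 * (\<rho> ^ (n - 1) / poly F \<rho>)"
proof -
  have X2: "(Xp - Xi) * Xp = (Xp - [:\<rho>:]) * (Xp + [:\<rho>:]) - (Xp * Xi - 1)"
    using assms(2) by (simp add: algebra_simps one_pCons mult_pCons_left mult_pCons_right)
  have "(Xp - Xi) * pole \<rho> * bar (pole \<rho>) \<approx> (Xp - Xi) * pole \<rho> * smult (- \<rho>) (Xp * pole \<rho>)"
    by (intro eqv_mult bar_pole assms eqv_refl)
  also have "\<dots> = smult (- \<rho>) (((Xp - Xi) * Xp) * (pole \<rho> * pole \<rho>))"
    by (simp add: mult_ac)
  also have "\<dots> = smult (- \<rho>) (((Xp - [:\<rho>:]) * (Xp + [:\<rho>:]) - (Xp * Xi - 1)) * (pole \<rho> * pole \<rho>))"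
    by (simp only: X2)
  also have "\<dots> \<approx> smult (- \<rho>) (((Xp - [:\<rho>:]) * (Xp + [:\<rho>:]) - (1 - 1)) * (pole \<rho> * pole \<rho>))"
    by (intro eqv_smult eqv_mult eqv_diff X_Xi eqv_refl)
  also have "\<dots> = smult (- \<rho>) (((Xp - [:\<rho>:]) * pole \<rho>) * ((Xp - [:\<rho>:]) * pole \<rho>)
      + smult (2 * \<rho>) (((Xp - [:\<rho>:]) * pole \<rho>) * pole \<rho>))"
  proof -
    have *: "Xp + [:\<rho>:] = (Xp - [:\<rho>:]) + smult (2 * \<rho>) 1" by (simp add: one_pCons)
    show ?thesis unfolding * by (simp only: distrib_left distrib_right mult_smult_left mult_smult_right
        mult_1_right mult_1_left diff_self diff_zero mult_ac)
  qed
  also have "\<dots> \<approx> smult (- \<rho>) (1 * 1 + smult (2 * \<rho>) (1 * pole \<rho>))"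
    by (intro eqv_smult eqv_add eqv_mult pole_inverse assms eqv_refl)
  finally have "bil (pole \<rho>) (pole \<rho>) = lam (smult (- \<rho>) (1 * 1 + smult (2 * \<rho>) (1 * pole \<rho>)))"
    unfolding bil_def by (rule lam_cong)
  also have "\<dots> = - 2 * (\<rho> * \<rho>) * lam (pole \<rho>)" by (simp add: lam_1)
  also have "lam (pole \<rho>) = - (\<rho> ^ (n - 1)) / poly F \<rho>"
    unfolding lam_def using n0 assms(1) by (intro top_coeff_pole) auto
  finally show ?thesis using assms(2) by simp
qed

lemma X2_poles: "((Xp - Xi) * Xp) * (pole 1 * pole (- 1)) \<approx> 1"
proof -
  have "((Xp - Xi) * Xp) * (pole 1 * pole (- 1))
      = (((Xp - [:1:]) * pole 1) * ((Xp - [:- 1:]) * pole (- 1))) - (Xp * Xi - 1) * (pole 1 * pole (- 1))"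
    by (simp add: algebra_simps one_pCons mult_pCons_left mult_pCons_right)
  also have "\<dots> \<approx> 1 * 1 - (1 - 1) * (pole 1 * pole (- 1))"
    by (intro eqv_diff eqv_mult pole_inverse F1 Fm1 X_Xi eqv_refl)
  finally show ?thesis by simp
qed

text \<open>The two poles cancel (X - 1/X) X = X^2 - 1, which leaves \<open>lam\<close> of
  1.\<close>

lemma bil_pole_pole':
  "bil (pole 1) (pole (- 1)) = 0"
proof -
  have "(Xp - Xi) * pole 1 * bar (pole (- 1)) \<approx> (Xp - Xi) * pole 1 * smult (- (- 1)) (Xp * pole (- 1))"
    by (intro eqv_mult bar_pole Fm1 eqv_refl) simp
  also have "\<dots> = ((Xp - Xi) * Xp) * (pole 1 * pole (- 1))" by (simp add: mult_ac)
  also have "\<dots> \<approx> 1" by (rule X2_poles)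
  finally have e: "(Xp - Xi) * pole 1 * bar (pole (- 1)) \<approx> 1" .
  show ?thesis unfolding bil_def using lam_cong[OF e] by (simp only: lam_1)
qed

lemma zpoly_pole: "\<rho> \<in> Z2 \<Longrightarrow> poly F \<rho> \<noteq> 0 \<Longrightarrow> zpoly (smult (poly F \<rho>) (pole \<rho>))"
  by (auto simp: pole_def intro!: zpoly_minus zpoly_synthetic_div zF)

text \<open>F(\<rho>) times the pole is minus the quotient of F by X - \<rho>, so
  \<open>zpoly_half_synthetic_div_diff\<close> applies. Both signs \<epsilon> are covered because
  changing it adds an integral quotient; the package needs \<epsilon> = (-1)^(n-1).\<close>

lemma zpoly_half_poles:
  assumes "\<epsilon> = 1 \<or> \<epsilon> = - 1"
  shows "zpoly (smult (poly F 1 / 2) (pole 1) + smult (\<epsilon> * poly F (- 1) / 2) (pole (- 1)))"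
proof -
  let ?s = "synthetic_div F 1" and ?t = "synthetic_div F (- 1)"
  have h: "zpoly (smult (1/2) (?s - ?t))" by (rule zpoly_half_synthetic_div_diff[OF zF])
  have t: "zpoly ?t" by (intro zpoly_synthetic_div zF) auto
  have "smult (poly F 1 / 2) (pole 1) + smult (\<epsilon> * poly F (- 1) / 2) (pole (- 1))
      = - smult (1/2) ?s - smult (\<epsilon>/2) ?t"
    using F1 Fm1 by (simp add: pole_def field_simps)
  also have "\<dots> = (if \<epsilon> = 1 then - smult (1/2) (?s - ?t) - ?t else - smult (1/2) (?s - ?t))"
    using assms by (auto simp: smult_diff_right simp flip: smult_add_left)
  finally show ?thesis using h t by (simp add: zpoly_minus zpoly_diff split: if_splits)
qed


text \<open>The inverse of X - 1/X, by the partial fractions of X/(X^2 - 1).\<close>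

definition theta :: "two_adic poly" where
  "theta = smult (1/2) (pole 1 + pole (- 1))"

lemma theta_inverse: "(Xp - Xi) * theta \<approx> 1"
proof -
  have X2: "(Xp - Xi) * Xp = Xp * Xp - 1 - (Xp * Xi - 1)" by (simp add: algebra_simps)
  have sq: "Xp * Xp - 1 = (Xp - [:1:]) * (Xp + [:1:])" "Xp * Xp - 1 = (Xp - [:- 1:]) * (Xp - [:1:])"
    by (simp_all add: mult_pCons_left one_pCons)
  have "(Xp * Xp - 1) * theta = smult (1/2)
      (((Xp - [:1:]) * pole 1) * (Xp + [:1:]) + ((Xp - [:- 1:]) * pole (- 1)) * (Xp - [:1:]))"
  proof -
    have "(Xp * Xp - 1) * pole 1 = ((Xp - [:1:]) * pole 1) * (Xp + [:1:])"
      unfolding sq(1) by (simp only: mult_ac)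
    moreover have "(Xp * Xp - 1) * pole (- 1) = ((Xp - [:- 1:]) * pole (- 1)) * (Xp - [:1:])"
      unfolding sq(2) by (simp only: mult_ac)
    ultimately show ?thesis by (simp only: theta_def mult_smult_right distrib_left)
  qed
  also have "\<dots> \<approx> smult (1/2) (1 * (Xp + [:1:]) + 1 * (Xp - [:1:]))"
    by (intro eqv_smult eqv_add eqv_mult pole_inverse F1 Fm1 eqv_refl)
  also have "\<dots> = Xp" by simp
  finally have 1: "(Xp * Xp - 1) * theta \<approx> Xp" .
  have "(Xp - Xi) * theta = 1 * ((Xp - Xi) * theta)" by simp
  also have "\<dots> \<approx> (Xp * Xi) * ((Xp - Xi) * theta)"
    by (intro eqv_mult eqv_sym[OF X_Xi] eqv_refl)
  also have "\<dots> = Xi * ((Xp * Xp - 1 - (Xp * Xi - 1)) * theta)" unfolding X2[symmetric] by (simp only: mult_ac)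
  also have "\<dots> \<approx> Xi * ((Xp * Xp - 1 - (1 - 1)) * theta)"
    by (intro eqv_mult eqv_diff X_Xi eqv_refl)
  also have "\<dots> = Xi * ((Xp * Xp - 1) * theta)" by simp
  also have "\<dots> \<approx> Xi * Xp" by (intro eqv_mult 1 eqv_refl)
  also have "\<dots> = Xp * Xi" by (rule mult.commute)
  also have "\<dots> \<approx> 1" by (rule X_Xi)
  finally show ?thesis .
qed

lemma X_theta: "Xp * theta \<approx> smult (1/2) (pole 1 - pole (- 1)) + 1"
proof -
  have "Xp * theta = smult (1/2) (Xp * pole 1 + Xp * pole (- 1))"
    by (simp only: theta_def mult_smult_right distrib_left)
  also have "\<dots> \<approx> smult (1/2)
      ((smult 1 (pole 1) + 1) + (smult (- 1) (pole (- 1)) + 1))"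
    by (intro eqv_smult eqv_add X_pole F1 Fm1)
  also have "\<dots> = smult (1/2) (pole 1 - pole (- 1)) + 1"
    by (simp add: smult_add_right smult_diff_right flip: smult_add_left)
  finally show ?thesis .
qed

lemma bil_theta: "bil theta g = lam (bar g)"
proof -
  have "(Xp - Xi) * theta * bar g \<approx> 1 * bar g" by (intro eqv_mult theta_inverse eqv_refl)
  from lam_cong[OF this] show ?thesis by (simp only: bil_def mult_1_left)
qed

lemma bil_half_pole_sum: "zpoly g \<Longrightarrow> bil (smult (1/2) (pole 1 + pole (- 1))) g \<in> Z2"
  unfolding theta_def[symmetric] bil_theta by (intro lam_zpoly zpoly_bar)

text \<open>Up to the integral vector 1, the half difference is X/(X - 1/X) by
  \<open>X_theta\<close>; pairing it with g is \<open>lam\<close> of an integral polynomial.\<close>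

lemma bil_half_pole_diff:
  assumes "zpoly g"
  shows "bil (smult (1/2) (pole 1 - pole (- 1))) g \<in> Z2"
proof -
  have "(Xp - Xi) * (Xp * theta) * bar g = ((Xp - Xi) * theta) * (Xp * bar g)" by (simp only: mult_ac)
  also have "\<dots> \<approx> 1 * (Xp * bar g)" by (intro eqv_mult theta_inverse eqv_refl)
  finally have e: "(Xp - Xi) * (Xp * theta) * bar g \<approx> 1 * (Xp * bar g)" .
  have 1: "bil (Xp * theta) g \<in> Z2" unfolding bil_def lam_cong[OF e]
    using assms by (intro lam_zpoly zpoly_mult zpoly_bar) simp_all
  have "bil (Xp * theta) g = bil (smult (1/2) (pole 1 - pole (- 1))) g + bil 1 g"
    using bil_cong[OF X_theta eqv_refl] by (simp only: bil_add_left)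
  then have "bil (smult (1/2) (pole 1 - pole (- 1))) g = bil (Xp * theta) g - bil 1 g"
    by (simp only: eq_diff_eq)
  then show ?thesis using 1 bil_zpoly[OF zpoly_1 assms] by (simp only: Z2_diff)
qed

section \<open>The dual of the lattice of integral polynomials\<close>

text \<open>The trace-like pairing by \<open>top_coeff\<close> is unimodular: X^i lifts the
  coefficient of index 2n - 1 - i to the top, so the coefficients are recovered in descending
  order.\<close>

lemma zpoly_of_top_coeffs:
  assumes "\<And>i. i < 2 * n \<Longrightarrow> top_coeff (Xp ^ i * y) \<in> Z2"
  shows "zpoly (y mod F)"
proof -
  define z where "z = y mod F"
  have degz: "degree z < 2 * n"
    using degree_mod_less'[of F y] deg n0 unfolding z_def by fastforce
  have top: "top_coeff (Xp ^ i * z) \<in> Z2" if "i < 2 * n" for i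
  proof -
    have "Xp ^ i * z \<approx> Xp ^ i * y" unfolding z_def by (intro eqv_mult eqv_mod eqv_refl)
    then show ?thesis using assms[OF that] top_coeff_cong by simp
  qed
  have c: "coeff z (2 * n - 1 - i) \<in> Z2" if "i < 2 * n" for i
    using that
  proof (induction i rule: less_induct)
    case (less i)
    define k where "k = 2 * n - i"
    have k: "k > 0" "k \<le> 2 * n" "2 * n - 1 - i = k - 1" "i + k = 2 * n" using less.prems by (auto simp: k_def)
    have high: "coeff z j \<in> Z2" if "j \<ge> k" for j
    proof (cases "j < 2 * n")
      case True
      then show ?thesis using less.IH[of "2 * n - 1 - j"] that k by auto
    next
      case False
      then show ?thesis using degz by (simp add: coeff_eq_0)
    qed
    define l h where "l = poly_cutoff k z" and "h = Polynomial.monom 1 k * poly_shift k z"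
    have z: "z = l + h"
    proof (rule poly_eqI)
      fix j show "coeff z j = coeff (l + h) j"
        by (simp add: l_def h_def coeff_poly_cutoff coeff_monom_mult coeff_poly_shift)
    qed
    have "zpoly h" unfolding h_def
      using high by (intro zpoly_mult zpoly_monom) (auto simp: zpoly_def coeff_poly_shift)
    then have h: "top_coeff (Xp ^ i * h) \<in> Z2" by (intro top_coeff_zpoly zpoly_mult zpoly_power) simp_all
    have X: "Xp ^ i = Polynomial.monom 1 i" by (simp add: monom_altdef)
    have "degree (Xp ^ i * l) < 2 * n"
    proof (rule le_less_trans)
      show "degree (Xp ^ i * l) \<le> 2 * n - 1"
        by (rule degree_le) (use k in \<open>auto simp: X l_def coeff_monom_mult coeff_poly_cutoff\<close>)
    qed (use n0 in simp)
    then have "top_coeff (Xp ^ i * l) = coeff (Xp ^ i * l) (2 * n - 1)" by (rule top_coeff_small)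
    also have "\<dots> = coeff l (k - 1)" using k by (auto simp: X coeff_monom_mult)
    also have "\<dots> = coeff z (k - 1)" using k by (simp add: l_def coeff_poly_cutoff)
    finally have "coeff z (k - 1) = top_coeff (Xp ^ i * z) - top_coeff (Xp ^ i * h)"
      by (simp add: z distrib_left)
    then show ?case using h top[OF less.prems] k by (simp only: Z2_diff)
  qed
  have "coeff z j \<in> Z2" if "j < 2 * n" for j
    using c[of "2 * n - 1 - j"] that n0 by simp
  moreover have "coeff z j \<in> Z2" if "j \<ge> 2 * n" for j using degz that by (simp add: coeff_eq_0)
  ultimately show ?thesis unfolding z_def[symmetric] zpoly_def by (meson not_le)
qed

lemma zpoly_mod_X2:
  assumes "zpoly r"
  obtains a b c where "a \<in> Z2" "b \<in> Z2" "zpoly c" "r = smult a 1 + smult b Xp + (Xp * Xp - 1) * c"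
proof -
  have "\<exists>a b c. a \<in> Z2 \<and> b \<in> Z2 \<and> zpoly c \<and> r = smult a 1 + smult b Xp + (Xp * Xp - 1) * c"
    using assms
  proof (induction r)
    case 0
    show ?case by (intro exI[of _ 0]) simp
  next
    case (pCons x r)
    then obtain a b c where abc: "a \<in> Z2" "b \<in> Z2" "zpoly c" "r = smult a 1 + smult b Xp + (Xp * Xp - 1) * c"
      by auto
    have "pCons x r = smult x 1 + Xp * r" by (simp add: mult_pCons_left one_pCons)
    also have "\<dots> = smult (x + b) 1 + smult a Xp + (Xp * Xp - 1) * (Xp * c + smult b 1)"
      unfolding abc(4) by (simp only: distrib_left distrib_right left_diff_distrib right_diff_distrib
        mult_smult_left mult_smult_right mult_1_left mult_1_right smult_add_left smult_diff_right) (simp add: algebra_simps)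
    finally have "pCons x r = smult (x + b) 1 + smult a Xp + (Xp * Xp - 1) * (Xp * c + smult b 1)" .
    moreover have "x + b \<in> Z2" "zpoly (Xp * c + smult b 1)"
      using abc pCons.prems by (auto intro!: zpoly_add zpoly_mult zpoly_smult)
    ultimately show ?case using abc(1) by blast
  qed
  then show ?thesis using that by blast
qed

text \<open>Being dual to all powers of X means that (X - 1/X) y is integral. Multiplying back by
  \<open>theta\<close>, multiples of X^2 - 1 become integral and only a remainder a + b X survives,
  which yields (a + b)/2 and (a - b)/2 at the poles.\<close>

lemma dual_zpoly:
  assumes "\<And>j. j < 2 * n \<Longrightarrow> bil y (Xp ^ j) \<in> Z2"
  obtains r a b where "zpoly r" "2 * a \<in> Z2" "a - b \<in> Z2"
    "y \<approx> r + smult a (pole 1) + smult b (pole (- 1))"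
proof -
  \<comment> \<open>The shift by X^(-n) is chosen so that the value of \<open>bil\<close> at
    X^(2n-1-i) is the top coefficient of X^i y'.\<close>
  define y' where "y' = (Xp - Xi) * y * Xi ^ n"
  have "top_coeff (Xp ^ i * y') \<in> Z2" if i: "i < 2 * n" for i
  proof -
    have e: "Xp ^ (n - 1) * ((Xp - Xi) * y * bar (Xp ^ (2 * n - 1 - i))) \<approx> Xp ^ i * y'"
    proof -
      have "Xp ^ i * y' = ((Xp - Xi) * y * Xp ^ i * Xi ^ n) * 1" by (simp only: y'_def mult_ac mult_1_right mult_1_left)
      also have "\<dots> \<approx> ((Xp - Xi) * y * Xp ^ i * Xi ^ n) * (Xp ^ (n - 1) * Xi ^ (n - 1))"
        by (intro eqv_mult eqv_sym[OF X_Xi_power] eqv_refl)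
      also have "\<dots> = Xp ^ (n - 1) * ((Xp - Xi) * y) * (Xp ^ i * (Xi ^ n * Xi ^ (n - 1)))"
        by (simp only: mult_ac)
      also have "Xi ^ n * Xi ^ (n - 1) = Xi ^ (2 * n - 1)" using n0 by (simp add: mult_2 flip: power_add)
      also have "Xp ^ (n - 1) * ((Xp - Xi) * y) * (Xp ^ i * Xi ^ (2 * n - 1))
          \<approx> Xp ^ (n - 1) * ((Xp - Xi) * y) * Xi ^ (2 * n - 1 - i)"
        using i by (intro eqv_mult Xi_power_X_power' eqv_refl) simp
      finally show ?thesis by (simp add: eqv_sym mult.assoc)
    qed
    then show ?thesis using assms[of "2 * n - 1 - i"] n0 top_coeff_cong[OF e]
      by (simp add: bil_def lam_def)
  qed
  then have zy: "zpoly (y' mod F)" by (rule zpoly_of_top_coeffs)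
  have "(Xp - Xi) * y = ((Xp - Xi) * y) * 1" by simp
  also have "\<dots> \<approx> ((Xp - Xi) * y) * (Xp ^ n * Xi ^ n)" by (intro eqv_mult eqv_sym[OF X_Xi_power] eqv_refl)
  also have "\<dots> = Xp ^ n * y'" by (simp only: y'_def mult_ac)
  also have "\<dots> \<approx> Xp ^ n * (y' mod F)" by (intro eqv_mult eqv_sym[OF eqv_mod] eqv_refl)
  finally have e: "(Xp - Xi) * y \<approx> Xp ^ n * (y' mod F)" .
  have "zpoly (Xp ^ n * (y' mod F))" by (intro zpoly_mult zpoly_power zy) simp
  then obtain a b c where abc: "a \<in> Z2" "b \<in> Z2" "zpoly c"
    "Xp ^ n * (y' mod F) = smult a 1 + smult b Xp + (Xp * Xp - 1) * c" by (rule zpoly_mod_X2)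
  have X2: "Xp * Xp - 1 = Xp * (Xp - Xi) + (Xp * Xi - 1)" by (simp add: algebra_simps)
  have "y = y * 1" by simp
  also have "\<dots> \<approx> y * ((Xp - Xi) * theta)" by (intro eqv_mult eqv_sym[OF theta_inverse] eqv_refl)
  also have "\<dots> = ((Xp - Xi) * y) * theta" by (simp only: mult_ac)
  also have "\<dots> \<approx> (smult a 1 + smult b Xp + (Xp * Xp - 1) * c) * theta"
    using e unfolding abc(4) by (intro eqv_mult eqv_refl)
  also have "\<dots> = smult a theta + smult b (Xp * theta)
      + Xp * c * ((Xp - Xi) * theta) + (Xp * Xi - 1) * c * theta"
    unfolding X2 by (simp only: distrib_right distrib_left mult_smult_left mult_smult_right mult_1_left mult_1_right add.assoc mult_ac)
  also have "\<dots> \<approx> smult a theta + smult b (smult (1/2) (pole 1 - pole (- 1)) + 1)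
      + Xp * c * 1 + (1 - 1) * c * theta"
    by (intro eqv_add eqv_mult eqv_diff eqv_smult X_theta theta_inverse X_Xi eqv_refl)
  also have "\<dots> = (Xp * c + smult b 1)
      + smult ((a + b) / 2) (pole 1) + smult ((a - b) / 2) (pole (- 1))"
    by (simp add: theta_def smult_add_right smult_diff_right smult_add_left smult_diff_left
        add_divide_distrib diff_divide_distrib algebra_simps)
  finally have fin: "y \<approx> (Xp * c + smult b 1)
      + smult ((a + b) / 2) (pole 1) + smult ((a - b) / 2) (pole (- 1))" .
  show ?thesis
  proof (rule that[OF _ _ _ fin])
    show "zpoly (Xp * c + smult b 1)"
      using abc by (intro zpoly_add zpoly_mult zpoly_smult) simp_all
    have "2 * ((a + b) / 2) = a + b" by simp
    then show "2 * ((a + b) / 2) \<in> Z2" using abc by (simp only: Z2_add)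
    have "(a + b) / 2 - (a - b) / 2 = b" by (simp add: field_simps)
    then show "(a + b) / 2 - (a - b) / 2 \<in> Z2" using abc by simp
  qed
qed

end

section \<open>Lattices in coordinate modules\<close>

definition scaleF :: "two_adic \<Rightarrow> ('i \<Rightarrow> two_adic poly) \<Rightarrow> 'i \<Rightarrow> two_adic poly" (infixr "\<odot>" 75) where
  "c \<odot> x = (\<lambda>i. smult c (x i))"

global_interpretation QF: vector_space scaleF
  by unfold_locales
    (simp_all add: scaleF_def fun_eq_iff smult_add_right smult_add_left)

global_interpretation ZF: Modules.module "\<lambda>c. scaleF (to_fract c)"
  by unfold_locales (simp_all add: QF.scale_right_distrib QF.scale_left_distrib)

lemma ZF_span_scale: "c \<in> Z2 \<Longrightarrow> x \<in> ZF.span S \<Longrightarrow> c \<odot> x \<in> ZF.span S"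
  unfolding two_adic_ints_def using ZF.span_scale by auto

lemma ZF_span_induct [consumes 1, case_names zero add scale base]:
  assumes "x \<in> ZF.span S" "P 0" "\<And>x y. P x \<Longrightarrow> P y \<Longrightarrow> P (x + y)"
    "\<And>c x. c \<in> Z2 \<Longrightarrow> P x \<Longrightarrow> P (c \<odot> x)" "\<And>x. x \<in> S \<Longrightarrow> P x"
  shows "P x"
proof -
  have "ZF.span S \<subseteq> {x. P x}"
    by (rule ZF.span_minimal) (use assms(2-5) in \<open>auto simp: ZF.subspace_def\<close>)
  then show ?thesis using assms(1) by auto
qed

lemma vec_eqI: "(\<And>i k. coeff (x i) k = coeff (y i) k) \<Longrightarrow> x = y" for x y :: "'i \<Rightarrow> two_adic poly"
  by (intro ext poly_eqI) simp

lemma coeff_scaleF [simp]: "coeff ((c \<odot> x) i) k = c * coeff (x i) k"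
  by (simp add: scaleF_def)

definition bilin :: "(('i \<Rightarrow> two_adic poly) \<Rightarrow> ('i \<Rightarrow> two_adic poly) \<Rightarrow> two_adic) \<Rightarrow> bool" where
  "bilin b \<longleftrightarrow> (\<forall>x y z. b (x + y) z = b x z + b y z) \<and> (\<forall>c x y. b (c \<odot> x) y = c * b x y) \<and>
     (\<forall>x y. b x y = b y x)"

lemma bilinD:
  assumes "bilin b"
  shows "b (x + y) z = b x z + b y z" "b z (x + y) = b z x + b z y"
    "b (c \<odot> x) y = c * b x y" "b y (c \<odot> x) = c * b y x"
    "b (x - y) z = b x z - b y z" "b z (x - y) = b z x - b z y"
    "b 0 z = 0" "b z 0 = 0"
proof -
  show l: "b (x + y) z = b x z + b y z" "b (c \<odot> x) y = c * b x y" for x y z c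
    using assms unfolding bilin_def by blast+
  have s: "b x y = b y x" for x y using assms unfolding bilin_def by blast
  show r: "b z (x + y) = b z x + b z y" "b y (c \<odot> x) = c * b y x" for x y z c
    using l s by metis+
  have m: "x - y = x + (-1) \<odot> y" for x y :: "'a \<Rightarrow> two_adic poly"
    by (rule vec_eqI) simp
  show "b (x - y) z = b x z - b y z" "b z (x - y) = b z x - b z y"
    unfolding m l r by simp_all
  have z: "0 = (0 :: two_adic) \<odot> (0 :: 'a \<Rightarrow> two_adic poly)" by simp
  show "b 0 z = 0" "b z 0 = 0" by (subst z, unfold l r, simp)+
qed

lemma bilin_sym: "bilin b \<Longrightarrow> b x y = b y x"
  unfolding bilin_def by blast

lemma bilin_plus: "bilin b \<Longrightarrow> bilin b' \<Longrightarrow> bilin (\<lambda>x y. b x y + b' x y)"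
  unfolding bilin_def by (auto simp: algebra_simps)

text \<open>Forms are total functions; depending only on the coordinates in J is what allows forms
  on disjoint blocks to be added into an orthogonal sum.\<close>

definition supported :: "'i set \<Rightarrow> (('i \<Rightarrow> two_adic poly) \<Rightarrow> ('i \<Rightarrow> two_adic poly) \<Rightarrow> two_adic) \<Rightarrow> bool" where
  "supported J b \<longleftrightarrow> (\<forall>x y. (\<forall>i\<in>J. x i = 0) \<longrightarrow> b x y = 0)"

definition vrestrict :: "'i set \<Rightarrow> ('i \<Rightarrow> two_adic poly) \<Rightarrow> 'i \<Rightarrow> two_adic poly" where
  "vrestrict J x = (\<lambda>i. if i \<in> J then x i else 0)"

lemma supported_vrestrict:
  assumes "bilin b" "supported J b"
  shows "b x (vrestrict J y) = b x y" "b (vrestrict J y) x = b y x"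
proof -
  have "b (y - vrestrict J y) x = 0"
    using assms(2) unfolding supported_def vrestrict_def by auto
  then show "b (vrestrict J y) x = b y x" by (simp add: bilinD[OF assms(1)])
  then show "b x (vrestrict J y) = b x y" using bilin_sym[OF assms(1)] by metis
qed

lemma supported_zero:
  assumes "bilin b" "supported J b" "\<forall>i\<in>J. x i = 0"
  shows "b x y = 0" "b y x = 0"
  using assms bilin_sym unfolding supported_def by metis+

locale coords =
  fixes m :: "'i \<Rightarrow> two_adic poly"
begin

definition coord :: "'i set \<Rightarrow> ('i \<Rightarrow> two_adic poly) set" where
  "coord J = {x. (\<forall>i. i \<notin> J \<longrightarrow> x i = 0) \<and> (\<forall>i\<in>J. x i mod m i = x i)}"

definition act :: "('i \<Rightarrow> two_adic poly) \<Rightarrow> 'i \<Rightarrow> two_adic poly" where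
  "act x = (\<lambda>i. (Xp * x i) mod m i)"

lemma act_linear: "act (x + y) = act x + act y" "act (c \<odot> x) = c \<odot> act x" "act (x - y) = act x - act y"
  "act 0 = 0"
  by (simp_all add: act_def scaleF_def fun_eq_iff distrib_left right_diff_distrib poly_mod_add_left
      poly_mod_diff_left mod_smult_left)

lemma act_vrestrict: "act (vrestrict J x) = vrestrict J (act x)"
  by (auto simp: act_def vrestrict_def)

lemma subspace_coord: "QF.subspace (coord J)"
  unfolding QF.subspace_def
  by (auto simp: coord_def scaleF_def poly_mod_add_left mod_smult_left)

lemma coord_closed:
  "x \<in> coord J \<Longrightarrow> y \<in> coord J \<Longrightarrow> x + y \<in> coord J" "x \<in> coord J \<Longrightarrow> c \<odot> x \<in> coord J"
  "x \<in> coord J \<Longrightarrow> y \<in> coord J \<Longrightarrow> x - y \<in> coord J"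
  using subspace_coord QF.subspace_add QF.subspace_scale QF.subspace_diff by blast+

lemma coord_mono: "J \<subseteq> K \<Longrightarrow> coord J \<subseteq> coord K"
  unfolding coord_def by (force intro: mod_0)

lemma act_coord: "x \<in> coord J \<Longrightarrow> act x \<in> coord J"
  by (auto simp: coord_def act_def)

lemma vrestrict_coord: "x \<in> coord K \<Longrightarrow> J \<subseteq> K \<Longrightarrow> vrestrict J x \<in> coord J"
  by (auto simp: coord_def vrestrict_def)

lemma vrestrict_split:
  assumes "x \<in> coord (J \<union> K)" "J \<inter> K = {}"
  shows "x = vrestrict J x + vrestrict K x"
  using assms by (auto simp: coord_def vrestrict_def fun_eq_iff)

lemma coord_zero: "x \<in> coord J \<Longrightarrow> J \<inter> K = {} \<Longrightarrow> \<forall>i\<in>K. x i = 0"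
  by (auto simp: coord_def)

lemma QF_span_coord: "S \<subseteq> coord J \<Longrightarrow> QF.span S \<subseteq> coord J"
  by (intro QF.span_minimal subspace_coord)

lemma ZF_span_coord: "S \<subseteq> coord J \<Longrightarrow> ZF.span S \<subseteq> coord J"
proof
  fix x assume S: "S \<subseteq> coord J" and x: "x \<in> ZF.span S"
  show "x \<in> coord J"
    by (rule ZF_span_induct[OF x, where P = "\<lambda>x. x \<in> coord J"])
      (use S coord_closed in \<open>auto simp: QF.subspace_0[OF subspace_coord]\<close>)
qed

text \<open>The lattice is given by a finite generating set, neither independent nor of full rank,
  and possibly empty; glue vectors can then be adjoined without changing a basis.\<close>

definition lat :: "'i set \<Rightarrow> (('i \<Rightarrow> two_adic poly) \<Rightarrow> ('i \<Rightarrow> two_adic poly) \<Rightarrow> two_adic) \<Rightarrow>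
    ('i \<Rightarrow> two_adic poly) set \<Rightarrow> bool" where
  "lat J b S \<longleftrightarrow> bilin b \<and> supported J b \<and> finite S \<and> S \<subseteq> coord J \<and>
     (\<forall>x\<in>coord J. \<forall>y\<in>coord J. b (act x) (act y) = b x y) \<and> act ` S \<subseteq> ZF.span S \<and>
     (\<forall>x\<in>S. \<forall>y\<in>S. b x y \<in> Z2) \<and> (\<forall>x\<in>S. b x x / 2 \<in> Z2)"

lemma integral_span:
  assumes "bilin b" "\<And>x. x \<in> S \<Longrightarrow> b x y \<in> Z2" "x \<in> ZF.span S"
  shows "b x y \<in> Z2"
  by (rule ZF_span_induct[OF assms(3), where P = "\<lambda>x. b x y \<in> Z2"])
    (auto simp: bilinD[OF assms(1)] assms(2))

lemma integral_span_span:
  assumes "bilin b" "\<And>x y. x \<in> S \<Longrightarrow> y \<in> T \<Longrightarrow> b x y \<in> Z2" "x \<in> ZF.span S" "y \<in> ZF.span T"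
  shows "b x y \<in> Z2"
proof (rule integral_span[OF assms(1) _ assms(3)])
  fix z assume z: "z \<in> S"
  have "b y z \<in> Z2"
    by (rule integral_span[OF assms(1) _ assms(4)]) (use assms(2)[OF z] bilin_sym[OF assms(1)] in metis)
  then show "b z y \<in> Z2" using bilin_sym[OF assms(1)] by metis
qed

text \<open>By polarization the cross term enters twice, so its half is integral.\<close>

lemma even_span:
  assumes "bilin b" "\<And>x y. x \<in> S \<Longrightarrow> y \<in> S \<Longrightarrow> b x y \<in> Z2" "\<And>x. x \<in> S \<Longrightarrow> b x x / 2 \<in> Z2"
    and "x \<in> ZF.span S"
  shows "b x x / 2 \<in> Z2"
proof -
  let ?P = "\<lambda>x. x \<in> ZF.span S \<and> b x x / 2 \<in> Z2"
  have "?P x"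
  proof (rule ZF_span_induct[OF assms(4), where P = ?P])
    fix x y assume xy: "?P x" "?P y"
    have "b x x / 2 + b x y + b y y / 2 \<in> Z2"
      using xy integral_span_span[OF assms(1), of S S x y] assms(2) by (intro Z2_add) auto
    also have "b x x / 2 + b x y + b y y / 2 = b (x + y) (x + y) / 2"
      using bilin_sym[OF assms(1), of y x] by (simp add: bilinD[OF assms(1)] field_simps)
    finally show "?P (x + y)" using xy by (simp add: ZF.span_add)
  next
    fix c x assume cx: "c \<in> Z2" "?P x"
    have "c * c * (b x x / 2) \<in> Z2" using cx by (intro Z2_mult) auto
    then show "?P (c \<odot> x)" using cx by (simp add: bilinD[OF assms(1)] ZF_span_scale mult.assoc)
  qed (auto simp: bilinD[OF assms(1)] ZF.span_zero ZF.span_base assms(3))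
  then show ?thesis ..
qed

lemma latD:
  assumes "lat J b S"
  shows "bilin b" "supported J b" "finite S" "S \<subseteq> coord J"
    "x \<in> coord J \<Longrightarrow> y \<in> coord J \<Longrightarrow> b (act x) (act y) = b x y"
    "act ` S \<subseteq> ZF.span S" "x \<in> ZF.span S \<Longrightarrow> y \<in> ZF.span S \<Longrightarrow> b x y \<in> Z2"
    "x \<in> ZF.span S \<Longrightarrow> b x x / 2 \<in> Z2" "x \<in> ZF.span S \<Longrightarrow> act x \<in> ZF.span S"
proof -
  show b: "bilin b" "supported J b" "finite S" "S \<subseteq> coord J"
    "x \<in> coord J \<Longrightarrow> y \<in> coord J \<Longrightarrow> b (act x) (act y) = b x y" and a: "act ` S \<subseteq> ZF.span S"
    using assms unfolding lat_def by blast+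
  show "x \<in> ZF.span S \<Longrightarrow> y \<in> ZF.span S \<Longrightarrow> b x y \<in> Z2"
    by (rule integral_span_span[OF b(1), of S S]) (use assms in \<open>auto simp: lat_def\<close>)
  show "x \<in> ZF.span S \<Longrightarrow> b x x / 2 \<in> Z2"
    by (rule even_span[OF b(1), of S]) (use assms in \<open>auto simp: lat_def\<close>)
  show "x \<in> ZF.span S \<Longrightarrow> act x \<in> ZF.span S"
    by (erule ZF_span_induct[where P = "\<lambda>x. act x \<in> ZF.span S"])
      (use a in \<open>auto simp: act_linear ZF.span_zero ZF.span_add ZF_span_scale\<close>)
qed

lemma lat_extend:
  assumes "lat J b S" "finite T" "T \<subseteq> coord J" "\<And>t. t \<in> T \<Longrightarrow> act t \<in> ZF.span (S \<union> T)"
    "\<And>s t. s \<in> S \<Longrightarrow> t \<in> T \<Longrightarrow> b s t \<in> Z2" "\<And>s t. s \<in> T \<Longrightarrow> t \<in> T \<Longrightarrow> b s t \<in> Z2"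
    "\<And>t. t \<in> T \<Longrightarrow> b t t / 2 \<in> Z2"
  shows "lat J b (S \<union> T)"
proof -
  note l = latD[OF assms(1)]
  have ts: "b t s \<in> Z2" if "s \<in> S" "t \<in> T" for s t
    using assms(5)[OF that] bilin_sym[OF l(1)] by metis
  have mono: "ZF.span S \<subseteq> ZF.span (S \<union> T)" by (intro ZF.span_mono) auto
  show ?thesis unfolding lat_def
  proof (intro conjI ballI)
    show "act ` (S \<union> T) \<subseteq> ZF.span (S \<union> T)" using l(6) mono assms(4) by blast
  next
    fix x y assume "x \<in> S \<union> T" "y \<in> S \<union> T"
    then show "b x y \<in> Z2" by (elim UnE) (simp_all add: l(7) ts assms(5,6) ZF.span_base)
  next
    fix x assume "x \<in> S \<union> T"
    then show "b x x / 2 \<in> Z2" by (elim UnE) (simp_all add: l(8) assms(7) ZF.span_base)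
  qed (use l assms(2,3) in auto)
qed

lemma lat_Un:
  assumes "lat J b S" "lat K c T" "J \<inter> K = {}"
  shows "lat (J \<union> K) (\<lambda>x y. b x y + c x y) (S \<union> T)"
proof -
  note b = latD[OF assms(1)] and c = latD[OF assms(2)]
  have mono: "ZF.span S \<subseteq> ZF.span (S \<union> T)" "ZF.span T \<subseteq> ZF.span (S \<union> T)" by (intro ZF.span_mono; auto)+
  have c0: "c x y = 0" "c y x = 0" if "x \<in> coord J" for x y
    using supported_zero[OF c(1,2)] coord_zero[OF that assms(3)] by auto
  have b0: "b x y = 0" "b y x = 0" if "x \<in> coord K" for x y
    using supported_zero[OF b(1,2)] coord_zero[OF that] assms(3) by blast+
  have inv: "b (act x) (act y) = b x y" if "x \<in> coord (J \<union> K)" "y \<in> coord (J \<union> K)" for x y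
    using b(5)[of "vrestrict J x" "vrestrict J y"] that
    by (simp add: vrestrict_coord act_vrestrict supported_vrestrict[OF b(1,2)])
  have inv': "c (act x) (act y) = c x y" if "x \<in> coord (J \<union> K)" "y \<in> coord (J \<union> K)" for x y
    using c(5)[of "vrestrict K x" "vrestrict K y"] that
    by (simp add: vrestrict_coord act_vrestrict supported_vrestrict[OF c(1,2)])
  have SJ: "x \<in> coord J" if "x \<in> S" for x using that b(4) by auto
  have TK: "x \<in> coord K" if "x \<in> T" for x using that c(4) by auto
  show ?thesis unfolding lat_def
  proof (intro conjI ballI)
    show "bilin (\<lambda>x y. b x y + c x y)" using b(1) c(1) by (rule bilin_plus)
    show "supported (J \<union> K) (\<lambda>x y. b x y + c x y)" using b(2) c(2) unfolding supported_def by auto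
    show "finite (S \<union> T)" using b(3) c(3) by simp
    show "S \<union> T \<subseteq> coord (J \<union> K)" using b(4) c(4) coord_mono by blast
    show "act ` (S \<union> T) \<subseteq> ZF.span (S \<union> T)" using b(6) c(6) mono by blast
  next
    fix x y assume "x \<in> S \<union> T" "y \<in> S \<union> T"
    then show "b x y + c x y \<in> Z2"
      using b(7)[of x y] c(7)[of x y] by (auto simp: c0 b0 SJ TK ZF.span_base)
  next
    fix x assume "x \<in> S \<union> T"
    then show "(b x x + c x x) / 2 \<in> Z2"
      using b(8)[of x] c(8)[of x] by (auto simp: c0 b0 SJ TK ZF.span_base)
  qed (simp_all add: inv inv')
qed

text \<open>Adds full rank and the inclusion of the dual in the lattice. The reverse inclusion is
  the integrality contained in \<open>lat\<close>, so together they express unimodularity.\<close>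

definition good :: "'i set \<Rightarrow> (('i \<Rightarrow> two_adic poly) \<Rightarrow> ('i \<Rightarrow> two_adic poly) \<Rightarrow> two_adic) \<Rightarrow>
    ('i \<Rightarrow> two_adic poly) set \<Rightarrow> bool" where
  "good J b S \<longleftrightarrow> lat J b S \<and> coord J \<subseteq> QF.span S \<and>
     (\<forall>y\<in>coord J. (\<forall>x\<in>S. b x y \<in> Z2) \<longrightarrow> y \<in> ZF.span S)"

lemma good_Un:
  assumes "good J b S" "good K c T" "J \<inter> K = {}"
  shows "good (J \<union> K) (\<lambda>x y. b x y + c x y) (S \<union> T)"
proof -
  have lb: "lat J b S" and lc: "lat K c T" using assms unfolding good_def by blast+
  note b = latD[OF lb] and c = latD[OF lc]
  have split: "x = vrestrict J x + vrestrict K x" "vrestrict J x \<in> coord J" "vrestrict K x \<in> coord K"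
    if "x \<in> coord (J \<union> K)" for x
    using vrestrict_split[OF that assms(3)] vrestrict_coord[OF that] by auto
  show ?thesis unfolding good_def
  proof (intro conjI ballI impI subsetI)
    show "lat (J \<union> K) (\<lambda>x y. b x y + c x y) (S \<union> T)" using lb lc assms(3) by (rule lat_Un)
  next
    fix x assume x: "x \<in> coord (J \<union> K)"
    have "vrestrict J x \<in> QF.span S" "vrestrict K x \<in> QF.span T"
      using split(2,3)[OF x] assms unfolding good_def by blast+
    then have "vrestrict J x + vrestrict K x \<in> QF.span (S \<union> T)"
      by (meson QF.span_add QF.span_mono Un_upper1 Un_upper2 subsetD)
    then show "x \<in> QF.span (S \<union> T)" using split(1)[OF x] by simp
  next
    fix y assume y: "y \<in> coord (J \<union> K)" and int: "\<forall>x\<in>S \<union> T. b x y + c x y \<in> Z2"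
    have "b x (vrestrict J y) \<in> Z2" if "x \<in> S" for x
    proof -
      have "c x y = 0" using that b(4) supported_zero[OF c(1,2)] coord_zero[OF _ assms(3)] by blast
      moreover have "b x y + c x y \<in> Z2" using int that by blast
      ultimately show ?thesis by (simp add: supported_vrestrict[OF b(1,2)])
    qed
    then have 1: "vrestrict J y \<in> ZF.span S" using split(2)[OF y] assms(1) unfolding good_def by blast
    have "c x (vrestrict K y) \<in> Z2" if "x \<in> T" for x
    proof -
      have "b x y = 0" using that c(4) supported_zero[OF b(1,2)] coord_zero[of x K J] assms(3) by blast
      moreover have "b x y + c x y \<in> Z2" using int that by blast
      ultimately show ?thesis by (simp add: supported_vrestrict[OF c(1,2)])
    qed
    then have "vrestrict K y \<in> ZF.span T" using split(3)[OF y] assms(2) unfolding good_def by blast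
    then have "vrestrict J y + vrestrict K y \<in> ZF.span (S \<union> T)"
      using ZF.span_mono[of S "S \<union> T"] ZF.span_mono[of T "S \<union> T"] 1 by (intro ZF.span_add) auto
    then show "y \<in> ZF.span (S \<union> T)" using split(1)[OF y] by simp
  qed
qed

end

section \<open>Diagonal forms on the lines of M^+ and M^-\<close>

definition unit_coord :: "'i \<Rightarrow> 'i \<Rightarrow> two_adic poly" where
  "unit_coord i = (\<lambda>j. if j = i then 1 else 0)"

text \<open>Coordinates with linear modulus are constants, whence \<open>coeff\<close> at 0. The
  factor 2 matches the values 2 A of the form at the poles, so that gluing compares \<open>a\<close>
  with A.\<close>

definition diag_form :: "'i set \<Rightarrow> ('i \<Rightarrow> two_adic) \<Rightarrow> ('i \<Rightarrow> two_adic poly) \<Rightarrow> ('i \<Rightarrow> two_adic poly) \<Rightarrow> two_adic" where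
  "diag_form E a x y = (\<Sum>i\<in>E. 2 * a i * (coeff (x i) 0 * coeff (y i) 0))"

lemma bilin_diag_form: "bilin (diag_form E a)"
  unfolding bilin_def diag_form_def
  by (auto simp: algebra_simps sum.distrib sum_distrib_left intro!: sum.cong)

lemma supported_diag_form: "supported E (diag_form E a)"
  unfolding supported_def diag_form_def by auto

lemma diag_form_unit_coord:
  assumes "finite E" "i \<in> E"
  shows "diag_form E a (unit_coord i) x = 2 * a i * coeff (x i) 0"
proof -
  have "diag_form E a (unit_coord i) x = (\<Sum>j\<in>E. if j = i then 2 * a i * coeff (x i) 0 else 0)"
    unfolding diag_form_def unit_coord_def by (intro sum.cong) auto
  also have "\<dots> = 2 * a i * coeff (x i) 0" using assms by simp
  finally show ?thesis .
qed

lemma coeff_unit_coord: "coeff (unit_coord i j) k = (if i = j \<and> k = 0 then 1 else 0)"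
  by (auto simp: unit_coord_def coeff_1)

lemma mult_X_mod_linear: "degree p = 0 \<Longrightarrow> (Xp * p) mod [:- r, 1:] = smult r (p :: two_adic poly)"
proof -
  assume "degree p = 0"
  then obtain c where p: "p = [:c:]" by (rule degree_eq_zeroE)
  have X: "Xp * p = smult c [:- r, 1:] + [:r * c:]" by (simp add: p mult_pCons_left)
  have M: "[:r * c:] mod [:- r, 1:] = [:r * c:]" by (rule mod_poly_less) auto
  show ?thesis unfolding X poly_mod_add_left mod_smult_left mod_self M by (simp add: p)
qed

lemma degree_mod_linear: "p mod [:- r, 1:] = (p :: two_adic poly) \<Longrightarrow> degree p = 0"
  using degree_mod_less[of "[:- r, 1:]" p] by auto

context coords
begin

lemma coord_linear:
  assumes "m i = [:- r, 1:]" "x \<in> coord E" "i \<in> E"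
  shows "x i = [:coeff (x i) 0:]" "act x i = smult r (x i)"
proof -
  have "degree (x i) = 0" using assms degree_mod_linear[of "x i" r] by (auto simp: coord_def)
  then show "x i = [:coeff (x i) 0:]" by (auto elim: degree_eq_zeroE)
  show "act x i = smult r (x i)"
    unfolding act_def assms(1) using \<open>degree (x i) = 0\<close> by (rule mult_X_mod_linear)
qed

lemma unit_coord_coord: "m i = [:- r, 1:] \<Longrightarrow> i \<in> E \<Longrightarrow> unit_coord i \<in> coord E"
  by (auto simp: coord_def unit_coord_def mod_poly_less)

lemma act_unit_coord: "m i = [:- r, 1:] \<Longrightarrow> act (unit_coord i) = r \<odot> unit_coord i"
  using mult_X_mod_linear[of 1 r] by (auto simp: act_def unit_coord_def scaleF_def fun_eq_iff)

lemma lat_diag_form: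
  assumes "finite E" "\<And>i. i \<in> E \<Longrightarrow> \<exists>r. m i = [:- r, 1:] \<and> (r = 1 \<or> r = - 1)"
  shows "lat E (diag_form E a) {}"
proof -
  have "diag_form E a (act x) (act y) = diag_form E a x y" if "x \<in> coord E" "y \<in> coord E" for x y
    unfolding diag_form_def
  proof (intro sum.cong refl)
    fix i assume i: "i \<in> E"
    then obtain r where r: "m i = [:- r, 1:]" "r = 1 \<or> r = - 1" using assms(2) by blast
    then show "2 * a i * (coeff (act x i) 0 * coeff (act y i) 0) = 2 * a i * (coeff (x i) 0 * coeff (y i) 0)"
      using coord_linear(2)[OF r(1) that(1) i] coord_linear(2)[OF r(1) that(2) i] by auto
  qed
  then show ?thesis by (simp add: lat_def bilin_diag_form supported_diag_form)
qed

lemma coord_pair: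
  assumes "m i = [:- r, 1:]" "m j = [:- r', 1:]" "i \<noteq> j" "x \<in> coord {i, j}"
  shows "x = coeff (x i) 0 \<odot> unit_coord i + coeff (x j) 0 \<odot> unit_coord j"
proof (rule ext)
  fix k
  have "x i = [:coeff (x i) 0:]" "x j = [:coeff (x j) 0:]"
    using coord_linear(1)[OF assms(1,4)] coord_linear(1)[OF assms(2,4)] by auto
  moreover have "k \<noteq> i \<Longrightarrow> k \<noteq> j \<Longrightarrow> x k = 0" using assms(4) by (auto simp: coord_def)
  ultimately show "x k = (coeff (x i) 0 \<odot> unit_coord i + coeff (x j) 0 \<odot> unit_coord j) k"
    using assms(3) by (cases "k = i"; cases "k = j") (auto simp: unit_coord_def scaleF_def one_pCons)
qed

end

text \<open>A stable even lattice \<open>R\<close>, spanned by \<open>S\<close>, whose dual is \<open>R + {\<alpha> s\<^sub>1 + \<beta> s\<^sub>2 | 2\<alpha>, \<alpha> - \<beta> \<in> \<int>\<^sub>2}\<close>,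
  where \<open>s\<^sub>1\<close> and \<open>s\<^sub>2\<close> are orthogonal and, modulo \<open>R\<close>, eigenvectors for the signs \<open>r\<^sub>1\<close> and \<open>r\<^sub>2\<close>.\<close>

locale package = coords m for m :: "'i \<Rightarrow> two_adic poly" +
  fixes J :: "'i set" and b S s1 s2 A1 A2 r1 r2 o1 o2
  assumes lat: "lat J b S" and spanning: "coord J \<subseteq> QF.span S"
    and s_coord: "s1 \<in> coord J" "s2 \<in> coord J"
    and dual: "\<And>y. y \<in> coord J \<Longrightarrow> (\<And>x. x \<in> S \<Longrightarrow> b x y \<in> Z2) \<Longrightarrow>
      \<exists>r\<in>ZF.span S. \<exists>\<alpha> \<beta>. 2 * \<alpha> \<in> Z2 \<and> \<alpha> - \<beta> \<in> Z2 \<and> y = r + \<alpha> \<odot> s1 + \<beta> \<odot> s2"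
    and half: "\<And>x. x \<in> S \<Longrightarrow> b x ((1/2) \<odot> (s1 + s2)) \<in> Z2" "\<And>x. x \<in> S \<Longrightarrow> b x ((1/2) \<odot> (s1 - s2)) \<in> Z2"
    and vals: "b s1 s1 = 2 * A1" "b s2 s2 = 2 * A2" "b s1 s2 = 0" "A1 \<noteq> 0" "A2 \<noteq> 0"
    and dualvec: "(1/A1) \<odot> s1 \<in> ZF.span S" "(1/(2*A1)) \<odot> s1 + (1/(2*A2)) \<odot> s2 \<in> ZF.span S"
    and acts: "act s1 = r1 \<odot> s1 + o1" "act s2 = r2 \<odot> s2 + o2"
      "o1 \<in> ZF.span S" "o2 \<in> ZF.span S" "(1/2) \<odot> (o1 + o2) \<in> ZF.span S"
    and sgn: "r1 = 1 \<or> r1 = - 1" "r2 = 1 \<or> r2 = - 1"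
begin

lemmas L = latD[OF lat]
lemmas B = bilinD[OF L(1)]

lemma vals': "b s2 s1 = 0"
  using vals(3) bilin_sym[OF L(1)] by metis

lemma dualvec2: "(1/A2) \<odot> s2 \<in> ZF.span S"
proof -
  have "(1/A2) \<odot> s2 = 2 \<odot> ((1/(2*A1)) \<odot> s1 + (1/(2*A2)) \<odot> s2) - (1/A1) \<odot> s1"
    using vals by (intro vec_eqI) (simp add: field_simps)
  then show ?thesis using dualvec by (simp only: ZF.span_diff ZF_span_scale Z2_numeral)
qed

text \<open>These are half the norms of the lattice vectors s1/A1, s2/A2 and s1/(2 A1) + s2/(2 A2),
  integral because the lattice is even.\<close>

lemma inverse_A: "1 / A1 \<in> Z2" "1 / A2 \<in> Z2" "(1 / A1 + 1 / A2) / 4 \<in> Z2"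
  using L(8)[OF dualvec(1)] L(8)[OF dualvec2] L(8)[OF dualvec(2)] vals vals'
  by (simp_all add: B field_simps power2_eq_square)

text \<open>In terms of the half sum and the half difference of the poles the coefficients are
  \<alpha> + \<beta> and \<alpha> - \<beta>, both integral.\<close>

lemma glue_integral:
  assumes "x \<in> ZF.span S" "2 * \<alpha> \<in> Z2" "\<alpha> - \<beta> \<in> Z2"
  shows "b x (\<alpha> \<odot> s1 + \<beta> \<odot> s2) \<in> Z2"
proof -
  have eq: "\<alpha> \<odot> s1 + \<beta> \<odot> s2 = (2 * \<alpha> - (\<alpha> - \<beta>)) \<odot> ((1/2) \<odot> (s1 + s2)) + (\<alpha> - \<beta>) \<odot> ((1/2) \<odot> (s1 - s2))"
    by (intro vec_eqI) (simp add: field_simps)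
  have h: "b x ((1/2) \<odot> (s1 + s2)) \<in> Z2" "b x ((1/2) \<odot> (s1 - s2)) \<in> Z2"
    by (rule integral_span[OF L(1) _ assms(1)]; use half in blast)+
  have c: "2 * \<alpha> - (\<alpha> - \<beta>) \<in> Z2" using assms(2,3) by (rule Z2_diff)
  show ?thesis unfolding eq B(2) B(4)[of _ "2 * \<alpha> - (\<alpha> - \<beta>)"] B(4)[of _ "\<alpha> - \<beta>"]
    by (rule Z2_add[OF Z2_mult[OF c h(1)] Z2_mult[OF assms(3) h(2)]])
qed

text \<open>Lets the pole at -1 take the role of \<open>s1\<close>, for the case in which only the
  eigenvalue -1 occurs.\<close>

lemma swap: "package m J b S s2 s1 A2 A1 r2 r1 o2 o1"
proof unfold_locales
  fix y assume y: "y \<in> coord J" "\<And>x. x \<in> S \<Longrightarrow> b x y \<in> Z2"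
  then obtain r \<alpha> \<beta> where r: "r \<in> ZF.span S" "2 * \<alpha> \<in> Z2" "\<alpha> - \<beta> \<in> Z2" "y = r + \<alpha> \<odot> s1 + \<beta> \<odot> s2"
    using dual by blast
  have "2 * \<alpha> - 2 * (\<alpha> - \<beta>) \<in> Z2" "- (\<alpha> - \<beta>) \<in> Z2" using r by blast+
  then have "2 * \<beta> \<in> Z2" "\<beta> - \<alpha> \<in> Z2" by (simp_all add: algebra_simps)
  moreover have "y = r + \<beta> \<odot> s2 + \<alpha> \<odot> s1" using r(4) by (simp add: add_ac)
  ultimately show "\<exists>r\<in>ZF.span S. \<exists>\<alpha> \<beta>. 2 * \<alpha> \<in> Z2 \<and> \<alpha> - \<beta> \<in> Z2 \<and> y = r + \<alpha> \<odot> s2 + \<beta> \<odot> s1"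
    using r(1) by blast
next
  fix x assume x: "x \<in> S"
  then show "b x ((1/2) \<odot> (s2 + s1)) \<in> Z2" using half(1) by (simp add: add.commute)
  have "- b x ((1/2) \<odot> (s1 - s2)) \<in> Z2" using half(2)[OF x] by blast
  then show "b x ((1/2) \<odot> (s2 - s1)) \<in> Z2" by (simp add: B algebra_simps)
qed (use lat spanning s_coord vals vals' dualvec dualvec2 acts sgn in \<open>simp_all add: add.commute\<close>)

text \<open>The congruence modulo 4 makes the value of the form at \<open>(t\<^sub>1 s\<^sub>1 + t\<^sub>2 s\<^sub>2) / 2\<close> even.\<close>

lemma good_close:
  assumes u: "Z2_unit (t1 ^ 2 * A1)" "Z2_unit (t2 ^ 2 * A2)" and e: "(t1 ^ 2 * A1 + t2 ^ 2 * A2) / 4 \<in> Z2"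
  shows "good J b (S \<union> {t1 \<odot> s1, (1/2) \<odot> (t1 \<odot> s1 + t2 \<odot> s2)})"
proof -
  define a1 a2 where "a1 = t1 ^ 2 * A1" and "a2 = t2 ^ 2 * A2"
  have a: "Z2_unit a1" "Z2_unit a2" "(a1 + a2) / 4 \<in> Z2" using assms by (simp_all add: a1_def a2_def)
  have t0: "t1 \<noteq> 0" "t2 \<noteq> 0" using u by (auto simp: Z2_unit_def)
  have inv: "1 / A1 = t1 ^ 2 * inverse a1" "1 / A2 = t2 ^ 2 * inverse a2"
    using t0 by (simp_all add: a1_def a2_def field_simps)
  have ai: "inverse a1 \<in> Z2" "inverse a2 \<in> Z2" "a1 \<in> Z2" "a2 \<in> Z2" "a1 \<noteq> 0" "a2 \<noteq> 0"
    using a by (auto simp: Z2_unit_def)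
  have tZ: "t1 \<in> Z2" "t2 \<in> Z2"
    using Z2_square_unit_mult[of t1 "inverse a1"] Z2_square_unit_mult[of t2 "inverse a2"] inverse_A inv a by auto
  have q4: "(t1/2) ^ 2 * inverse a1 + (t2/2) ^ 2 * inverse a2 \<in> Z2"
    using inverse_A(3) unfolding inv by (simp add: power_divide add_divide_distrib)
  \<comment> \<open>If one summand in \<open>q4\<close> is integral, so is the other. Equal parity
    of t1 and t2 is what makes \<open>v\<close> a glue vector that pairs integrally with the old
    lattice.\<close>
  have "t1 / 2 \<in> Z2 \<longleftrightarrow> t2 / 2 \<in> Z2"
  proof
    assume "t1 / 2 \<in> Z2"
    then have "((t1/2) ^ 2 * inverse a1 + (t2/2) ^ 2 * inverse a2) - (t1/2) ^ 2 * inverse a1 \<in> Z2"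
      using q4 ai by (intro Z2_diff Z2_mult Z2_power)
    then have "(t2/2) ^ 2 * inverse a2 \<in> Z2" by simp
    then show "t2 / 2 \<in> Z2" using Z2_square_unit_mult a(2) Z2_unit_inverse by blast
  next
    assume "t2 / 2 \<in> Z2"
    then have "((t1/2) ^ 2 * inverse a1 + (t2/2) ^ 2 * inverse a2) - (t2/2) ^ 2 * inverse a2 \<in> Z2"
      using q4 ai by (intro Z2_diff Z2_mult Z2_power)
    then have "(t1/2) ^ 2 * inverse a1 \<in> Z2" by simp
    then show "t1 / 2 \<in> Z2" using Z2_square_unit_mult a(1) Z2_unit_inverse by blast
  qed
  then have td: "(t1 - t2) / 2 \<in> Z2" using Z2_parity tZ by blast
  define p v where "p = t1 \<odot> s1" and "v = (1/2) \<odot> (t1 \<odot> s1 + t2 \<odot> s2)"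
  define S' where "S' = S \<union> {p, v}"
  have inS: "p \<in> ZF.span S'" "v \<in> ZF.span S'" "\<And>x. x \<in> ZF.span S \<Longrightarrow> x \<in> ZF.span S'"
    unfolding S'_def using ZF.span_mono[of S "S \<union> {p, v}"] by (auto intro: ZF.span_base)
  have d: "t2 \<odot> s2 = 2 \<odot> v - p"
    by (rule vec_eqI) (simp add: v_def p_def)
  have inS2: "t2 \<odot> s2 \<in> ZF.span S'" unfolding d using inS by (intro ZF.span_diff ZF_span_scale) auto
  have bp: "b p p = 2 * a1" "b p v = a1" "b v v / 2 = (a1 + a2) / 4" "b v p = a1"
    unfolding p_def v_def using vals vals' by (simp_all add: B a1_def a2_def power2_eq_square field_simps)
  have latS': "lat J b S'"
    unfolding S'_def
  proof (rule lat_extend[OF lat])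
    show "{p, v} \<subseteq> coord J" using s_coord by (auto simp: p_def v_def intro!: coord_closed)
  next
    fix t assume t: "t \<in> {p, v}"
    have "act p = r1 \<odot> p + t1 \<odot> o1"
      by (simp add: p_def act_linear acts) (rule vec_eqI, simp add: field_simps)
    moreover have rZ: "r1 \<in> Z2" "(r2 - r1) / 2 \<in> Z2" using sgn by auto
    ultimately have "act p \<in> ZF.span S'"
      using inS(1) inS(3)[OF acts(3)] tZ by (simp only: ZF.span_add ZF_span_scale)
    \<comment> \<open>The signs on the two summands of \<open>v\<close> may differ; the discrepancy
      is an integral multiple of \<open>t2 \<odot> s2\<close>, which lies in the new lattice. As t1
      - t2 is even, only the half sum of o1 and o2 and a multiple of o2 remain.\<close>
    moreover have "act v = r1 \<odot> v + ((r2 - r1) / 2) \<odot> (t2 \<odot> s2) + (t1 \<odot> ((1/2) \<odot> (o1 + o2)) - ((t1 - t2) / 2) \<odot> o2)"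
      by (simp add: v_def act_linear acts) (rule vec_eqI, simp add: field_simps)
    ultimately have "act v \<in> ZF.span S'"
      using inS(2) inS2 inS(3)[OF acts(4)] inS(3)[OF acts(5)] rZ tZ td
      by (simp only: ZF.span_add ZF.span_diff ZF_span_scale)
    with \<open>act p \<in> ZF.span S'\<close> t show "act t \<in> ZF.span (S \<union> {p, v})" by (auto simp: S'_def)
  next
    fix s t assume st: "s \<in> S" "t \<in> {p, v}"
    have s: "s \<in> ZF.span S" using st by (simp add: ZF.span_base)
    have "p = t1 \<odot> s1 + 0 \<odot> s2" "v = (t1/2) \<odot> s1 + (t2/2) \<odot> s2"
      by (auto simp: p_def v_def intro!: vec_eqI)
    then show "b s t \<in> Z2"
      using st glue_integral[OF s, of t1 0] glue_integral[OF s, of "t1/2" "t2/2"] tZ td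
      by (auto simp: diff_divide_distrib)
  next
    fix s t assume "s \<in> {p, v}" "t \<in> {p, v}"
    have "b v v = 2 * (b v v / 2)" by simp
    then have bvv: "b v v \<in> Z2" using a(3) unfolding bp(3) by (metis Z2_mult Z2_numeral)
    show "b s t \<in> Z2" using \<open>s \<in> {p, v}\<close> \<open>t \<in> {p, v}\<close>
      by (auto simp: bp(1,2,4) bvv ai intro!: Z2_mult)
  next
    fix t assume "t \<in> {p, v}"
    then show "b t t / 2 \<in> Z2"
      by (elim insertE emptyE) (simp_all only: bp(3) a(3), simp add: bp(1) ai)
  qed simp
  have "y \<in> ZF.span S'" if y: "y \<in> coord J" "\<forall>x\<in>S'. b x y \<in> Z2" for y
  proof -
    obtain r \<alpha> \<beta> where r: "r \<in> ZF.span S" "y = r + \<alpha> \<odot> s1 + \<beta> \<odot> s2"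
      using dual[of y] y unfolding S'_def by blast
    define u where "u = \<alpha> \<odot> s1 + \<beta> \<odot> s2"
    have yu: "y = r + u" using r(2) by (simp add: u_def add_ac)
    have bu: "b x u \<in> Z2" if "x \<in> ZF.span S'" for x
    proof -
      have "b x y \<in> Z2" by (rule integral_span[OF L(1) _ that]) (use y in blast)
      moreover have "b x r \<in> Z2" using latD(7)[OF latS' that] inS(3)[OF r(1)] by blast
      ultimately have "b x y - b x r \<in> Z2" by blast
      then show ?thesis by (simp add: yu B)
    qed
    define x z where "x = 2 * \<alpha> / t1" and "z = 2 * \<beta> / t2"
    have bu': "b p u = a1 * x" "b (t2 \<odot> s2) u = a2 * z" "b v u = (a1 * x + a2 * z) / 2"
      using vals vals' t0 by (simp_all add: B p_def v_def u_def x_def z_def a1_def a2_def field_simps power2_eq_square)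
    have i: "a1 * x \<in> Z2" "a2 * z \<in> Z2" "(a1 * x + a2 * z) / 2 \<in> Z2"
      using bu[OF inS(1)] bu[OF inS2] bu[OF inS(2)] unfolding bu' .
    have "inverse a2 * (a2 * z) \<in> Z2" using i ai by blast
    moreover have "inverse a2 * (a2 * z) = z" using ai(6) by simp
    ultimately have z: "z \<in> Z2" by simp
    \<comment> \<open>Here u = (x/2) t1 s1 + (z/2) t2 s2. As a1 x + a2 z is even and a1 + a2 is
      divisible by 4, subtracting (a1 + a2) z shows that a1 (x - z) is even.\<close>
    have "inverse a1 * ((a1 * x + a2 * z) / 2 - 2 * ((a1 + a2) / 4) * z) \<in> Z2"
      using i ai a z by (intro Z2_mult Z2_diff Z2_numeral)
    also have "inverse a1 * ((a1 * x + a2 * z) / 2 - 2 * ((a1 + a2) / 4) * z) = (x - z) / 2"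
      using ai by (simp add: field_simps)
    finally have xz: "(x - z) / 2 \<in> Z2" .
    have "u = z \<odot> v + ((x - z) / 2) \<odot> p"
      using t0 by (intro vec_eqI) (simp add: u_def v_def p_def x_def z_def field_simps)
    then have "u \<in> ZF.span S'" using inS z xz by (simp only: ZF.span_add ZF_span_scale)
    then show ?thesis unfolding yu using inS r(1) by (simp only: ZF.span_add)
  qed
  then have "good J b S'"
    using latS' spanning QF.span_mono[of S S'] by (auto simp: good_def S'_def)
  then show ?thesis by (simp add: S'_def p_def v_def)
qed

end

section \<open>Packages made of two lines, and the gluing of opposite packages\<close>

context coords
begin

text \<open>Two lines imitate the poles of a polynomial: the lattice is spanned by just the two
  vectors that a package must contain, and the unit vectors then represent its discriminant group.
  The conditions on 1/a are those of \<open>inverse_A\<close>, that is evenness of the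
  generators.\<close>

lemma package_unit_coords:
  assumes ij: "i \<noteq> j" and m: "m i = [:- r1, 1:]" "m j = [:- r2, 1:]"
    and r: "r1 = 1 \<or> r1 = - 1" "r2 = 1 \<or> r2 = - 1"
    and a: "a i \<noteq> 0" "a j \<noteq> 0" "1 / a i \<in> Z2" "(1 / a i + 1 / a j) / 4 \<in> Z2"
  shows "package m {i, j} (diag_form {i, j} a)
    {(1 / a i) \<odot> unit_coord i, (1 / (2 * a i)) \<odot> unit_coord i + (1 / (2 * a j)) \<odot> unit_coord j}
    (unit_coord i) (unit_coord j) (a i) (a j) r1 r2 0 0"
proof -
  let ?e = "unit_coord i" and ?g = "unit_coord j" and ?b = "diag_form {i, j} a"
  define x y where "x = (1 / a i) \<odot> ?e" and "y = (1 / (2 * a i)) \<odot> ?e + (1 / (2 * a j)) \<odot> ?g"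
  note B = bilinD[OF bilin_diag_form[of "{i, j}" a]]
  have eg: "?b ?e ?e = 2 * a i" "?b ?g ?g = 2 * a j" "?b ?e ?g = 0" "?b ?g ?e = 0"
    using ij by (simp_all add: diag_form_unit_coord coeff_unit_coord)
  have c: "?e \<in> coord {i, j}" "?g \<in> coord {i, j}" using m by (auto intro: unit_coord_coord)
  have l0: "lat {i, j} ?b {}" by (rule lat_diag_form) (use m r in auto)
  have av: "act ?e = r1 \<odot> ?e" "act ?g = r2 \<odot> ?g" using m by (auto intro: act_unit_coord)
  have xy: "x \<in> ZF.span {x, y}" "y \<in> ZF.span {x, y}" by (auto intro: ZF.span_base)
  have g: "?g = (2 * a j) \<odot> y - a j \<odot> x" "?e = a i \<odot> x"
    using a by (auto simp: x_def y_def coeff_unit_coord intro!: vec_eqI)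
  have gj: "(1 / a j) \<odot> ?g = 2 \<odot> y - x"
    using a by (intro vec_eqI) (simp add: x_def y_def field_simps)
  have gS: "(1 / a j) \<odot> ?g \<in> ZF.span {x, y}" unfolding gj
    using xy by (simp only: ZF.span_diff ZF_span_scale Z2_numeral)
  have bxy: "?b x x / 2 = 1 / a i" "?b x y = 1 / a i" "?b y x = 1 / a i" "?b y y / 2 = (1 / a i + 1 / a j) / 4"
    using a by (simp_all add: x_def y_def B eg field_simps)
  have "lat {i, j} ?b ({} \<union> {x, y})"
  proof (rule lat_extend[OF l0])
    show "{x, y} \<subseteq> coord {i, j}" using c by (auto simp: x_def y_def intro!: coord_closed)
  next
    fix t assume t: "t \<in> {x, y}"
    have "act x = r1 \<odot> x" by (simp add: x_def act_linear av mult.commute)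
    moreover have "act y = r1 \<odot> y + ((r2 - r1) / 2) \<odot> ((1 / a j) \<odot> ?g)"
      by (simp add: y_def act_linear av)
        (rule vec_eqI, simp add: field_simps, simp add: diff_divide_distrib)
    moreover have "r1 \<in> Z2" "(r2 - r1) / 2 \<in> Z2" using r by auto
    ultimately have "act x \<in> ZF.span {x, y}" "act y \<in> ZF.span {x, y}"
      using xy gS by (simp_all only: ZF.span_add ZF_span_scale)
    then show "act t \<in> ZF.span ({} \<union> {x, y})" using t by auto
  next
    fix s t assume "s \<in> {x, y}" "t \<in> {x, y}"
    moreover have "?b x x = 2 * (?b x x / 2)" "?b y y = 2 * (?b y y / 2)" by simp_all
    then have "?b x x \<in> Z2" "?b y y \<in> Z2" unfolding bxy using a by (metis Z2_mult Z2_numeral)+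
    ultimately show "?b s t \<in> Z2" using a by (auto simp: bxy)
  next
    fix t assume "t \<in> {x, y}"
    then show "?b t t / 2 \<in> Z2" by (elim insertE emptyE) (simp_all only: bxy a)
  qed auto
  then have lat: "lat {i, j} ?b {x, y}" by simp
  have fin: "package m {i, j} ?b {x, y} ?e ?g (a i) (a j) r1 r2 0 0"
  proof unfold_locales
    show "coord {i, j} \<subseteq> QF.span {x, y}"
    proof
      fix v assume v: "v \<in> coord {i, j}"
      have "?e \<in> QF.span {x, y}" "?g \<in> QF.span {x, y}"
        unfolding g by (intro QF.span_diff QF.span_scale QF.span_base; simp)+
      then have "coeff (v i) 0 \<odot> ?e + coeff (v j) 0 \<odot> ?g \<in> QF.span {x, y}"
        by (intro QF.span_add QF.span_scale)
      then show "v \<in> QF.span {x, y}" using coord_pair[OF m ij v] by simp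
    qed
  next
    fix v assume v: "v \<in> coord {i, j}" and int: "\<And>w. w \<in> {x, y} \<Longrightarrow> ?b w v \<in> Z2"
    define \<alpha> \<beta> where "\<alpha> = coeff (v i) 0" and "\<beta> = coeff (v j) 0"
    have ve: "v = \<alpha> \<odot> ?e + \<beta> \<odot> ?g" unfolding \<alpha>_def \<beta>_def by (rule coord_pair[OF m ij v])
    have "?b x v = 2 * \<alpha>" "?b y v = \<alpha> + \<beta>"
      using a by (simp_all add: x_def y_def ve B eg field_simps)
    then have i: "2 * \<alpha> \<in> Z2" "\<alpha> + \<beta> \<in> Z2" using int[of x] int[of y] by simp_all
    then have "2 * \<alpha> - (\<alpha> + \<beta>) \<in> Z2" by (rule Z2_diff)
    then have "\<alpha> - \<beta> \<in> Z2" by (simp add: algebra_simps)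
    moreover have "v = 0 + \<alpha> \<odot> ?e + \<beta> \<odot> ?g" using ve by simp
    ultimately show "\<exists>r\<in>ZF.span {x, y}. \<exists>\<alpha> \<beta>. 2 * \<alpha> \<in> Z2 \<and> \<alpha> - \<beta> \<in> Z2 \<and> v = r + \<alpha> \<odot> ?e + \<beta> \<odot> ?g"
      using i(1) ZF.span_zero by blast
  next
    fix w assume "w \<in> {x, y}"
    then show "?b w ((1/2) \<odot> (?e + ?g)) \<in> Z2" "?b w ((1/2) \<odot> (?e - ?g)) \<in> Z2"
      using a by (auto simp: x_def y_def B eg)
  qed (use lat c eg a xy av r in \<open>simp_all add: x_def y_def ZF.span_zero\<close>)
  then show ?thesis by (simp add: x_def y_def)
qed

text \<open>A discriminant form and its negative: the graph of the isomorphism that matches the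
  poles is isotropic, since the contributions of both sides cancel, and it is its own orthogonal
  complement. The two adjoined vectors generate the graph.\<close>

lemma package_glue:
  assumes P: "package m J b S s1 s2 A1 A2 r1 r2 o1 o2"
    and P': "package m J' b' S' s1' s2' A1' A2' r1 r2 o1' o2'"
    and disj: "J \<inter> J' = {}" and A: "A1' = - A1" "A2' = - A2"
  shows "good (J \<union> J') (\<lambda>x y. b x y + b' x y)
    (S \<union> S' \<union> {(1/2) \<odot> ((s1 + s2) + (s1' + s2')), (1/2) \<odot> ((s1 - s2) + (s1' - s2'))})"
proof -
  interpret P: package m J b S s1 s2 A1 A2 r1 r2 o1 o2 by (rule P)
  interpret P': package m J' b' S' s1' s2' A1' A2' r1 r2 o1' o2' by (rule P')
  define c where "c = (\<lambda>x y. b x y + b' x y)"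
  define U where "U = S \<union> S'"
  have latU: "lat (J \<union> J') c U" unfolding c_def U_def using P.lat P'.lat disj by (rule lat_Un)
  note C = bilinD[OF latD(1)[OF latU]]
  have b'0: "b' x y = 0" "b' y x = 0" if "x \<in> coord J" for x y
    using supported_zero[OF P'.L(1,2)] coord_zero[OF that disj] by auto
  have b0: "b x y = 0" "b y x = 0" if "x \<in> coord J'" for x y
    using supported_zero[OF P.L(1,2)] coord_zero[OF that] disj by blast+
  have SJ: "x \<in> coord J" if "x \<in> ZF.span S" for x using that ZF_span_coord[OF P.L(4)] by blast
  have SJ': "x \<in> coord J'" if "x \<in> ZF.span S'" for x using that ZF_span_coord[OF P'.L(4)] by blast
  have cv: "c x y = b x y" if "x \<in> coord J" for x y using b'0[OF that] by (simp add: c_def)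
  have cv': "c x y = b' x y" if "x \<in> coord J'" for x y using b0[OF that] by (simp add: c_def)
  have vals: "c s1 s1 = 2 * A1" "c s2 s2 = 2 * A2" "c s1 s2 = 0" "c s2 s1 = 0"
    "c s1' s1' = - 2 * A1" "c s2' s2' = - 2 * A2" "c s1' s2' = 0" "c s2' s1' = 0"
    using P.vals P.vals' P'.vals P'.vals' A by (simp_all add: cv cv' P.s_coord P'.s_coord)
  have vals0: "c s1 s1' = 0" "c s1 s2' = 0" "c s2 s1' = 0" "c s2 s2' = 0"
     "c s1' s1 = 0" "c s1' s2 = 0" "c s2' s1 = 0" "c s2' s2 = 0"
    by (simp_all add: cv cv' P.s_coord P'.s_coord b0)  (simp_all add: b'0 P.s_coord)
  define w1 w2 where "w1 = (1/2) \<odot> ((s1 + s2) + (s1' + s2'))" and "w2 = (1/2) \<odot> ((s1 - s2) + (s1' - s2'))"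
  define T where "T = U \<union> {w1, w2}"
  have sub: "x \<in> ZF.span T" if "x \<in> ZF.span S \<or> x \<in> ZF.span S'" for x
    using that ZF.span_mono[of S T] ZF.span_mono[of S' T] unfolding T_def U_def by blast
  have wT: "w1 \<in> ZF.span T" "w2 \<in> ZF.span T" unfolding T_def by (auto intro: ZF.span_base)
  have w0: "c w1 w1 = 0" "c w1 w2 = 0" "c w2 w1 = 0" "c w2 w2 = 0"
    unfolding w1_def w2_def by (simp_all add: C vals vals0)
  have mono: "coord J \<subseteq> coord (J \<union> J')" "coord J' \<subseteq> coord (J \<union> J')" by (intro coord_mono; auto)+
  have lat: "lat (J \<union> J') c T"
    unfolding T_def
  proof (rule lat_extend[OF latU])
    show "{w1, w2} \<subseteq> coord (J \<union> J')"
      using mono P.s_coord P'.s_coord by (auto simp: w1_def w2_def intro!: coord_closed)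
  next
    fix t assume t: "t \<in> {w1, w2}"
    have o: "(1/2) \<odot> (o1 + o2) \<in> ZF.span T" "(1/2) \<odot> (o1' + o2') \<in> ZF.span T" "o2 \<in> ZF.span T" "o2' \<in> ZF.span T"
      using sub P.acts P'.acts by blast+
    have a1: "act w1 = ((r1 + r2) / 2) \<odot> w1 + ((r1 - r2) / 2) \<odot> w2 + ((1/2) \<odot> (o1 + o2) + (1/2) \<odot> (o1' + o2'))"
      unfolding w1_def w2_def by (simp add: act_linear P.acts P'.acts) (rule vec_eqI, simp add: field_simps)
    have a2: "act w2 = ((r1 - r2) / 2) \<odot> w1 + ((r1 + r2) / 2) \<odot> w2 + ((1/2) \<odot> (o1 + o2) + (1/2) \<odot> (o1' + o2') - o2 - o2')"
      unfolding w1_def w2_def by (simp add: act_linear P.acts P'.acts) (rule vec_eqI, simp add: field_simps)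
    have "(r1 + r2) / 2 \<in> Z2" "(r1 - r2) / 2 \<in> Z2" using P.sgn by auto
    then have "act w1 \<in> ZF.span T" "act w2 \<in> ZF.span T"
      unfolding a1 a2 using wT o by (simp_all only: ZF.span_add ZF.span_diff ZF_span_scale)
    then show "act t \<in> ZF.span (U \<union> {w1, w2})" using t unfolding T_def by auto
  next
    fix s t assume s: "s \<in> U" and t: "t \<in> {w1, w2}"
    have w: "w1 = (1/2) \<odot> (s1 + s2) + (1/2) \<odot> (s1' + s2')" "w2 = (1/2) \<odot> (s1 - s2) + (1/2) \<odot> (s1' - s2')"
      by (simp_all add: w1_def w2_def QF.scale_right_distrib)
    have h: "(1/2) \<odot> (s1 + s2) \<in> coord J" "(1/2) \<odot> (s1 - s2) \<in> coord J"
      "(1/2) \<odot> (s1' + s2') \<in> coord J'" "(1/2) \<odot> (s1' - s2') \<in> coord J'"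
      using P.s_coord P'.s_coord by (auto intro!: coord_closed)
    from s consider "s \<in> S" | "s \<in> S'" unfolding U_def by blast
    then show "c s t \<in> Z2"
    proof cases
      case 1
      then have sc: "s \<in> coord J" using P.L(4) by blast
      have "c s w1 = b s ((1/2) \<odot> (s1 + s2))" "c s w2 = b s ((1/2) \<odot> (s1 - s2))"
        unfolding w by (simp_all only: cv[OF sc] P.B(2) b0(2) h add_0_right)
      then show ?thesis using t P.half[OF 1] by auto
    next
      case 2
      then have sc: "s \<in> coord J'" using P'.L(4) by blast
      have "c s w1 = b' s ((1/2) \<odot> (s1' + s2'))" "c s w2 = b' s ((1/2) \<odot> (s1' - s2'))"
        unfolding w by (simp_all only: cv'[OF sc] P'.B(2) b'0(2) h add_0_left)
      then show ?thesis using t P'.half[OF 2] by auto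
    qed
  next
    fix s t assume "s \<in> {w1, w2}" "t \<in> {w1, w2}"
    then show "c s t \<in> Z2" using w0 by auto
  next
    fix t assume "t \<in> {w1, w2}"
    then show "c t t / 2 \<in> Z2" using w0 by auto
  qed simp
  have "y \<in> ZF.span T" if y: "y \<in> coord (J \<union> J')" "\<forall>x\<in>T. c x y \<in> Z2" for y
  proof -
    define y1 y2 where "y1 = vrestrict J y" and "y2 = vrestrict J' y"
    have y12: "y = y1 + y2" "y1 \<in> coord J" "y2 \<in> coord J'"
      using vrestrict_split[OF y(1) disj] vrestrict_coord[OF y(1)] by (auto simp: y1_def y2_def)
    have "b x y1 \<in> Z2" if "x \<in> S" for x
    proof -
      have "x \<in> coord J" using that P.L(4) by blast
      then have "c x y = b x y" by (rule cv)
      moreover have "c x y \<in> Z2" using y(2) that unfolding T_def U_def by blast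
      ultimately show ?thesis unfolding y1_def by (simp only: supported_vrestrict[OF P.L(1,2)])
    qed
    then obtain r \<alpha> \<beta> where r: "r \<in> ZF.span S" "2 * \<alpha> \<in> Z2" "\<alpha> - \<beta> \<in> Z2" "y1 = r + \<alpha> \<odot> s1 + \<beta> \<odot> s2"
      using P.dual[OF y12(2)] by blast
    have "b' x y2 \<in> Z2" if "x \<in> S'" for x
    proof -
      have "x \<in> coord J'" using that P'.L(4) by blast
      then have "c x y = b' x y" by (rule cv')
      moreover have "c x y \<in> Z2" using y(2) that unfolding T_def U_def by blast
      ultimately show ?thesis unfolding y2_def by (simp only: supported_vrestrict[OF P'.L(1,2)])
    qed
    then obtain r' \<alpha>' \<beta>' where r': "r' \<in> ZF.span S'" "2 * \<alpha>' \<in> Z2" "\<alpha>' - \<beta>' \<in> Z2" "y2 = r' + \<alpha>' \<odot> s1' + \<beta>' \<odot> s2'"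
      using P'.dual[OF y12(3)] by blast
    define p q where "p = A1 * (\<alpha> - \<alpha>')" and "q = A2 * (\<beta> - \<beta>')"
    define u where "u = \<alpha> \<odot> s1 + \<beta> \<odot> s2 + \<alpha>' \<odot> s1' + \<beta>' \<odot> s2'"
    have yu: "y = (r + r') + u" unfolding y12(1) r(4) r'(4) u_def by (simp add: add_ac)
    have rr: "r + r' \<in> ZF.span T" using sub r(1) r'(1) by (blast intro: ZF.span_add)
    have cu: "c w u \<in> Z2" if "w \<in> {w1, w2}" for w
    proof -
      have w: "w \<in> ZF.span T" "c w y \<in> Z2" using that wT y(2) unfolding T_def by auto
      have "c w (r + r') \<in> Z2" using latD(7)[OF lat w(1) rr] .
      with w(2) have "c w y - c w (r + r') \<in> Z2" by (rule Z2_diff)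
      then show ?thesis by (simp add: yu C)
    qed
    have e: "c w1 u = p + q" "c w2 u = p - q"
      unfolding w1_def w2_def u_def p_def q_def by (simp_all add: C vals vals0 algebra_simps)
    have pq: "p + q \<in> Z2" "p - q \<in> Z2" using cu[of w1] cu[of w2] e by simp_all
    have "(p + q) + (p - q) \<in> Z2" using pq by (rule Z2_add)
    then have p2: "2 * p \<in> Z2" by simp
    have "2 * \<alpha>' - (\<alpha>' - \<beta>') \<in> Z2" using r'(2,3) by (rule Z2_diff)
    then have ab: "\<alpha>' + \<beta>' \<in> Z2" by (simp add: algebra_simps)
    \<comment> \<open>The part (\<alpha> - \<alpha>') s1 + (\<beta> - \<beta>') s2 equals (p/A1) s1
      + (q/A2) s2 and is expressed by the lattice vectors of \<open>dualvec\<close>; what is left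
      lies on the graph and is a combination of \<open>w1\<close> and \<open>w2\<close>.\<close>
    have ue: "u = (2 * p) \<odot> ((1/(2*A1)) \<odot> s1 + (1/(2*A2)) \<odot> s2) - (p - q) \<odot> ((1/A2) \<odot> s2)
        + ((\<alpha>' + \<beta>') \<odot> w1 + (\<alpha>' - \<beta>') \<odot> w2)"
      using P.vals(4,5) unfolding u_def w1_def w2_def p_def q_def
      by (intro vec_eqI) (simp add: field_simps)
    have "u \<in> ZF.span T" unfolding ue
      using sub[of "(1/(2*A1)) \<odot> s1 + (1/(2*A2)) \<odot> s2"] sub[of "(1/A2) \<odot> s2"] P.dualvec(2) P.dualvec2
        p2 pq ab r'(3) wT
      by (simp only: ZF.span_add ZF.span_diff ZF_span_scale simp_thms)
    with rr show ?thesis unfolding yu by (rule ZF.span_add)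
  qed
  moreover have "coord (J \<union> J') \<subseteq> QF.span T"
  proof
    fix y assume y: "y \<in> coord (J \<union> J')"
    have "vrestrict J y \<in> QF.span S" "vrestrict J' y \<in> QF.span S'"
      using vrestrict_coord[OF y] P.spanning P'.spanning by blast+
    then have "vrestrict J y \<in> QF.span T" "vrestrict J' y \<in> QF.span T"
      using QF.span_mono[of S T] QF.span_mono[of S' T] unfolding T_def U_def by blast+
    then have "vrestrict J y + vrestrict J' y \<in> QF.span T" by (rule QF.span_add)
    then show "y \<in> QF.span T" using vrestrict_split[OF y disj] by simp
  qed
  ultimately have "good (J \<union> J') c T" using lat unfolding good_def by blast
  then show ?thesis unfolding c_def T_def U_def w1_def w2_def .
qed

end

context package
begin

text \<open>The line \<open>j\<close> may carry either sign \<open>r\<close>: since \<open>t s\<^sub>2\<close> itself is adjoined, \<open>t s\<^sub>2 / 2\<close> and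
  \<open>- t s\<^sub>2 / 2\<close> agree modulo the lattice.\<close>

lemma good_absorb:
  assumes ij: "i \<noteq> j" "i \<notin> J" "j \<notin> J" and m: "m i = [:- r1, 1:]" "m j = [:- r, 1:]"
    and r: "r = 1 \<or> r = - 1" and a: "a i = - A1" "a j = - (t ^ 2 * A2)"
    and u: "Z2_unit (t ^ 2 * A2)" and t: "t / 2 \<in> Z2"
  shows "good (J \<union> {i, j}) (\<lambda>x y. b x y + diag_form {i, j} a x y)
    (S \<union> {s1 + unit_coord i, (1 / (4 * A1)) \<odot> (s1 - unit_coord i), t \<odot> s2, (1/2) \<odot> (t \<odot> s2 + unit_coord j)})"
proof -
  define c where "c = (\<lambda>x y. b x y + diag_form {i, j} a x y)"
  define a2 where "a2 = t ^ 2 * A2"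
  let ?e = "unit_coord i" and ?g = "unit_coord j" and ?J = "J \<union> {i, j}"
  have t0: "t \<noteq> 0" using u by (auto simp: Z2_unit_def)
  have a2: "a2 \<in> Z2" "inverse a2 \<in> Z2" "a2 \<noteq> 0" using u by (auto simp: Z2_unit_def a2_def)
  have disj: "J \<inter> {i, j} = {}" using ij by auto
  have latd: "lat {i, j} (diag_form {i, j} a) {}" by (rule lat_diag_form) (use m r sgn in auto)
  have lat0: "lat ?J c S" using lat_Un[OF lat latd disj] by (simp add: c_def)
  note C = bilinD[OF latD(1)[OF lat0]]
  note d = bilin_diag_form[of "{i, j}" a] supported_diag_form[of "{i, j}" a]
  have d0: "diag_form {i, j} a x y = 0" "diag_form {i, j} a y x = 0" if "x \<in> coord J" for x y
    using supported_zero[OF d] coord_zero[OF that disj] by auto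
  have eg: "?e \<in> coord {i, j}" "?g \<in> coord {i, j}" using m by (auto intro: unit_coord_coord)
  have b0: "b x y = 0" "b y x = 0" if "x \<in> coord {i, j}" for x y
    using supported_zero[OF L(1,2)] coord_zero[OF that] disj by blast+
  have cv: "c x y = b x y" if "x \<in> coord J" for x y using d0[OF that] by (simp add: c_def)
  have vals1: "c s1 s1 = 2 * A1" "c s2 s2 = 2 * A2" "c s1 s2 = 0" "c s2 s1 = 0"
    using vals vals' by (simp_all add: cv s_coord)
  have vals2: "c ?e ?e = - 2 * A1" "c ?g ?g = - 2 * a2" "c ?e ?g = 0" "c ?g ?e = 0"
    using ij a by (simp_all add: c_def b0 eg diag_form_unit_coord coeff_unit_coord a2_def)
  have vals0: "c s1 ?e = 0" "c s1 ?g = 0" "c s2 ?e = 0" "c s2 ?g = 0"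
     "c ?e s1 = 0" "c ?e s2 = 0" "c ?g s1 = 0" "c ?g s2 = 0"
    by (simp_all add: c_def b0 eg d0 s_coord)
  \<comment> \<open>Evenness of t makes 1/A2 divisible by 4; by \<open>inverse_A\<close> the same
    then holds for 1/A1, which is why the coefficient of \<open>y\<close> below is integral.\<close>
  have A2i: "1 / A2 = 4 * ((t/2) ^ 2 * inverse a2)"
    using t0 vals by (simp add: a2_def power_divide field_simps)
  have "(1 / A1 + 1 / A2) / 4 - (t/2) ^ 2 * inverse a2 \<in> Z2"
    using inverse_A(3) t a2 by (intro Z2_diff Z2_mult Z2_power)
  then have A4: "1 / (4 * A1) \<in> Z2" unfolding A2i by (simp add: field_simps)
  have tZ: "t \<in> Z2" using Z2_mult[OF Z2_numeral t, of "Num.Bit0 Num.One"] by simp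
  \<comment> \<open>\<open>x\<close> and \<open>y\<close> form a hyperbolic pair with product 1;
    \<open>z\<close> and \<open>z'\<close> span a plane of determinant -a2^2, a unit.\<close>
  define x y z z' where "x = s1 + ?e" and "y = (1 / (4 * A1)) \<odot> (s1 - ?e)"
    and "z = t \<odot> s2" and "z' = (1/2) \<odot> (t \<odot> s2 + ?g)"
  define T where "T = S \<union> {x, y, z, z'}"
  have inT: "x \<in> ZF.span T" "y \<in> ZF.span T" "z \<in> ZF.span T" "z' \<in> ZF.span T"
    "\<And>v. v \<in> ZF.span S \<Longrightarrow> v \<in> ZF.span T"
    unfolding T_def using ZF.span_mono[of S "S \<union> {x, y, z, z'}"] by (auto intro: ZF.span_base)
  have bxx: "c x x = 0" "c x y = 1" "c x z = 0" "c x z' = 0"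
    "c y x = 1" "c y y = 0" "c y z = 0" "c y z' = 0"
    "c z x = 0" "c z y = 0" "c z z = 2 * a2" "c z z' = a2"
    "c z' x = 0" "c z' y = 0" "c z' z = a2" "c z' z' = 0"
    unfolding x_def y_def z_def z'_def using vals(4)
    by (simp_all add: C vals0 vals1 vals2) (simp_all add: a2_def power2_eq_square)
  have mono: "coord J \<subseteq> coord ?J" "coord {i, j} \<subseteq> coord ?J" by (intro coord_mono; auto)+
  have "lat ?J c T"
    unfolding T_def
  proof (rule lat_extend[OF lat0])
    show "{x, y, z, z'} \<subseteq> coord ?J"
      using mono s_coord eg by (auto simp: x_def y_def z_def z'_def intro!: coord_closed)
  next
    fix v assume v: "v \<in> {x, y, z, z'}"
    note act_eg = act_unit_coord[OF m(1)] act_unit_coord[OF m(2)]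
    have 1: "act x = r1 \<odot> x + o1" "act y = r1 \<odot> y + (1 / (4 * A1)) \<odot> o1" "act z = r2 \<odot> z + t \<odot> o2"
      "act z' = r \<odot> z' + ((r2 - r) / 2) \<odot> z + (t / 2) \<odot> o2"
      by (simp_all add: x_def y_def z_def z'_def act_linear acts act_eg) (rule vec_eqI, simp add: field_simps)+
    have "r1 \<in> Z2" "r2 \<in> Z2" "r \<in> Z2" "(r2 - r) / 2 \<in> Z2" using r sgn by auto
    then have "act x \<in> ZF.span T" "act y \<in> ZF.span T" "act z \<in> ZF.span T" "act z' \<in> ZF.span T"
      unfolding 1 using inT inT(5)[OF acts(3)] inT(5)[OF acts(4)] t tZ A4
      by (simp_all only: ZF.span_add ZF_span_scale)
    then show "act v \<in> ZF.span (S \<union> {x, y, z, z'})" using v unfolding T_def by auto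
  next
    fix s v assume s: "s \<in> S" and v: "v \<in> {x, y, z, z'}"
    have sS: "s \<in> ZF.span S" "s \<in> coord J" using s L(4) by (auto intro: ZF.span_base)
    have ce: "c s ?e = 0" "c s ?g = 0" by (simp_all add: c_def b0 eg d0 sS)
    have g: "c s s1 \<in> Z2" "c s (t \<odot> s2) \<in> Z2" "c s ((t/2) \<odot> s2) \<in> Z2"
      using glue_integral[OF sS(1), of 1 0] glue_integral[OF sS(1), of 0 t] glue_integral[OF sS(1), of 0 "t/2"] t tZ
      by (simp_all add: cv[OF sS(2)] Z2_minus)
    have "c s y = (1 / (4 * A1)) * c s s1" "c s z' = c s ((t/2) \<odot> s2)" "c s x = c s s1" "c s z = c s (t \<odot> s2)"
      by (simp_all add: x_def y_def z_def z'_def C ce)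
    moreover have "(1 / (4 * A1)) * c s s1 \<in> Z2" by (rule Z2_mult[OF A4 g(1)])
    ultimately show "c s v \<in> Z2" using v g by auto
  next
    fix s v assume "s \<in> {x, y, z, z'}" "v \<in> {x, y, z, z'}"
    then show "c s v \<in> Z2" using a2(1) by (auto simp: bxx intro!: Z2_mult)
  next
    fix v assume "v \<in> {x, y, z, z'}"
    then show "c v v / 2 \<in> Z2" using a2(1) by (auto simp: bxx)
  qed simp
  note lat1 = this
  have "y0 \<in> ZF.span T" if y0: "y0 \<in> coord ?J" "\<forall>v\<in>T. c v y0 \<in> Z2" for y0
  proof -
    define y1 y2 where "y1 = vrestrict J y0" and "y2 = vrestrict {i, j} y0"
    have y12: "y0 = y1 + y2" "y1 \<in> coord J" "y2 \<in> coord {i, j}"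
      using vrestrict_split[OF y0(1) disj] vrestrict_coord[OF y0(1)] by (auto simp: y1_def y2_def)
    have "b v y1 \<in> Z2" if "v \<in> S" for v
    proof -
      have "v \<in> coord J" using that L(4) by blast
      then have "c v y0 = b v y0" by (rule cv)
      moreover have "c v y0 \<in> Z2" using y0(2) that unfolding T_def by blast
      ultimately show ?thesis unfolding y1_def by (simp only: supported_vrestrict[OF L(1,2)])
    qed
    then obtain r0 \<alpha> \<beta> where r0: "r0 \<in> ZF.span S" "y1 = r0 + \<alpha> \<odot> s1 + \<beta> \<odot> s2"
      using dual[OF y12(2)] by blast
    obtain \<gamma> \<delta> where gd: "y2 = \<gamma> \<odot> ?e + \<delta> \<odot> ?g" using coord_pair[OF m ij(1) y12(3)] by blast
    define w where "w = \<alpha> \<odot> s1 + \<beta> \<odot> s2 + \<gamma> \<odot> ?e + \<delta> \<odot> ?g"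
    have yw: "y0 = r0 + w" unfolding y12(1) r0(2) gd w_def by (simp add: add_ac)
    have cw: "c v w \<in> Z2" if "v \<in> {x, y, z, z'}" for v
    proof -
      have v: "v \<in> ZF.span T" "c v y0 \<in> Z2" using that inT y0(2) unfolding T_def by auto
      have "c v r0 \<in> Z2" using latD(7)[OF lat1 v(1) inT(5)[OF r0(1)]] .
      with v(2) have "c v y0 - c v r0 \<in> Z2" by (rule Z2_diff)
      then show ?thesis by (simp add: yw C)
    qed
    define p q k where "p = 2 * A1 * (\<alpha> - \<gamma>)" and "q = (\<alpha> + \<gamma>) / 2" and "k = \<beta> / t"
    have e: "c x w = p" "c y w = q" "c z w = 2 * a2 * k" "c z' w = a2 * (k - \<delta>)"
      using vals(4) t0 unfolding x_def y_def z_def z'_def w_def p_def q_def k_def a2_def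
      by (simp_all add: C vals0 vals1 vals2 a2_def power2_eq_square field_simps)
    have pq: "p \<in> Z2" "q \<in> Z2" "2 * a2 * k \<in> Z2" "a2 * (k - \<delta>) \<in> Z2"
      using cw[of x] cw[of y] cw[of z] cw[of z'] unfolding e by simp_all
    have "inverse a2 * (2 * a2 * k) \<in> Z2" "inverse a2 * (a2 * (k - \<delta>)) \<in> Z2"
      using pq(3,4) a2(2) by (blast intro: Z2_mult)+
    moreover have "inverse a2 * (2 * a2 * k) = 2 * k" "inverse a2 * (a2 * (k - \<delta>)) = k - \<delta>"
      using a2(3) by simp_all
    ultimately have k: "2 * k \<in> Z2" "k - \<delta> \<in> Z2" by simp_all
    have "2 * k - 2 * (k - \<delta>) \<in> Z2" by (rule Z2_diff[OF k(1) Z2_mult[OF Z2_numeral k(2)]])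
    then have d2: "2 * \<delta> \<in> Z2" by (simp add: algebra_simps)
    \<comment> \<open>For the hyperbolic pair, the coordinate along \<open>x\<close> is the value at
      \<open>y\<close> and conversely; the other two coefficients come from the values at
      \<open>z\<close> and \<open>z'\<close> divided by the unit a2.\<close>
    have we: "w = q \<odot> x + p \<odot> y + (k - \<delta>) \<odot> z + (2 * \<delta>) \<odot> z'"
      using vals(4) t0 unfolding w_def x_def y_def z_def z'_def p_def q_def k_def
      by (intro vec_eqI) (simp add: field_simps)
    have "w \<in> ZF.span T" unfolding we using inT pq k d2 by (simp only: ZF.span_add ZF_span_scale)
    with inT(5)[OF r0(1)] show ?thesis unfolding yw by (rule ZF.span_add)
  qed
  moreover have "coord ?J \<subseteq> QF.span T"
  proof
    fix v assume v: "v \<in> coord ?J"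
    have sp: "vrestrict J v \<in> QF.span T"
      using vrestrict_coord[OF v] spanning QF.span_mono[of S T] unfolding T_def by blast
    have s: "s1 \<in> QF.span T" "s2 \<in> QF.span T"
      using s_coord spanning QF.span_mono[of S T] unfolding T_def by blast+
    have T: "x \<in> QF.span T" "z' \<in> QF.span T" by (auto simp: T_def intro: QF.span_base)
    have "?e = x - s1" "?g = 2 \<odot> z' - t \<odot> s2" by (auto simp: x_def z'_def intro!: vec_eqI)
    then have "?e \<in> QF.span T" "?g \<in> QF.span T"
      using s T by (auto intro!: QF.span_diff QF.span_scale)
    then have "vrestrict {i, j} v \<in> QF.span T"
      using coord_pair[OF m ij(1) vrestrict_coord[OF v, of "{i, j}"]]
      by (metis QF.span_add QF.span_scale Un_upper2)
    with sp have "vrestrict J v + vrestrict {i, j} v \<in> QF.span T" by (rule QF.span_add)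
    then show "v \<in> QF.span T" using vrestrict_split[OF v disj] by simp
  qed
  ultimately have "good ?J c T" using lat1 unfolding good_def by blast
  then show ?thesis unfolding c_def T_def x_def y_def z_def z'_def .
qed

end

section \<open>Coprimality and the Chinese remainder theorem\<close>

definition bezout :: "two_adic poly \<Rightarrow> two_adic poly \<Rightarrow> bool" where
  "bezout p q \<longleftrightarrow> (\<exists>u v. u * p + v * q = 1)"

lemma bezout_sym: "bezout p q \<Longrightarrow> bezout q p"
  unfolding bezout_def by (metis add.commute)

lemma bezout_mult:
  assumes "bezout p q" "bezout p q'"
  shows "bezout p (q * q')"
proof -
  obtain u v u' v' where uv: "u * p + v * q = 1" "u' * p + v' * q' = 1" using assms unfolding bezout_def by blast
  have E: "(u * u' * p + u * v' * q' + v * q * u') * p + (v * v') * (q * q')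
      = (u * p + v * q) * (u' * p + v' * q')" by (simp only: distrib_left distrib_right mult_ac add_ac)
  have "(u * u' * p + u * v' * q' + v * q * u') * p + (v * v') * (q * q') = 1"
    unfolding E uv by simp
  then show ?thesis unfolding bezout_def by blast
qed

lemma bezout_1: "bezout p 1"
  unfolding bezout_def by (rule exI[of _ 0], rule exI[of _ 1]) simp

lemma bezout_prod: "(\<And>i. i \<in> I \<Longrightarrow> bezout p (f i)) \<Longrightarrow> bezout p (prod f I)"
  by (induction I rule: infinite_finite_induct) (auto intro: bezout_mult bezout_1)

lemma bezout_mult_dvd:
  assumes "bezout p q" "p dvd g" "q dvd g"
  shows "p * q dvd g"
proof -
  obtain u v where uv: "u * p + v * q = 1" using assms unfolding bezout_def by blast
  have "g = u * (p * g) + v * (g * q)"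
    using arg_cong[OF uv, of "\<lambda>x. x * g"] by (simp add: algebra_simps)
  moreover have "p * q dvd p * g" "p * q dvd g * q" using assms by (auto intro: mult_dvd_mono)
  ultimately show ?thesis by (metis dvd_add dvd_mult)
qed

lemma bezout_prod_dvd:
  assumes "finite I" "\<And>i j. i \<in> I \<Longrightarrow> j \<in> I \<Longrightarrow> i \<noteq> j \<Longrightarrow> bezout (f i) (f j)"
    "\<And>i. i \<in> I \<Longrightarrow> f i dvd g"
  shows "prod f I dvd g"
  using assms
proof (induction I rule: finite_induct)
  case (insert i I)
  have "bezout (f i) (prod f I)" by (intro bezout_prod insert.prems) (use insert.hyps in auto)
  then have "f i * prod f I dvd g" using insert by (intro bezout_mult_dvd) auto
  then show ?case using insert by simp
qed simp

context coords
begin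

text \<open>By the Chinese remainder theorem, \<open>c\<close> and \<open>iota\<close> are inverse
  isomorphisms between the coordinates and K[X]/(F), and \<open>bil\<close> is transported along
  them. The unit \<kappa> rescales the form and leaves lattice and dual unchanged; it provides
  opposite copies and, later, the prescribed determinants.\<close>

lemma package_sym_poly:
  assumes F: "sym_poly F n" and J: "finite J" and prod: "F = (\<Prod>i\<in>J. m i)"
    and cop: "\<And>i j. i \<in> J \<Longrightarrow> j \<in> J \<Longrightarrow> i \<noteq> j \<Longrightarrow> bezout (m i) (m j)"
    and \<kappa>: "Z2_unit \<kappa>"
  obtains b S s1 s2 o1 o2 where
    "package m J b S s1 s2 (\<kappa> / poly F 1) (\<kappa> * (- 1) ^ (n - 1) / poly F (- 1)) 1 (- 1) o1 o2"
proof -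
  interpret sym_poly F n by (rule F)
  \<comment> \<open>The idempotent of the factor i, taken from a Bezout relation between
    \<open>m i\<close> and the product of the other moduli.\<close>
  have "\<exists>\<epsilon>. \<forall>j\<in>J. m j dvd \<epsilon> - (if i = j then 1 else 0)" if i: "i \<in> J" for i
  proof -
    have "bezout (m i) (\<Prod>j\<in>J-{i}. m j)" by (intro bezout_prod cop) (use i in auto)
    then obtain u v where uv: "u * m i + v * (\<Prod>j\<in>J-{i}. m j) = 1" unfolding bezout_def by blast
    have "m j dvd v * (\<Prod>j\<in>J-{i}. m j) - (if i = j then 1 else 0)" if "j \<in> J" for j
    proof (cases "i = j")
      case True
      have "v * (\<Prod>j\<in>J-{i}. m j) - 1 = - u * m i" using uv by (simp add: algebra_simps flip: uv)
      then show ?thesis using True by simp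
    next
      case False
      then have "m j dvd (\<Prod>j\<in>J-{i}. m j)" using J that by (intro dvd_prodI) auto
      then show ?thesis using False by simp
    qed
    then show ?thesis by blast
  qed
  then obtain \<epsilon> where \<epsilon>: "\<And>i j. i \<in> J \<Longrightarrow> j \<in> J \<Longrightarrow> m j dvd \<epsilon> i - (if i = j then 1 else 0)" by metis
  define c where "c x = (\<Sum>i\<in>J. x i * \<epsilon> i)" for x :: "'i \<Rightarrow> two_adic poly"
  define iota where "iota g = (\<lambda>i. if i \<in> J then g mod m i else 0)" for g
  have smult_sum: "smult k (sum f J) = (\<Sum>i\<in>J. smult k (f i))" for k and f :: "'i \<Rightarrow> two_adic poly"
    by (induction J rule: infinite_finite_induct) (simp_all add: smult_add_right)
  have c_lin: "c (x + y) = c x + c y" "c (k \<odot> x) = smult k (c x)" for x y k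
    by (simp_all add: c_def scaleF_def distrib_right sum.distrib smult_sum)
  have c_mod: "m j dvd c x - x j" if j: "j \<in> J" for x j
  proof -
    have "c x - x j = (\<Sum>i\<in>J. x i * \<epsilon> i) - (\<Sum>i\<in>J. x i * (if i = j then 1 else 0))"
      using j J by (simp add: c_def if_distrib[of "\<lambda>y. _ * y"] cong: if_cong)
    also have "\<dots> = (\<Sum>i\<in>J. x i * (\<epsilon> i - (if i = j then 1 else 0)))"
      by (simp add: sum_subtractf[symmetric] right_diff_distrib)
    finally show ?thesis using \<epsilon>[OF _ j] by (auto intro!: dvd_sum dvd_mult)
  qed
  have iota_coord: "iota g \<in> coord J" for g by (simp add: iota_def coord_def)
  have iota_c: "iota (c x) = x" if x: "x \<in> coord J" for x
  proof (rule ext)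
    fix i show "iota (c x) i = x i"
    proof (cases "i \<in> J")
      case True
      then have "c x mod m i = x i mod m i" using c_mod by (simp add: mod_eq_dvd_iff)
      then show ?thesis using True x by (simp add: iota_def coord_def)
    qed (use x in \<open>simp add: iota_def coord_def\<close>)
  qed
  have c_iota: "c (iota g) \<approx> g" for g
  proof -
    have "(\<Prod>i\<in>J. m i) dvd c (iota g) - g"
    proof (intro bezout_prod_dvd J cop)
      fix i assume i: "i \<in> J"
      have "m i dvd g mod m i - g" by (simp add: mod_eq_dvd_iff[symmetric])
      then have "m i dvd (c (iota g) - iota g i) + (g mod m i - g)" by (rule dvd_add[OF c_mod[OF i]])
      then show "m i dvd c (iota g) - g" using i by (simp add: iota_def)
    qed
    then show ?thesis unfolding eqv_iff_dvd prod[symmetric] .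
  qed
  have iota_cong: "iota g = iota h" if "g \<approx> h" for g h
  proof (rule ext)
    fix i
    have "m i dvd g - h" if "i \<in> J"
    proof -
      have "m i dvd F" using dvd_prodI[OF J that, of m] by (simp only: prod)
      then show ?thesis using \<open>g \<approx> h\<close> unfolding eqv_iff_dvd by (rule dvd_trans)
    qed
    then show "iota g i = iota h i" by (simp add: iota_def mod_eq_dvd_iff)
  qed
  have iota_lin: "iota (g + h) = iota g + iota h" "iota (g - h) = iota g - iota h"
    "iota (smult k g) = k \<odot> iota g" "iota 0 = 0" for g h k
    by (auto simp: iota_def fun_eq_iff scaleF_def poly_mod_add_left poly_mod_diff_left mod_smult_left)
  have iota_sum: "iota (sum f I) = (\<Sum>i\<in>I. iota (f i))" for f and I :: "nat set"
    by (induction I rule: infinite_finite_induct) (simp_all add: iota_lin)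
  have act_iota: "act (iota g) = iota (Xp * g)" for g
    by (auto simp: act_def iota_def fun_eq_iff mod_mult_right_eq)
  define b where "b x y = \<kappa> * bil (c x) (c y)" for x y
  have b: "bilin b"
    unfolding bilin_def b_def
    by (auto simp: c_lin bil_add_left bil_smult_left algebra_simps) (use bil_sym in metis)
  have b_iota: "b (iota g) (iota h) = \<kappa> * bil g h" for g h
    using bil_cong[OF c_iota c_iota, of g h] by (simp add: b_def)
  define S where "S = (\<lambda>j. iota (Xp ^ j)) ` {..<2*n}"
  have expand: "iota g = (\<Sum>j<2*n. coeff (g mod F) j \<odot> iota (Xp ^ j))" for g
  proof -
    have "degree (g mod F) < 2 * n" using degree_mod_less'[of F g] deg n0 by fastforce
    then have "g mod F = (\<Sum>j<2*n. smult (coeff (g mod F) j) (Xp ^ j))"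
      using n0 by (subst poly_as_sum_of_monoms'[of "g mod F" "2 * n - 1", symmetric])
        (auto simp: monom_altdef lessThan_Suc_atMost[symmetric] intro!: sum.cong)
    moreover have "iota g = iota (g mod F)" by (rule iota_cong[OF eqv_sym[OF eqv_mod]])
    ultimately show ?thesis by (metis (no_types, lifting) iota_lin(3) iota_sum sum.cong)
  qed
  have Zspan: "iota g \<in> ZF.span S" if "zpoly g" for g
  proof -
    have "zpoly (g mod F)" using that zF monic by (simp add: zpoly_mod_monic)
    then show ?thesis unfolding expand[of g]
      by (intro ZF.span_sum ZF_span_scale ZF.span_base) (auto simp: zpoly_def S_def)
  qed
  have Qspan: "iota g \<in> QF.span S" for g
    unfolding expand[of g] by (intro QF.span_sum QF.span_scale QF.span_base) (auto simp: S_def)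
  have zX: "zpoly (Xp ^ j)" for j by (intro zpoly_power) simp
  have kZ: "\<kappa> \<in> Z2" "inverse \<kappa> \<in> Z2" "\<kappa> \<noteq> 0" using \<kappa> by (auto simp: Z2_unit_def)
  have lat: "lat J b S"
    unfolding lat_def
  proof (intro conjI ballI)
    show "supported J b" unfolding supported_def b_def c_def by (auto simp: bil_def)
    show "S \<subseteq> coord J" using iota_coord by (auto simp: S_def)
    show "act ` S \<subseteq> ZF.span S"
    proof (rule image_subsetI)
      fix x assume "x \<in> S"
      then obtain j where x: "x = iota (Xp ^ j)" by (auto simp: S_def)
      show "act x \<in> ZF.span S" unfolding x act_iota by (intro Zspan zpoly_mult zX) simp
    qed
  next
    fix x y assume xy: "x \<in> coord J" "y \<in> coord J"
    have "b (act (iota (c x))) (act (iota (c y))) = b (iota (c x)) (iota (c y))"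
      unfolding act_iota b_iota bil_X ..
    then show "b (act x) (act y) = b x y" using xy by (simp add: iota_c)
  next
    fix x y assume "x \<in> S" "y \<in> S"
    then show "b x y \<in> Z2" using kZ zX by (auto simp: S_def b_iota intro!: Z2_mult bil_zpoly)
  next
    fix x assume "x \<in> S"
    then obtain j where x: "x = iota (Xp ^ j)" by (auto simp: S_def)
    have "\<kappa> * (bil (Xp ^ j) (Xp ^ j) / 2) \<in> Z2" by (rule Z2_mult[OF kZ(1) bil_even[OF zX]])
    then show "b x x / 2 \<in> Z2" by (simp add: x b_iota)
  qed (auto simp: b S_def)
  define s1 s2 where "s1 = iota (pole 1)" and "s2 = iota (pole (- 1))"
  define A1 A2 where "A1 = \<kappa> / poly F 1" and "A2 = \<kappa> * (- 1) ^ (n - 1) / poly F (- 1)"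
  have sq: "(- 1 :: two_adic) ^ (n - 1) * (- 1) ^ (n - 1) = 1" by (simp flip: power_mult_distrib)
  have A0: "A1 \<noteq> 0" "A2 \<noteq> 0" using F1 Fm1 kZ by (simp_all add: A1_def A2_def)
  have i1: "inverse A1 = inverse \<kappa> * poly F 1" "inverse A2 = inverse \<kappa> * ((- 1) ^ (n - 1) * poly F (- 1))"
    using sq F1 Fm1 kZ by (simp_all add: A1_def A2_def field_simps)
  have "package m J b S s1 s2 A1 A2 1 (- 1) (iota 1) (iota 1)"
  proof unfold_locales
    show "coord J \<subseteq> QF.span S" using iota_c Qspan by (metis subsetI)
    show "s1 \<in> coord J" "s2 \<in> coord J" using iota_coord by (simp_all add: s1_def s2_def)
    fix y assume y: "y \<in> coord J" and int: "\<And>x. x \<in> S \<Longrightarrow> b x y \<in> Z2"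
    have "bil (c y) (Xp ^ j) \<in> Z2" if "j < 2 * n" for j
    proof -
      have "b (iota (Xp ^ j)) (iota (c y)) \<in> Z2" using int that iota_c[OF y] by (auto simp: S_def)
      then have "inverse \<kappa> * (\<kappa> * bil (Xp ^ j) (c y)) \<in> Z2" unfolding b_iota by (rule Z2_mult[OF kZ(2)])
      then show ?thesis using kZ(3) bil_sym[of "c y" "Xp ^ j"] by (simp add: mult.assoc[symmetric])
    qed
    then obtain r \<alpha> \<beta> where r: "zpoly r" "2 * \<alpha> \<in> Z2" "\<alpha> - \<beta> \<in> Z2"
      "c y \<approx> r + smult \<alpha> (pole 1) + smult \<beta> (pole (- 1))" by (rule dual_zpoly)
    have "y = iota r + \<alpha> \<odot> s1 + \<beta> \<odot> s2"
      using iota_cong[OF r(4)] iota_c[OF y] by (simp add: iota_lin s1_def s2_def)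
    then show "\<exists>r\<in>ZF.span S. \<exists>\<alpha> \<beta>. 2 * \<alpha> \<in> Z2 \<and> \<alpha> - \<beta> \<in> Z2 \<and> y = r + \<alpha> \<odot> s1 + \<beta> \<odot> s2"
      using Zspan[OF r(1)] r(2,3) by blast
  next
    fix x assume "x \<in> S"
    then obtain j where x: "x = iota (Xp ^ j)" by (auto simp: S_def)
    have "(1/2) \<odot> (s1 + s2) = iota (smult (1/2) (pole 1 + pole (- 1)))"
      "(1/2) \<odot> (s1 - s2) = iota (smult (1/2) (pole 1 - pole (- 1)))"
      by (simp_all only: iota_lin s1_def s2_def)
    then show "b x ((1/2) \<odot> (s1 + s2)) \<in> Z2" "b x ((1/2) \<odot> (s1 - s2)) \<in> Z2"
      unfolding x using bil_half_pole_sum[OF zX[of j]] bil_half_pole_diff[OF zX[of j]] kZ(1)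
      by (simp_all only: b_iota bil_sym[of "Xp ^ j"] Z2_mult)
  next
    show "b s1 s1 = 2 * A1" "b s2 s2 = 2 * A2" "b s1 s2 = 0"
      using bil_pole_pole[OF F1] bil_pole_pole[OF Fm1] bil_pole_pole'
      by (simp_all add: s1_def s2_def b_iota A1_def A2_def)
  next
    have "(1 / A1) \<odot> s1 = inverse \<kappa> \<odot> iota (smult (poly F 1) (pole 1))"
      by (simp add: divide_inverse i1 s1_def iota_lin)
    also have "\<dots> \<in> ZF.span S" by (rule ZF_span_scale[OF kZ(2) Zspan[OF zpoly_pole[OF Z2_1 F1]]])
    finally show "(1 / A1) \<odot> s1 \<in> ZF.span S" .
    have e: "(- 1 :: two_adic) ^ (n - 1) = 1 \<or> (- 1 :: two_adic) ^ (n - 1) = - 1"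
      by (cases "even (n - 1)") simp_all
    have h: "1 / (2 * A1) = inverse \<kappa> * (poly F 1 / 2)"
      "1 / (2 * A2) = inverse \<kappa> * ((- 1) ^ (n - 1) * poly F (- 1) / 2)"
      using A0 kZ F1 Fm1 sq by (simp_all add: A1_def A2_def field_simps)
    have "(1 / (2 * A1)) \<odot> s1 + (1 / (2 * A2)) \<odot> s2 = inverse \<kappa> \<odot> iota (smult (poly F 1 / 2) (pole 1)
        + smult ((- 1) ^ (n - 1) * poly F (- 1) / 2) (pole (- 1)))"
      unfolding h s1_def s2_def by (simp only: iota_lin QF.scale_right_distrib QF.scale_scale)
    also have "\<dots> \<in> ZF.span S" by (rule ZF_span_scale[OF kZ(2) Zspan[OF zpoly_half_poles[OF e]]])
    finally show "(1 / (2 * A1)) \<odot> s1 + (1 / (2 * A2)) \<odot> s2 \<in> ZF.span S" .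
  next
    show "act s1 = 1 \<odot> s1 + iota 1" "act s2 = - 1 \<odot> s2 + iota 1"
      unfolding s1_def s2_def act_iota iota_cong[OF X_pole[OF F1]] iota_cong[OF X_pole[OF Fm1]] iota_lin
      by (rule refl)+
    have "(1/2) \<odot> (iota 1 + iota 1) = iota 1"
      by (rule vec_eqI) (simp only: coeff_scaleF plus_fun_apply coeff_add, simp)
    then show "(1/2) \<odot> (iota 1 + iota 1) \<in> ZF.span S" using Zspan by simp
  qed (use lat A0 Zspan in simp_all)
  then show ?thesis using that unfolding A1_def A2_def by blast
qed

end

section \<open>Unimodular lattices with prescribed values on the lines\<close>

locale coords_linear = coords m for m :: "'i \<Rightarrow> two_adic poly" +
  fixes E :: "'i set"
  assumes linear: "i \<in> E \<Longrightarrow> \<exists>r. m i = [:- r, 1:] \<and> (r = 1 \<or> r = - 1)"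
begin

text \<open>Retains of a unimodular lattice only what the determinants depend on: the lines in E are
  orthogonal with values 2 a. One global \<open>a\<close> serves all blocks, so that unions of
  blocks compose.\<close>

definition admits :: "('i \<Rightarrow> two_adic) \<Rightarrow> 'i set \<Rightarrow> bool" where
  "admits a J \<longleftrightarrow> (\<exists>b S. good J b S \<and>
     (\<forall>i\<in>J\<inter>E. \<forall>j\<in>J\<inter>E. b (unit_coord i) (unit_coord j) = (if i = j then 2 * a i else 0)))"

lemma goodD: "good J b S \<Longrightarrow> bilin b" "good J b S \<Longrightarrow> supported J b"
  unfolding good_def lat_def by blast+

lemma admits_Un:
  assumes "admits a J" "admits a K" "J \<inter> K = {}"
  shows "admits a (J \<union> K)"
proof -
  obtain b S c T where b: "good J b S"
    "\<forall>i\<in>J\<inter>E. \<forall>j\<in>J\<inter>E. b (unit_coord i) (unit_coord j) = (if i = j then 2 * a i else 0)"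
    and c: "good K c T"
    "\<forall>i\<in>K\<inter>E. \<forall>j\<in>K\<inter>E. c (unit_coord i) (unit_coord j) = (if i = j then 2 * a i else 0)"
    using assms unfolding admits_def by blast
  have b0: "b (unit_coord i) y = 0" "b y (unit_coord i) = 0" if "i \<in> K" for i y
  proof -
    have "\<forall>j\<in>J. unit_coord i j = 0" using that assms(3) by (auto simp: unit_coord_def)
    then show "b (unit_coord i) y = 0" "b y (unit_coord i) = 0" by (rule supported_zero[OF goodD[OF b(1)]])+
  qed
  have c0: "c (unit_coord i) y = 0" "c y (unit_coord i) = 0" if "i \<in> J" for i y
  proof -
    have "\<forall>j\<in>K. unit_coord i j = 0" using that assms(3) by (auto simp: unit_coord_def)
    then show "c (unit_coord i) y = 0" "c y (unit_coord i) = 0" by (rule supported_zero[OF goodD[OF c(1)]])+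
  qed
  have "b (unit_coord i) (unit_coord j) + c (unit_coord i) (unit_coord j) = (if i = j then 2 * a i else 0)"
    if "i \<in> (J \<union> K) \<inter> E" "j \<in> (J \<union> K) \<inter> E" for i j
    using that b(2) c(2) assms(3) by (auto simp: b0 c0)
  then show ?thesis using good_Un[OF b(1) c(1) assms(3)] unfolding admits_def by blast
qed

lemma admits_empty: "admits a {}"
proof -
  have "good {} (\<lambda>_ _. 0) {}"
    by (auto simp: good_def lat_def bilin_def supported_def coord_def fun_eq_iff ZF.span_zero)
  then show ?thesis unfolding admits_def by blast
qed

lemma admits_pairs:
  fixes N :: nat
  assumes "inj_on h {..<2*N}" "\<And>k. k < N \<Longrightarrow> admits a {h (2 * k), h (2 * k + 1)}"
  shows "admits a (h ` {..<2*N})"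
  using assms
proof (induction N)
  case 0
  then show ?case by (simp add: admits_empty)
next
  case (Suc N)
  have "inj_on h {..<2*N}" using Suc.prems(1) by (rule inj_on_subset) auto
  then have "admits a (h ` {..<2*N})" using Suc by simp
  moreover have "h ` {..<2*N} \<inter> {h (2 * N), h (2 * N + 1)} = {}"
  proof -
    have "h (2 * N) \<noteq> h i" "h (2 * N + 1) \<noteq> h i" if "i < 2 * N" for i
      using inj_onD[OF Suc.prems(1), of "2 * N" i] inj_onD[OF Suc.prems(1), of "2 * N + 1" i] that by auto
    then show ?thesis by auto
  qed
  ultimately have "admits a (h ` {..<2*N} \<union> {h (2 * N), h (2 * N + 1)})"
    using Suc.prems(2)[of N] by (intro admits_Un) auto
  moreover have "h ` {..<2*N} \<union> {h (2 * N), h (2 * N + 1)} = h ` {..<2 * Suc N}"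
    by (auto simp: lessThan_Suc)
  ultimately show ?case by simp
qed

lemma admits_UN:
  assumes "finite I" "\<And>i. i \<in> I \<Longrightarrow> admits a (J i)" "\<And>i j. i \<in> I \<Longrightarrow> j \<in> I \<Longrightarrow> i \<noteq> j \<Longrightarrow> J i \<inter> J j = {}"
  shows "admits a (\<Union>i\<in>I. J i)"
  using assms
proof (induction I rule: finite_induct)
  case (insert i I)
  have "J i \<inter> (\<Union>i\<in>I. J i) = {}" using insert by fastforce
  then show ?case using insert by (simp add: admits_Un)
qed (simp add: admits_empty)

lemma admits_good: "good J b S \<Longrightarrow> J \<inter> E = {} \<Longrightarrow> admits a J"
  unfolding admits_def by auto

text \<open>\<open>good_close\<close> with t1 = t2 = 1, where the two values cancel. The eigenvalues
  of the two lines may differ, so a line of M^+ can be paired with one of M^-.\<close>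

lemma admits_hyperbolic:
  assumes ij: "i \<noteq> j" "i \<in> E" "j \<in> E" and a: "Z2_unit (a i)" "a j = - a i"
  shows "admits a {i, j}"
proof -
  obtain r1 r2 where r: "m i = [:- r1, 1:]" "r1 = 1 \<or> r1 = - 1" "m j = [:- r2, 1:]" "r2 = 1 \<or> r2 = - 1"
    using linear ij by metis
  have a0: "a i \<noteq> 0" "a j \<noteq> 0" "1 / a i \<in> Z2" "(1 / a i + 1 / a j) / 4 \<in> Z2"
  proof -
    show "a i \<noteq> 0" "1 / a i \<in> Z2" using a(1) unfolding Z2_unit_def divide_inverse by simp_all
    then show "a j \<noteq> 0" by (simp add: a(2))
    show "(1 / a i + 1 / a j) / 4 \<in> Z2" by (simp add: a(2))
  qed
  interpret P: package m "{i, j}" "diag_form {i, j} a"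
    "{(1 / a i) \<odot> unit_coord i, (1 / (2 * a i)) \<odot> unit_coord i + (1 / (2 * a j)) \<odot> unit_coord j}"
    "unit_coord i" "unit_coord j" "a i" "a j" r1 r2 0 0
    using ij(1) r(1,3,2,4) a0 by (rule package_unit_coords)
  have u: "Z2_unit (1 ^ 2 * a i)" "Z2_unit (1 ^ 2 * a j)" "(1 ^ 2 * a i + 1 ^ 2 * a j) / 4 \<in> Z2"
    using a by simp_all
  have "\<exists>S. good {i, j} (diag_form {i, j} a) S" using P.good_close[OF u] by (rule exI)
  then obtain S where "good {i, j} (diag_form {i, j} a) S" ..
  moreover have "diag_form {i, j} a (unit_coord k) (unit_coord l) = (if k = l then 2 * a k else 0)"
    if "k \<in> {i, j}" "l \<in> {i, j}" for k l
    using that ij(1) by (auto simp: diag_form_unit_coord coeff_unit_coord)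
  then have "\<forall>k\<in>{i, j} \<inter> E. \<forall>l\<in>{i, j} \<inter> E.
      diag_form {i, j} a (unit_coord k) (unit_coord l) = (if k = l then 2 * a k else 0)" by blast
  ultimately show ?thesis unfolding admits_def by blast
qed

lemma admits_diag:
  assumes "good (J \<union> {i, j}) (\<lambda>x y. b x y + diag_form {i, j} a x y) S" "bilin b" "supported J b"
    "J \<inter> E = {}" "i \<noteq> j" "i \<in> E" "j \<in> E"
  shows "admits a (J \<union> {i, j})"
proof -
  have "b (unit_coord k) y = 0" if "k \<in> E" for k y
  proof -
    have "\<forall>i\<in>J. unit_coord k i = 0" using that assms(4) by (auto simp: unit_coord_def)
    then show ?thesis by (rule supported_zero[OF assms(2,3)])
  qed
  then have "b (unit_coord k) (unit_coord l) + diag_form {i, j} a (unit_coord k) (unit_coord l)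
      = (if k = l then 2 * a k else 0)"
    if "k \<in> (J \<union> {i, j}) \<inter> E" "l \<in> (J \<union> {i, j}) \<inter> E" for k l
    using that assms(4,5) by (auto simp: diag_form_unit_coord coeff_unit_coord)
  then show ?thesis using assms(1) unfolding admits_def by blast
qed

text \<open>The conditions that make the two lines a package are those of \<open>inverse_A\<close>
  with all signs reversed.\<close>

lemma admits_glue:
  assumes P: "package m J b S s1 s2 A1 A2 r1 r2 o1 o2" and J: "J \<inter> E = {}"
    and ij: "i \<noteq> j" "i \<in> E" "j \<in> E" and m: "m i = [:- r1, 1:]" "m j = [:- r2, 1:]"
    and a: "a i = - A1" "a j = - A2"
  shows "admits a (J \<union> {i, j})"
proof -
  interpret P: package m J b S s1 s2 A1 A2 r1 r2 o1 o2 by (rule P)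
  have "1 / a i = - (1 / A1)" "(1 / a i + 1 / a j) / 4 = - ((1 / A1 + 1 / A2) / 4)"
    by (simp_all add: a diff_divide_distrib add_divide_distrib)
  moreover have "- (1 / A1) \<in> Z2" "- ((1 / A1 + 1 / A2) / 4) \<in> Z2" using P.inverse_A by blast+
  ultimately have a0: "a i \<noteq> 0" "a j \<noteq> 0" "1 / a i \<in> Z2" "(1 / a i + 1 / a j) / 4 \<in> Z2"
    using P.vals(4,5) by (simp_all only: a neg_equal_0_iff_equal not_False_eq_True)
  have P': "package m {i, j} (diag_form {i, j} a)
    {(1 / a i) \<odot> unit_coord i, (1 / (2 * a i)) \<odot> unit_coord i + (1 / (2 * a j)) \<odot> unit_coord j}
    (unit_coord i) (unit_coord j) (a i) (a j) r1 r2 0 0"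
    using ij(1) m P.sgn a0 by (rule package_unit_coords)
  have disj: "J \<inter> {i, j} = {}" using ij J by auto
  show ?thesis
    by (rule admits_diag[OF package_glue[OF P P' disj a] P.L(1,2) J ij])
qed

text \<open>Only \<open>s1\<close> has a line of its own eigenvalue. If t is even,
  \<open>good_absorb\<close> applies. Otherwise t is a unit, hence so are A1 and A2, and A1 + A2 is
  divisible by 4; the poles then close up by themselves and the two lines form a separate hyperbolic
  plane.\<close>

lemma admits_absorb:
  assumes P: "package m J b S s1 s2 A1 A2 r1 r2 o1 o2" and J: "J \<inter> E = {}"
    and ij: "i \<noteq> j" "i \<in> E" "j \<in> E" and m: "m i = [:- r1, 1:]"
    and u: "Z2_unit (t ^ 2 * A2)"
  shows "\<exists>p q. p \<noteq> 0 \<and> q \<noteq> 0 \<and> (\<forall>a. a i = p \<longrightarrow> a j = q \<longrightarrow> admits a (J \<union> {i, j}))"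
proof -
  interpret P: package m J b S s1 s2 A1 A2 r1 r2 o1 o2 by (rule P)
  obtain r where r: "m j = [:- r, 1:]" "r = 1 \<or> r = - 1" using linear ij by metis
  have disj: "J \<inter> {i, j} = {}" using ij J by auto
  have t0: "t \<noteq> 0" using u by (auto simp: Z2_unit_def)
  show ?thesis
  proof (cases "t / 2 \<in> Z2")
    case True
    have "admits a (J \<union> {i, j})" if a: "a i = - A1" "a j = - (t ^ 2 * A2)" for a
      by (rule admits_diag[OF P.good_absorb[OF ij(1) _ _ m r a u True] P.L(1,2) J ij]) (use disj in auto)
    then show ?thesis using P.vals t0 by (rule_tac exI[of _ "- A1"], rule_tac exI[of _ "- (t ^ 2 * A2)"]) auto
  next
    case False
    have i2: "1 / A2 = t ^ 2 * inverse (t ^ 2 * A2)" using t0 P.vals(5) by (simp add: field_simps)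
    have tA: "t ^ 2 * inverse (t ^ 2 * A2) \<in> Z2" using P.inverse_A(2) unfolding i2 .
    have iu: "Z2_unit (inverse (t ^ 2 * A2))" using u unfolding Z2_unit_inverse .
    have "t \<in> Z2" by (rule Z2_square_unit_mult[OF tA iu])
    then have tu: "Z2_unit t" using False Z2_unit_parity by blast
    have "Z2_unit (t ^ 2 * inverse (t ^ 2 * A2))"
      using Z2_unit_mult[OF Z2_unit_mult[OF tu tu] iu] by (simp only: power2_eq_square)
    then have u2: "Z2_unit (1 / A2)" unfolding i2 .
    have eq: "(1 / A1 + 1 / A2) / 2 = 2 * ((1 / A1 + 1 / A2) / 4)" by simp
    have s: "(1 / A1 + 1 / A2) / 2 \<in> Z2"
      unfolding eq by (rule Z2_mult[OF Z2_numeral P.inverse_A(3)])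
    have "1 / A1 / 2 \<notin> Z2"
    proof
      assume "1 / A1 / 2 \<in> Z2"
      with s have "(1 / A1 + 1 / A2) / 2 - 1 / A1 / 2 \<in> Z2" by (rule Z2_diff)
      then have "1 / A2 / 2 \<in> Z2" by (simp add: add_divide_distrib)
      then show False using Z2_unit_not_half[OF u2] by simp
    qed
    then have u1: "Z2_unit (1 / A1)" using P.inverse_A(1) Z2_unit_parity by blast
    have uA: "Z2_unit A1" "Z2_unit A2"
      using Z2_unit_inverse[of A1] Z2_unit_inverse[of A2] u1 u2 by (simp_all add: divide_inverse)
    have "A1 * A2 * ((1 / A1 + 1 / A2) / 4) \<in> Z2"
      using uA P.inverse_A(3) by (intro Z2_mult) (auto simp: Z2_unit_def)
    also have "A1 * A2 * ((1 / A1 + 1 / A2) / 4) = (A1 + A2) / 4"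
      using P.vals by (simp add: field_simps)
    finally have "\<exists>S. good J b S" using P.good_close[of 1 1] uA by auto
    then have g: "admits a J" for a using admits_good J by blast
    have "admits a (J \<union> {i, j})" if "a i = 1" "a j = - 1" for a
      using that ij disj by (intro admits_Un g admits_hyperbolic) auto
    then show ?thesis by (rule_tac exI[of _ 1], rule_tac exI[of _ "- 1"]) auto
  qed
qed

text \<open>The scales \<kappa> = 1 and \<kappa> = -1 make the packages of the two copies
  opposite.\<close>

lemma admits_double:
  assumes ij: "i \<noteq> j" "i \<notin> E" "j \<notin> E" and m: "m i = g" "m j = g" and g: "sym_poly g d"
  shows "admits a {i, j}"
proof -
  obtain b S s1 s2 o1 o2 where
    P: "package m {i} b S s1 s2 (1 / poly g 1) (1 * (- 1) ^ (d - 1) / poly g (- 1)) 1 (- 1) o1 o2"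
    by (rule package_sym_poly[of g d "{i}" 1]) (use g m in auto)
  obtain b' S' s1' s2' o1' o2' where
    P': "package m {j} b' S' s1' s2' (- 1 / poly g 1) (- 1 * (- 1) ^ (d - 1) / poly g (- 1)) 1 (- 1) o1' o2'"
    by (rule package_sym_poly[of g d "{j}" "- 1"]) (use g m in auto)
  have "\<exists>b S. good ({i} \<union> {j}) b S"
    using package_glue[OF P P'] ij by (auto simp del: mult_minus_left)
  then have "\<exists>b S. good {i, j} b S" by (simp add: insert_commute)
  then show ?thesis using ij admits_good[of "{i, j}"] by auto
qed

end

lemma sym_poly_mult:
  assumes "sym_poly p k" "sym_poly q l"
  shows "sym_poly (p * q) (k + l)"
proof -
  interpret p: sym_poly p k by (rule assms)
  interpret q: sym_poly q l by (rule assms)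
  have "p \<noteq> 0" "q \<noteq> 0" using p.F1 q.F1 by auto
  moreover have "lead_coeff (p * q) = 1" by (simp only: lead_coeff_mult p.monic q.monic mult_1)
  ultimately show ?thesis
    using p.zF q.zF p.deg q.deg p.n0 p.reflect q.reflect p.F1 q.F1 p.Fm1 q.Fm1
    by unfold_locales (simp_all only: zpoly_mult degree_mult_eq reflect_poly_mult poly_mult
        distrib_left add_pos_pos mult_eq_0_iff simp_thms not_False_eq_True)
qed

lemma sym_poly_prod:
  assumes "finite V" "V \<noteq> {}" "\<And>w. w \<in> V \<Longrightarrow> sym_poly (g w) (d w)"
  shows "sym_poly (\<Prod>w\<in>V. g w) (\<Sum>w\<in>V. d w)"
  using assms by (induction V rule: finite_ne_induct) (auto intro: sym_poly_mult)

section \<open>Assembling the whole module from its blocks\<close>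

text \<open>A flat index set for the three components of \<open>ambient\<close>, so that M becomes
  one coordinate module.\<close>

type_synonym 'w idx = "nat + nat + 'w \<times> nat"

abbreviation PI :: "nat \<Rightarrow> 'w idx" where "PI i \<equiv> Inl i"
abbreviation MI :: "nat \<Rightarrow> 'w idx" where "MI i \<equiv> Inr (Inl i)"
abbreviation WI :: "'w \<Rightarrow> nat \<Rightarrow> 'w idx" where "WI w i \<equiv> Inr (Inr (w, i))"

definition modulus :: "('w \<Rightarrow> two_adic poly) \<Rightarrow> 'w idx \<Rightarrow> two_adic poly" where
  "modulus g = case_sum (\<lambda>_. [:- 1, 1:]) (case_sum (\<lambda>_. [:1, 1:]) (\<lambda>(w, _). g w))"

lemma modulus_simps [simp]: "modulus g (PI i) = [:- 1, 1:]" "modulus g (MI i) = [:1, 1:]"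
  "modulus g (WI w i) = g w"
  by (simp_all add: modulus_def)

text \<open>The split and the self-dual factors are no longer distinguished: \<open>g w\<close> is
  the full modulus, which is symmetric in either case.\<close>

locale assembly =
  fixes W :: "'w set" and g :: "'w \<Rightarrow> two_adic poly" and d nw :: "'w \<Rightarrow> nat"
  assumes finite_W: "finite W" and sym: "w \<in> W \<Longrightarrow> sym_poly (g w) (d w)"
    and bez: "w \<in> W \<Longrightarrow> w' \<in> W \<Longrightarrow> w \<noteq> w' \<Longrightarrow> bezout (g w) (g w')"
begin

sublocale coords_linear "modulus g" "range PI \<union> range MI"
proof
  fix i :: "'w idx" assume "i \<in> range PI \<union> range MI"
  then show "\<exists>r. modulus g i = [:- r, 1:] \<and> (r = 1 \<or> r = - 1)"
    by (auto intro: exI[of _ 1] exI[of _ "- 1"])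
qed

definition Wodd :: "'w set" where "Wodd = {w \<in> W. odd (nw w)}"
definition fodd :: "two_adic poly" where "fodd = (\<Prod>w\<in>Wodd. g w)"
definition dodd :: nat where "dodd = (\<Sum>w\<in>Wodd. d w)"
definition Jodd :: "'w idx set" where "Jodd = (\<lambda>w. WI w 0) ` Wodd"
definition Jw :: "'w idx set" where "Jw = {WI w i | w i. w \<in> W \<and> i < nw w}"
definition J :: "nat \<Rightarrow> nat \<Rightarrow> 'w idx set" where "J np nm = PI ` {..<np} \<union> MI ` {..<nm} \<union> Jw"

lemma finite_Wodd: "finite Wodd" using finite_W by (simp add: Wodd_def)

lemma admits_Jw_rest: "admits a (Jw - Jodd)"
proof -
  \<comment> \<open>For odd multiplicity the copy 0 belongs to \<open>Jodd\<close>; the remaining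
    copies start at \<open>nw w mod 2\<close> and are even in number.\<close>
  define h where "h w k = WI w (nw w mod 2 + k)" for w k
  have eq: "Jw - Jodd = (\<Union>w\<in>W. h w ` {..<2 * (nw w div 2)})"
  proof -
    have "Jw - Jodd = (\<Union>w\<in>W. {WI w i | i. i < nw w \<and> (odd (nw w) \<longrightarrow> i \<noteq> 0)})"
      by (auto simp: Jw_def Jodd_def Wodd_def)
    also have "\<dots> = (\<Union>w\<in>W. h w ` {..<2 * (nw w div 2)})"
    proof (intro SUP_cong refl)
      fix w
      define r q where "r = nw w mod 2" and "q = nw w div 2"
      have nw: "nw w = r + 2 * q" "odd (nw w) \<longleftrightarrow> r = 1" "r \<le> 1"
        by (auto simp: r_def q_def odd_iff_mod_2_eq_one)
      have "i < nw w \<and> (odd (nw w) \<longrightarrow> i \<noteq> 0) \<longleftrightarrow> (\<exists>k<2 * q. i = r + k)" for i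
      proof
        assume "i < nw w \<and> (odd (nw w) \<longrightarrow> i \<noteq> 0)"
        then show "\<exists>k<2 * q. i = r + k" using nw by (intro exI[of _ "i - r"]) auto
      qed (use nw in auto)
      then show "{WI w i | i. i < nw w \<and> (odd (nw w) \<longrightarrow> i \<noteq> 0)} = h w ` {..<2 * (nw w div 2)}"
        unfolding h_def r_def q_def by (auto simp: image_iff)
    qed
    finally show ?thesis .
  qed
  show ?thesis unfolding eq
  proof (intro admits_UN admits_pairs finite_W)
    fix w k assume w: "w \<in> W"
    show "admits a {h w (2 * k), h w (2 * k + 1)}"
      unfolding h_def by (rule admits_double[of _ _ "g w" "d w"]) (use sym[OF w] in auto)
  qed (auto simp: h_def inj_on_def)
qed

lemma Jodd_E: "Jodd \<inter> (range PI \<union> range MI) = {}" by (auto simp: Jodd_def)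

lemma package_odd:
  assumes "Wodd \<noteq> {}" "Z2_unit \<kappa>"
  obtains b S s1 s2 o1 o2 where
    "package (modulus g) Jodd b S s1 s2 (\<kappa> / poly fodd 1) (\<kappa> * (- 1) ^ (dodd - 1) / poly fodd (- 1)) 1 (- 1) o1 o2"
proof (rule package_sym_poly[of fodd dodd Jodd \<kappa>])
  show "sym_poly fodd dodd" unfolding fodd_def dodd_def
    using finite_Wodd assms(1) sym by (intro sym_poly_prod) (auto simp: Wodd_def)
  have "inj_on (\<lambda>w. WI w 0) Wodd" by (auto simp: inj_on_def)
  then show "fodd = (\<Prod>i\<in>Jodd. modulus g i)" by (simp add: fodd_def Jodd_def prod.reindex)
  show "\<And>i j. i \<in> Jodd \<Longrightarrow> j \<in> Jodd \<Longrightarrow> i \<noteq> j \<Longrightarrow> bezout (modulus g i) (modulus g j)"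
    by (auto simp: Jodd_def Wodd_def intro!: bez)
qed (use finite_Wodd assms that in \<open>auto simp: Jodd_def\<close>)

lemma fodd_empty: "Wodd = {} \<Longrightarrow> fodd = 1" "Wodd = {} \<Longrightarrow> dodd = 0" "Wodd = {} \<Longrightarrow> Jodd = {}"
  by (simp_all add: fodd_def dodd_def Jodd_def)

lemma dodd_pos: "Wodd \<noteq> {} \<Longrightarrow> dodd > 0"
proof -
  assume "Wodd \<noteq> {}"
  then obtain w where w: "w \<in> Wodd" by blast
  then have "d w > 0" using sym by (auto simp: Wodd_def sym_poly_def)
  moreover have "d w \<le> dodd" unfolding dodd_def using w finite_Wodd by (intro member_le_sum) auto
  ultimately show ?thesis by simp
qed

text \<open>Here no lines are involved: the poles of \<open>fodd\<close> are removed by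
  \<open>good_close\<close>, and the hypotheses are the forms in which (a) and (b) enter.\<close>

lemma admits_odd:
  assumes u: "Z2_unit (t1 ^ 2 / poly fodd 1)" "Z2_unit (t2 ^ 2 / poly fodd (- 1))"
    and e: "(t1 ^ 2 / poly fodd 1 - (- 1) ^ dodd * t2 ^ 2 / poly fodd (- 1)) / 4 \<in> Z2"
  shows "admits a Jodd"
proof (cases "Wodd = {}")
  case True
  then show ?thesis by (simp add: fodd_empty admits_empty)
next
  case False
  \<comment> \<open>As \<open>dodd\<close> is positive, (-1)^(dodd-1) = -(-1)^dodd, which turns the
    sum in \<open>good_close\<close> into the difference in the hypothesis.\<close>
  obtain k where k: "dodd = Suc k" using dodd_pos[OF False] by (cases dodd) auto
  obtain b S s1 s2 o1 o2 where
    P: "package (modulus g) Jodd b S s1 s2 (1 / poly fodd 1) (1 * (- 1) ^ (dodd - 1) / poly fodd (- 1)) 1 (- 1) o1 o2"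
    using package_odd[OF False Z2_unit_1] by blast
  have a2: "t2 ^ 2 * (1 * (- 1) ^ (dodd - 1) / poly fodd (- 1)) = (- 1) ^ k * (t2 ^ 2 / poly fodd (- 1))"
    by (simp add: k)
  have u1': "Z2_unit (t1 ^ 2 * (1 / poly fodd 1))" using u(1) by simp
  have "Z2_unit ((- 1) ^ k * (t2 ^ 2 / poly fodd (- 1)))" using u(2) by (cases "even k") simp_all
  then have u2': "Z2_unit (t2 ^ 2 * (1 * (- 1) ^ (dodd - 1) / poly fodd (- 1)))" unfolding a2 .
  have e': "(t1 ^ 2 * (1 / poly fodd 1) + t2 ^ 2 * (1 * (- 1) ^ (dodd - 1) / poly fodd (- 1))) / 4 \<in> Z2"
    using e unfolding a2 by (simp add: k)
  have "\<exists>S. good Jodd b S" using package.good_close[OF P u1' u2' e'] by blast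
  then show ?thesis using admits_good Jodd_E by blast
qed

lemma Jw_split: "Jw = Jodd \<union> (Jw - Jodd)"
  by (auto simp: Jw_def Jodd_def Wodd_def intro: odd_pos)

text \<open>\<open>K\<close> uses up the odd part and the first c and c' lines. The other lines form
  hyperbolic planes in consecutive pairs with values 1 and -1, and the remaining copies of factors
  come in equal pairs.\<close>

lemma admits_J:
  assumes "admits a K" "\<And>i. 2 * i < np - c \<Longrightarrow> a (PI (c + 2 * i)) = 1 \<and> a (PI (c + 2 * i + 1)) = - 1"
    "\<And>i. 2 * i < nm - c' \<Longrightarrow> a (MI (c' + 2 * i)) = 1 \<and> a (MI (c' + 2 * i + 1)) = - 1"
    "even (np - c)" "even (nm - c')" "c \<le> np" "c' \<le> nm"
    "K = Jodd \<union> (PI ` {..<c} \<union> MI ` {..<c'})"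
  shows "admits a (J np nm)"
proof -
  have 1: "admits a ((\<lambda>k. PI (c + k)) ` {..<2 * ((np - c) div 2)})"
    using assms(2,4) by (intro admits_pairs admits_hyperbolic) (auto simp: inj_on_def add.assoc)
  have 2: "admits a ((\<lambda>k. MI (c' + k)) ` {..<2 * ((nm - c') div 2)})"
    using assms(3,5) by (intro admits_pairs admits_hyperbolic) (auto simp: inj_on_def add.assoc)
  have "admits a (((K \<union> (\<lambda>k. PI (c + k)) ` {..<2 * ((np - c) div 2)})
      \<union> (\<lambda>k. MI (c' + k)) ` {..<2 * ((nm - c') div 2)}) \<union> (Jw - Jodd))"
    by (intro admits_Un assms(1) 1 2 admits_Jw_rest) (auto simp: assms(8) Jodd_def Jw_def)
  also have "((K \<union> (\<lambda>k. PI (c + k)) ` {..<2 * ((np - c) div 2)})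
      \<union> (\<lambda>k. MI (c' + k)) ` {..<2 * ((nm - c') div 2)}) \<union> (Jw - Jodd) = J np nm"
  proof -
    have P: "PI ` {..<c} \<union> (\<lambda>k. PI (c + k)) ` {..<np - c} = PI ` {..<np}"
      using assms(6) by (auto simp: image_iff) (metis add_diff_inverse_nat diff_less_mono leI lessThan_iff)
    have M: "MI ` {..<c'} \<union> (\<lambda>k. MI (c' + k)) ` {..<nm - c'} = MI ` {..<nm}"
      using assms(7) by (auto simp: image_iff) (metis add_diff_inverse_nat diff_less_mono leI lessThan_iff)
    have e: "2 * ((np - c) div 2) = np - c" "2 * ((nm - c') div 2) = nm - c'" using assms(4,5) by simp_all
    have "Jodd \<subseteq> Jw" using Jw_split by blast
    then show ?thesis unfolding J_def P[symmetric] M[symmetric] assms(8) e by blast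
  qed
  finally show ?thesis .
qed


lemma lessThan_2: "{..<2::nat} = {0, 1}"
  by auto

lemma admits_none:
  assumes "Z2_unit (t1 ^ 2 / poly fodd 1)" "Z2_unit (t2 ^ 2 / poly fodd (- 1))"
    and "(t1 ^ 2 / poly fodd 1 - (- 1) ^ dodd * t2 ^ 2 / poly fodd (- 1)) / 4 \<in> Z2"
  shows "\<exists>a. admits a (J 0 0)"
  using admits_J[of _ Jodd 0 0 0 0] admits_odd[OF assms] by auto

text \<open>\<open>PI 0\<close> and \<open>MI 0\<close> are glued to the two poles of \<^term>\<open>fodd\<close>.\<close>

lemma admits_both_core:
  assumes "Z2_unit \<kappa>" and a: "a (PI 0) = - \<kappa> / poly fodd 1" "a (MI 0) = \<kappa> * (- 1) ^ dodd / poly fodd (- 1)"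
  shows "admits a (Jodd \<union> {PI 0, MI 0})"
proof (cases "Wodd = {}")
  case True
  \<comment> \<open>With all multiplicities even there are no poles; the two values are then
    -\<kappa> and \<kappa>.\<close>
  have "Z2_unit (a (PI 0))" "a (MI 0) = - a (PI 0)" using assms True by (simp_all add: fodd_empty)
  then have "admits a {PI 0, MI 0}" by (intro admits_hyperbolic) auto
  then show ?thesis using True by (simp add: fodd_empty)
next
  case False
  obtain k where k: "dodd = Suc k" using dodd_pos[OF False] by (cases dodd) auto
  obtain b S s1 s2 o1 o2 where
    P: "package (modulus g) Jodd b S s1 s2 (\<kappa> / poly fodd 1) (\<kappa> * (- 1) ^ (dodd - 1) / poly fodd (- 1)) 1 (- 1) o1 o2"
    using package_odd[OF False assms(1)] by blast
  show ?thesis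
    by (rule admits_glue[OF P Jodd_E]) (use a in \<open>auto simp: k\<close>)
qed

text \<open>The scale \<kappa> moves the values on both glued lines and is the free unit. The other
  lines pair up from index 1 on, so odd indices carry 1.\<close>

lemma admits_both_odd:
  assumes "odd np" "odd nm" "Z2_unit \<kappa>"
  shows "admits (case_sum (\<lambda>i. if i = 0 then - \<kappa> / poly fodd 1 else if odd i then 1 else - 1)
    (case_sum (\<lambda>i. if i = 0 then \<kappa> * (- 1) ^ dodd / poly fodd (- 1) else if odd i then 1 else - 1) (\<lambda>_. 0)))
    (J np nm)" (is "admits ?a _")
proof (rule admits_J[of ?a "Jodd \<union> {PI 0, MI 0}" np 1 nm 1])
  show "admits ?a (Jodd \<union> {PI 0, MI 0})" by (rule admits_both_core[OF assms(3)]) simp_all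
qed (use assms in \<open>auto simp: odd_pos Suc_le_eq\<close>)

text \<open>After gluing, an odd number of lines is left on each side. One from each forms a
  hyperbolic plane with values \<nu> and -\<nu>, and \<nu> is the free unit.\<close>

lemma admits_both_even:
  assumes "even np" "even nm" "np > 0" "nm > 0" "Z2_unit \<nu>"
  shows "admits (case_sum (\<lambda>i. if i = 0 then - 1 / poly fodd 1 else if i = 1 then \<nu> else if even i then 1 else - 1)
    (case_sum (\<lambda>i. if i = 0 then (- 1) ^ dodd / poly fodd (- 1) else if i = 1 then - \<nu> else if even i then 1 else - 1) (\<lambda>_. 0)))
    (J np nm)" (is "admits ?a _")
proof (rule admits_J[of ?a "(Jodd \<union> {PI 0, MI 0}) \<union> {PI 1, MI 1}" np 2 nm 2])
  have h: "admits ?a (Jodd \<union> {PI 0, MI 0})" by (rule admits_both_core[OF Z2_unit_1]) simp_all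
  show "admits ?a ((Jodd \<union> {PI 0, MI 0}) \<union> {PI 1, MI 1})"
    by (rule admits_Un[OF h admits_hyperbolic]) (use assms in \<open>auto simp: Jodd_def\<close>)
qed (use assms in \<open>auto simp: lessThan_2 elim!: evenE\<close>)

text \<open>The pole at -1 has no line of its eigenvalue and is absorbed together with a second line
  of M^+, present because \<open>np\<close> is even and positive. The hypothesis on t expresses (a)
  at -1.\<close>

lemma admits_plus:
  assumes "even np" "np > 0" "Z2_unit (t ^ 2 / poly fodd (- 1))"
  shows "\<exists>a. admits a (J np 0)"
proof (cases "Wodd = {}")
  case True
  define a :: "'w idx \<Rightarrow> two_adic" where "a = case_sum (\<lambda>i. if even i then 1 else - 1) (\<lambda>_. 0)"
  have "admits a (J np 0)"
    by (rule admits_J[of _ Jodd _ 0 _ 0]) (use True assms in \<open>auto simp: fodd_empty admits_empty a_def\<close>)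
  then show ?thesis by blast
next
  case False
  obtain b S s1 s2 o1 o2 where
    P: "package (modulus g) Jodd b S s1 s2 (1 / poly fodd 1) (1 * (- 1) ^ (dodd - 1) / poly fodd (- 1)) 1 (- 1) o1 o2"
    using package_odd[OF False Z2_unit_1] by blast
  have e: "t ^ 2 * (1 * (- 1) ^ (dodd - 1) / poly fodd (- 1)) = (- 1) ^ (dodd - 1) * (t ^ 2 / poly fodd (- 1))"
    by simp
  have "Z2_unit (t ^ 2 * (1 * (- 1) ^ (dodd - 1) / poly fodd (- 1)))"
    unfolding e using assms(3) by (cases "even (dodd - 1)") simp_all
  then obtain p q where pq: "\<And>a. a (PI 0) = p \<Longrightarrow> a (PI 1) = q \<Longrightarrow> admits a (Jodd \<union> {PI 0, PI 1})"
    using admits_absorb[OF P Jodd_E, of "PI 0" "PI 1" t] by auto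
  define a :: "'w idx \<Rightarrow> two_adic"
    where "a = case_sum (\<lambda>i. if i = 0 then p else if i = 1 then q else if even i then 1 else - 1) (\<lambda>_. 0)"
  have "admits a (J np 0)"
  proof (rule admits_J[of _ "Jodd \<union> {PI 0, PI 1}" _ 2 _ 0])
    show "admits a (Jodd \<union> {PI 0, PI 1})" by (rule pq) (simp_all add: a_def)
  qed (use assms in \<open>auto simp: a_def lessThan_2 elim!: evenE\<close>)
  then show ?thesis by blast
qed

lemma admits_minus:
  assumes "even nm" "nm > 0" "Z2_unit (t ^ 2 / poly fodd 1)"
  shows "\<exists>a. admits a (J 0 nm)"
proof (cases "Wodd = {}")
  case True
  define a :: "'w idx \<Rightarrow> two_adic"
    where "a = case_sum (\<lambda>_. 0) (case_sum (\<lambda>i. if even i then 1 else - 1) (\<lambda>_. 0))"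
  have "admits a (J 0 nm)"
    by (rule admits_J[of _ Jodd _ 0 _ 0]) (use True assms in \<open>auto simp: fodd_empty admits_empty a_def\<close>)
  then show ?thesis by blast
next
  case False
  obtain b S s1 s2 o1 o2 where
    P: "package (modulus g) Jodd b S s1 s2 (1 / poly fodd 1) (1 * (- 1) ^ (dodd - 1) / poly fodd (- 1)) 1 (- 1) o1 o2"
    using package_odd[OF False Z2_unit_1] by blast
  have "Z2_unit (t ^ 2 * (1 / poly fodd 1))" using assms(3) by simp
  then obtain p q where pq: "\<And>a. a (MI 0) = p \<Longrightarrow> a (MI 1) = q \<Longrightarrow> admits a (Jodd \<union> {MI 0, MI 1})"
    using admits_absorb[OF package.swap[OF P] Jodd_E, of "MI 0" "MI 1" t] by auto
  define a :: "'w idx \<Rightarrow> two_adic"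
    where "a = case_sum (\<lambda>_. 0) (case_sum (\<lambda>i. if i = 0 then p else if i = 1 then q else if even i then 1 else - 1) (\<lambda>_. 0))"
  have "admits a (J 0 nm)"
  proof (rule admits_J[of _ "Jodd \<union> {MI 0, MI 1}" _ 0 _ 2])
    show "admits a (Jodd \<union> {MI 0, MI 1})" by (rule pq) (simp_all add: a_def)
  qed (use assms in \<open>auto simp: a_def lessThan_2 elim!: evenE\<close>)
  then show ?thesis by blast
qed

end

section \<open>Bases and nondegeneracy\<close>

lemma Z_basis_exists:
  assumes "finite S"
  obtains B where "finite B" "\<not> QF.dependent B" "ZF.span B = ZF.span S"
proof -
  have "\<exists>B. finite B \<and> \<not> QF.dependent B \<and> ZF.span B = ZF.span S"
    using assms
  proof (induction "card S" arbitrary: S rule: less_induct)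
    case less
    show ?case
    proof (cases "QF.dependent S")
      case True
      then obtain u v where u: "v \<in> S" "u v \<noteq> 0" "(\<Sum>v\<in>S. u v \<odot> v) = 0"
        unfolding QF.dependent_finite[OF less.prems] by blast
      obtain c where c: "c \<in> u ` S" "c \<noteq> 0" "\<And>y. y \<in> u ` S \<Longrightarrow> y / c \<in> Z2"
        by (rule Z2_finite_generator[of "u ` S" "u v"]) (use less.prems u in auto)
      then obtain w where w: "w \<in> S" "u w = c" by auto
      have "u w \<odot> w + (\<Sum>v\<in>S - {w}. u v \<odot> v) = 0"
        using u(3) sum.remove[OF less.prems w(1), of "\<lambda>v. u v \<odot> v"] by simp
      then have "(1 / c) \<odot> (u w \<odot> w + (\<Sum>v\<in>S - {w}. u v \<odot> v)) = 0" by simp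
      then have "w + (\<Sum>v\<in>S - {w}. (u v / c) \<odot> v) = 0"
        using w c(2) by (simp add: QF.scale_right_distrib QF.scale_sum_right)
      then have we: "w = - (\<Sum>v\<in>S - {w}. (u v / c) \<odot> v)" by (simp add: eq_neg_iff_add_eq_0)
      have "(\<Sum>v\<in>S - {w}. (u v / c) \<odot> v) \<in> ZF.span (S - {w})"
        by (intro ZF.span_sum ZF_span_scale ZF.span_base c(3)) auto
      then have wspan: "w \<in> ZF.span (S - {w})" by (subst we) (rule ZF.span_neg)
      have "ZF.span (S - {w}) = ZF.span S"
      proof (rule ZF.span_eq[THEN iffD2, OF conjI])
        show "S - {w} \<subseteq> ZF.span S" by (auto intro: ZF.span_base)
        show "S \<subseteq> ZF.span (S - {w})"
        proof
          fix x assume "x \<in> S"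
          then show "x \<in> ZF.span (S - {w})" using wspan by (cases "x = w") (auto intro: ZF.span_base)
        qed
      qed
      moreover have "card (S - {w}) < card S" by (rule card_Diff1_less[OF less.prems w(1)])
      ultimately show ?thesis using less.hyps[of "S - {w}"] less.prems by auto
    qed (use less.prems in blast)
  qed
  then show ?thesis using that by blast
qed

lemma ZF_independent: "\<not> QF.dependent B \<Longrightarrow> \<not> ZF.dependent B"
proof
  assume "ZF.dependent B"
  then obtain t u where "finite t" "t \<subseteq> B" "(\<Sum>v\<in>t. to_fract (u v) \<odot> v) = 0" "\<exists>v\<in>t. u v \<noteq> 0"
    unfolding ZF.dependent_explicit by blast
  then have "\<exists>t u. finite t \<and> t \<subseteq> B \<and> (\<Sum>v\<in>t. u v \<odot> v) = 0 \<and> (\<exists>v\<in>t. u v \<noteq> 0)"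
    by (intro exI[of _ t] exI[of _ "\<lambda>v. to_fract (u v)"]) auto
  then have "QF.dependent B" unfolding QF.dependent_explicit .
  moreover assume "\<not> QF.dependent B"
  ultimately show False by simp
qed

text \<open>If r is a nonzero coordinate of x in a basis, the multiple of x by 1/(2 r) would have
  the coordinate 1/2.\<close>

lemma Z_lattice_no_line:
  assumes "finite S" "\<And>c. c \<odot> x \<in> ZF.span S"
  shows "x = 0"
proof -
  obtain B where B: "finite B" "\<not> QF.dependent B" "ZF.span B = ZF.span S"
    using Z_basis_exists[OF assms(1)] .
  have rep: "\<exists>r. (\<forall>v. r v \<in> Z2) \<and> c \<odot> x = (\<Sum>v\<in>B. r v \<odot> v)" for c
  proof -
    have "c \<odot> x \<in> range (\<lambda>u. \<Sum>v\<in>B. to_fract (u v) \<odot> v)"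
      using assms(2)[of c] unfolding B(3)[symmetric] ZF.span_finite[OF B(1)] .
    then obtain r where "c \<odot> x = (\<Sum>v\<in>B. to_fract (r v) \<odot> v)" by (rule rangeE)
    then show ?thesis
      by (intro exI[of _ "\<lambda>v. to_fract (r v)"] conjI allI to_fract_in_Z2)
  qed
  obtain r where r: "1 \<odot> x = (\<Sum>v\<in>B. r v \<odot> v)" using rep by blast
  have "r v = 0" if v: "v \<in> B" for v
  proof (rule ccontr)
    assume rv: "r v \<noteq> 0"
    obtain r' where r': "\<forall>v. r' v \<in> Z2" "(1 / (2 * r v)) \<odot> x = (\<Sum>v\<in>B. r' v \<odot> v)" using rep by blast
    have "(\<Sum>w\<in>B. (r' w - r w / (2 * r v)) \<odot> w) = (\<Sum>w\<in>B. r' w \<odot> w) - (1 / (2 * r v)) \<odot> (\<Sum>w\<in>B. r w \<odot> w)"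
      unfolding QF.scale_left_diff_distrib sum_subtractf QF.scale_sum_right QF.scale_scale by simp
    also have "\<dots> = 0" unfolding r[symmetric] r'(2)[symmetric] by simp
    finally have z: "(\<Sum>w\<in>B. (r' w - r w / (2 * r v)) \<odot> w) = 0" .
    have "r' v - r v / (2 * r v) = 0"
    proof (rule ccontr)
      assume "r' v - r v / (2 * r v) \<noteq> 0"
      then have "\<exists>u. (\<exists>v\<in>B. u v \<noteq> 0) \<and> (\<Sum>v\<in>B. u v \<odot> v) = 0"
        by (intro exI[of _ "\<lambda>w. r' w - r w / (2 * r v)"] conjI bexI[OF _ v] z)
      then show False using B(2) unfolding QF.dependent_finite[OF B(1)] by (rule notE[rotated])
    qed
    then have "r' v = 1 / 2" using rv by simp
    then show False using r'(1) Z2_half_notin by metis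
  qed
  then have "(\<Sum>v\<in>B. r v \<odot> v) = 0" by simp
  then show ?thesis using r by simp
qed

context coords
begin

text \<open>The radical is a subspace over the field and lies in the dual, hence in the lattice,
  which contains no line.\<close>

lemma good_nondegenerate:
  assumes "good J b S" "x \<in> coord J" "\<And>y. y \<in> coord J \<Longrightarrow> b x y = 0"
  shows "x = 0"
proof -
  have lat: "lat J b S" using assms(1) by (simp add: good_def)
  note l = latD[OF lat]
  have "b s (c \<odot> x) = 0" if "s \<in> S" for s c
    using assms(3)[of s] l(4) that bilin_sym[OF l(1), of s x] by (auto simp: bilinD[OF l(1)])
  then have "c \<odot> x \<in> ZF.span S" for c
    using assms(1,2) coord_closed(2)[OF assms(2), of c] unfolding good_def by auto
  then show ?thesis using Z_lattice_no_line[OF l(3)] by blast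
qed

lemma act_bij:
  assumes "\<And>i. i \<in> J \<Longrightarrow> \<exists>v. m i dvd Xp * v - 1"
  shows "bij_betw act (coord J) (coord J)"
proof -
  obtain v where v: "\<And>i. i \<in> J \<Longrightarrow> m i dvd Xp * v i - 1" using assms by metis
  define ai where "ai y = (\<lambda>i. if i \<in> J then (v i * y i) mod m i else 0)" for y
  have cancel: "(Xp * (v i * y)) mod m i = y mod m i" if "i \<in> J" for i y
  proof -
    have "Xp * (v i * y) - y = (Xp * v i - 1) * y" by (simp add: left_diff_distrib mult.assoc)
    then show ?thesis using v[OF that] by (simp add: mod_eq_dvd_iff)
  qed
  show ?thesis
  proof (rule bij_betw_byWitness[of _ ai])
    show "\<forall>x\<in>coord J. ai (act x) = x"
    proof
      fix x assume x: "x \<in> coord J"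
      have "(v i * ((Xp * x i) mod m i)) mod m i = x i" if "i \<in> J" for i
        using cancel[OF that, of "x i"] x that by (simp add: mod_mult_right_eq coord_def mult.left_commute)
      then show "ai (act x) = x" using x by (auto simp: ai_def act_def coord_def fun_eq_iff)
    qed
    show "\<forall>y\<in>coord J. act (ai y) = y"
    proof
      fix y assume y: "y \<in> coord J"
      have "(Xp * ((v i * y i) mod m i)) mod m i = y i" if "i \<in> J" for i
        using cancel[OF that, of "y i"] y that by (simp add: mod_mult_right_eq coord_def)
      then show "act (ai y) = y" using y by (auto simp: ai_def act_def coord_def fun_eq_iff)
    qed
    show "act ` coord J \<subseteq> coord J" using act_coord by blast
    show "ai ` coord J \<subseteq> coord J" by (auto simp: ai_def coord_def)
  qed
qed

text \<open>Unimodularity gives the reverse inclusion: the preimage x of a lattice vector y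
  satisfies b s x = b (act s) y, so x is in the dual and therefore in the lattice.\<close>

lemma good_act_image:
  assumes "good J b S" "bij_betw act (coord J) (coord J)"
  shows "act ` ZF.span S = ZF.span S"
proof
  have lat: "lat J b S" using assms(1) by (simp add: good_def)
  note l = latD[OF lat]
  show "act ` ZF.span S \<subseteq> ZF.span S" using l(9) by blast
  show "ZF.span S \<subseteq> act ` ZF.span S"
  proof
    fix y assume y: "y \<in> ZF.span S"
    then have "y \<in> coord J" using ZF_span_coord[OF l(4)] by blast
    then obtain x where x: "x \<in> coord J" "act x = y"
      using assms(2) unfolding bij_betw_def by (metis imageE)
    have "b s x \<in> Z2" if "s \<in> S" for s
    proof -
      have "b (act s) (act x) = b s x" using l(4) that x(1) by (intro l(5)) auto
      moreover have "b (act s) y \<in> Z2" using that y by (intro l(7) l(9)) (auto intro: ZF.span_base)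
      ultimately show ?thesis using x by simp
    qed
    then have "x \<in> ZF.span S" using assms(1) x(1) unfolding good_def by blast
    then show "y \<in> act ` ZF.span S" using x(2) by blast
  qed
qed

end

section \<open>Transport to the ambient space\<close>

definition to_ambient :: "('w idx \<Rightarrow> two_adic poly) \<Rightarrow> 'w ambient" where
  "to_ambient x = (\<lambda>i. x (PI i), \<lambda>i. x (MI i), \<lambda>w i. x (WI w i))"

definition of_ambient :: "'w ambient \<Rightarrow> 'w idx \<Rightarrow> two_adic poly" where
  "of_ambient = (\<lambda>(x, y, z). case_sum x (case_sum y (\<lambda>(w, i). z w i)))"

lemma of_to_ambient [simp]: "of_ambient (to_ambient x) = x"
  by (auto simp: of_ambient_def to_ambient_def fun_eq_iff split: sum.splits)

lemma to_of_ambient [simp]: "to_ambient (of_ambient v) = v"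
  by (cases v) (simp add: of_ambient_def to_ambient_def)

lemma to_ambient_add: "to_ambient (x + y) = to_ambient x + to_ambient y"
  by (simp add: to_ambient_def fun_eq_iff)

lemma to_ambient_scale: "to_ambient (c \<odot> x) = scaleQ c (to_ambient x)"
  by (simp add: to_ambient_def scaleQ_def scaleF_def)

lemma of_ambient_add: "of_ambient (u + v) = of_ambient u + of_ambient v"
  by (metis of_to_ambient to_ambient_add to_of_ambient)

lemma of_ambient_scale: "of_ambient (scaleQ c u) = c \<odot> of_ambient u"
  by (metis of_to_ambient to_ambient_scale to_of_ambient)

lemma inj_to_ambient: "inj to_ambient"
  by (metis injI of_to_ambient)

interpretation to_Q: module_hom scaleF scaleQ to_ambient
  by unfold_locales (simp_all add: to_ambient_add to_ambient_scale)

interpretation to_Z: module_hom "\<lambda>c. scaleF (to_fract c)" scaleZ to_ambient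
  by unfold_locales (simp_all add: to_ambient_add to_ambient_scale scaleZ_def)

lemma to_ambient_0: "to_ambient 0 = 0"
  by (simp add: to_ambient_def zero_prod_def fun_eq_iff)

lemma to_ambient_image_iff: "v \<in> to_ambient ` C \<longleftrightarrow> of_ambient v \<in> C"
  by (auto intro: image_eqI[of _ _ "of_ambient v"])

lemma idx_all: "(\<forall>i :: 'w idx. P i) \<longleftrightarrow> (\<forall>i. P (PI i)) \<and> (\<forall>i. P (MI i)) \<and> (\<forall>w i. P (WI w i))"
proof (intro iffI allI; (elim conjE)?)
  fix i :: "'w idx" assume a: "\<forall>i. P (PI i)" "\<forall>i. P (MI i)" "\<forall>w i. P (WI w i)"
  consider k where "i = PI k" | k where "i = MI k" | w k where "i = WI w k"
    by (metis surj_pair sum.exhaust)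
  then show "P i" using a by cases simp_all
qed simp

lemma quotient_ring_iff: "p \<in> quotient_ring g \<longleftrightarrow> p mod g = p"
proof
  assume "p \<in> quotient_ring g"
  then obtain q where "p = q mod g" unfolding quotient_ring_def by (rule rangeE)
  then show "p mod g = p" by simp
next
  assume "p mod g = p"
  then have "p = p mod g" by simp
  then show "p \<in> quotient_ring g" unfolding quotient_ring_def by (rule range_eqI)
qed

context assembly
begin

lemma J_simps [simp]: "PI i \<in> J np nm \<longleftrightarrow> i < np" "MI i \<in> J np nm \<longleftrightarrow> i < nm"
  "WI w i \<in> J np nm \<longleftrightarrow> w \<in> W \<and> i < nw w"
  by (auto simp: J_def Jw_def)

lemma coord_iff: "x \<in> coord K \<longleftrightarrow> (\<forall>i. if i \<in> K then x i mod modulus g i = x i else x i = 0)"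
  by (auto simp: coord_def)

lemma M_module_eq:
  assumes "\<And>w. g w = E_modulus (fw w)"
  shows "M_module np nm W fw nw = to_ambient ` coord (J np nm)"
proof (rule Set.set_eqI)
  fix v :: "'w ambient"
  obtain x y z where v: "v = (x, y, z)" by (cases v)
  have p: "p \<in> power_module h k \<longleftrightarrow> (\<forall>i. if i < k then p i mod h = p i else p i = 0)" for p h k
    unfolding power_module_def quotient_ring_iff by (auto simp: not_less)
  have z: "(\<forall>w\<in>W. z w \<in> power_module (E_modulus (fw w)) (nw w)) \<and> (\<forall>w. w \<notin> W \<longrightarrow> z w = 0)
      \<longleftrightarrow> (\<forall>w i. if w \<in> W \<and> i < nw w then z w i mod g w = z w i else z w i = 0)"
  proof -
    have aux: "(\<forall>w\<in>W. \<forall>i. if i < nw w then A w i else B w i) \<and> (\<forall>w. w \<notin> W \<longrightarrow> (\<forall>i. B w i))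
        \<longleftrightarrow> (\<forall>w i. if w \<in> W \<and> i < nw w then A w i else B w i)" for A B :: "'w \<Rightarrow> nat \<Rightarrow> bool"
      by (auto split: if_splits)
    show ?thesis unfolding p assms[symmetric] fun_eq_iff zero_fun_apply by (rule aux)
  qed
  have "v \<in> M_module np nm W fw nw \<longleftrightarrow> of_ambient v \<in> coord (J np nm)"
    unfolding v M_module_def coord_iff idx_all of_ambient_def
    by (simp only: mem_Collect_eq prod.case z) (simp only: p J_simps modulus_simps sum.case prod.case)
  then show "v \<in> M_module np nm W fw nw \<longleftrightarrow> v \<in> to_ambient ` coord (J np nm)"
    by (simp only: to_ambient_image_iff)
qed

lemma alpha_to_ambient:
  assumes "\<And>w. g w = E_modulus (fw w)"
  shows "alpha fw (to_ambient x) = to_ambient (act x)"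
  using assms by (simp add: alpha_def to_ambient_def act_def)

lemma good_has_stable:
  assumes good: "good (J np nm) b S" and g: "\<And>w. g w = E_modulus (fw w)"
  shows "has_stable_even_unimodular (M_module np nm W fw nw) (alpha fw)
    (\<lambda>u v. b (of_ambient u) (of_ambient v))" (is "has_stable_even_unimodular ?M _ ?b")
proof -
  have lat: "lat (J np nm) b S" using good by (simp add: good_def)
  note l = latD[OF lat]
  note B = bilinD[OF l(1)]
  let ?C = "coord (J np nm)"
  have M: "?M = to_ambient ` ?C" by (rule M_module_eq[OF g])
  have MC: "u \<in> ?M \<longleftrightarrow> of_ambient u \<in> ?C" for u
    unfolding M by (rule to_ambient_image_iff)
  have alpha: "of_ambient (alpha fw u) = act (of_ambient u)" for u
    using alpha_to_ambient[OF g, of "of_ambient u"] by simp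
  have bij: "bij_betw act ?C ?C"
  proof (rule act_bij)
    fix i assume i: "i \<in> J np nm"
    consider k where "i = PI k" | k where "i = MI k" | w k where "i = WI w k" "w \<in> W"
      using i by (auto simp: J_def Jw_def)
    then show "\<exists>v. modulus g i dvd Xp * v - 1"
    proof cases
      case 1
      have "Xp * 1 - 1 = ([:- 1, 1:] :: two_adic poly)" by (simp only: mult_1_right) (simp add: one_pCons)
      then show ?thesis unfolding 1 modulus_simps by (metis dvd_refl)
    next
      case 2
      have "Xp * (- 1) - 1 = - ([:1, 1:] :: two_adic poly)"
        by (simp only: mult_minus_right mult_1_right) (simp add: one_pCons)
      then show ?thesis unfolding 2 modulus_simps by (metis dvd_minus_iff dvd_refl)
    next
      case 3
      interpret s: sym_poly "g w" "d w" using sym 3 by blast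
      have "g w dvd Xp * s.Xi - 1" using s.X_Xi unfolding s.eqv_iff_dvd .
      then show ?thesis unfolding 3 modulus_simps by blast
    qed
  qed
  show ?thesis unfolding has_stable_even_unimodular_def
  proof (intro conjI exI[of _ "to_ambient ` ZF.span S"])
    show "inner_product_on ?M ?b"
      unfolding inner_product_on_def
    proof (intro conjI ballI allI impI)
      fix x assume x: "x \<in> ?M" and 0: "\<forall>y\<in>?M. ?b x y = 0"
      have "b (of_ambient x) y = 0" if "y \<in> ?C" for y
        using 0 that by (auto simp: M)
      then have "of_ambient x = 0" using good_nondegenerate[OF good] x MC by blast
      then show "x = 0" using to_of_ambient[of x] by (simp only: to_ambient_0)
    qed (auto simp: of_ambient_add of_ambient_scale B bilin_sym[OF l(1)])
    show "isometry_on ?M ?b (alpha fw)"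
      unfolding isometry_on_def
    proof (intro conjI ballI)
      have b1: "bij_betw of_ambient ?M ?C" unfolding M by (rule bij_betw_byWitness[of _ to_ambient]) auto
      have b2: "bij_betw to_ambient ?C ?M" unfolding M by (rule bij_betw_byWitness[of _ of_ambient]) auto
      have "bij_betw (to_ambient \<circ> (act \<circ> of_ambient)) ?M ?M"
        by (rule bij_betw_trans[OF bij_betw_trans[OF b1 bij] b2])
      moreover have "to_ambient \<circ> (act \<circ> of_ambient) = alpha fw"
        by (rule ext) (metis alpha comp_apply to_of_ambient)
      ultimately show "bij_betw (alpha fw) ?M ?M" by simp
    qed (simp add: alpha MC l(5))
    show "lattice_in ?M (to_ambient ` ZF.span S)"
      unfolding lattice_in_def
    proof (intro conjI)
      have im: "to_ambient ` ZF.span S = ZM.span (to_ambient ` S)" by (rule to_Z.span_image[symmetric])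
      show "ZM.subspace (to_ambient ` ZF.span S)" unfolding im by (rule ZM.subspace_span)
      obtain B where B: "finite B" "\<not> QF.dependent B" "ZF.span B = ZF.span S"
        using Z_basis_exists[OF l(3)] .
      have "\<not> ZM.dependent (to_ambient ` B)"
        using to_Z.independent_inj_image[OF ZF_independent[OF B(2)] inj_to_ambient] .
      moreover have "ZM.span (to_ambient ` B) = to_ambient ` ZF.span S"
        unfolding B(3)[symmetric] by (rule to_Z.span_image)
      ultimately show "\<exists>B. ZM.independent B \<and> ZM.span B = to_ambient ` ZF.span S" by blast
      have "QF.span (ZF.span S) = ?C"
      proof
        show "QF.span (ZF.span S) \<subseteq> ?C" by (intro QF_span_coord ZF_span_coord l(4))
        have "QF.span S \<subseteq> QF.span (ZF.span S)" by (intro QF.span_mono) (auto intro: ZF.span_base)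
        then show "?C \<subseteq> QF.span (ZF.span S)" using good unfolding good_def by blast
      qed
      then show "QM.span (to_ambient ` ZF.span S) = ?M" unfolding M to_Q.span_image by simp
    qed
    have "alpha fw ` to_ambient ` ZF.span S = to_ambient ` act ` ZF.span S"
      by (simp add: image_image alpha_to_ambient[OF g])
    then show "alpha fw ` to_ambient ` ZF.span S = to_ambient ` ZF.span S"
      using good_act_image[OF good bij] by simp
    show "even_lattice ?b (to_ambient ` ZF.span S)"
      unfolding even_lattice_def
    proof
      fix u assume "u \<in> to_ambient ` ZF.span S"
      then obtain x where x: "u = to_ambient x" "x \<in> ZF.span S" by blast
      show "?b u u \<in> (\<lambda>a. 2 * a) ` two_adic_ints"
        by (rule image_eqI[of _ _ "b x x / 2"]) (use l(8)[OF x(2)] x(1) in simp_all)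
    qed
    show "unimodular ?M ?b (to_ambient ` ZF.span S)"
      unfolding unimodular_def dual_lattice_def
    proof (intro Set.set_eqI iffI)
      fix u assume "u \<in> to_ambient ` ZF.span S"
      then obtain x where x: "u = to_ambient x" "x \<in> ZF.span S" by blast
      then show "u \<in> {y \<in> ?M. \<forall>x\<in>to_ambient ` ZF.span S. ?b x y \<in> two_adic_ints}"
        using ZF_span_coord[OF l(4)] l(7) by (auto simp: M)
    next
      fix u assume u: "u \<in> {y \<in> ?M. \<forall>x\<in>to_ambient ` ZF.span S. ?b x y \<in> two_adic_ints}"
      then have "of_ambient u \<in> ?C" "\<forall>x\<in>S. b x (of_ambient u) \<in> Z2"
        using MC by (auto intro: ZF.span_base)
      then have "of_ambient u \<in> ZF.span S" using good unfolding good_def by blast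
      then show "u \<in> to_ambient ` ZF.span S" by (metis imageI to_of_ambient)
    qed
  qed
qed

end

section \<open>Determinants\<close>

lemma square_class_mult_square:
  assumes "t \<noteq> 0"
  shows "square_class (a * t ^ 2) = square_class a"
proof
  show "square_class (a * t ^ 2) \<subseteq> square_class a"
  proof
    fix x assume "x \<in> square_class (a * t ^ 2)"
    then obtain s where "s \<noteq> 0" "x = a * t ^ 2 * s ^ 2" unfolding square_class_def by blast
    then have "t * s \<noteq> 0" "x = a * (t * s) ^ 2" using assms by (simp_all add: power_mult_distrib)
    then show "x \<in> square_class a" unfolding square_class_def by blast
  qed
  show "square_class a \<subseteq> square_class (a * t ^ 2)"
  proof
    fix x assume "x \<in> square_class a"
    then obtain s where "s \<noteq> 0" "x = a * s ^ 2" unfolding square_class_def by blast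
    then have "s / t \<noteq> 0" "x = a * t ^ 2 * (s / t) ^ 2" using assms by (simp_all add: power_divide)
    then show "x \<in> square_class (a * t ^ 2)" unfolding square_class_def by blast
  qed
qed

definition bilinQ :: "('w ambient \<Rightarrow> 'w ambient \<Rightarrow> two_adic) \<Rightarrow> bool" where
  "bilinQ b \<longleftrightarrow> (\<forall>x y z. b (x + y) z = b x z + b y z) \<and> (\<forall>c x y. b (scaleQ c x) y = c * b x y) \<and>
     (\<forall>x y. b x y = b y x)"

lemma bilinQ_sum:
  assumes "bilinQ b"
  shows "b (\<Sum>i\<in>I. scaleQ (c i) (v i)) y = (\<Sum>i\<in>I. c i * b (v i) y)"
    "b y (\<Sum>i\<in>I. scaleQ (c i) (v i)) = (\<Sum>i\<in>I. c i * b y (v i))"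
proof -
  have l: "b (x + y) z = b x z + b y z" "b (scaleQ c x) y = c * b x y" "b x y = b y x" for x y z c
    using assms unfolding bilinQ_def by blast+
  have z: "b 0 y = 0" for y using l(2)[of 0 0 y] by simp
  show 1: "b (\<Sum>i\<in>I. scaleQ (c i) (v i)) y = (\<Sum>i\<in>I. c i * b (v i) y)" for y
    by (induction I rule: infinite_finite_induct) (simp_all add: l(1,2) z)
  show "b y (\<Sum>i\<in>I. scaleQ (c i) (v i)) = (\<Sum>i\<in>I. c i * b y (v i))"
    unfolding l(3)[of y] by (rule 1)
qed

lemma det_gram_change:
  assumes b: "bilinQ b" and vs: "ordered_basis V vs" and ws: "ordered_basis V ws"
  obtains t where "det (gram_matrix b ws) = det (gram_matrix b vs) * t ^ 2"
proof -
  define n where "n = length vs"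
  have len: "length ws = n"
  proof -
    have "card (set ws) = card (set vs)"
      using vs ws QM.dim_span_eq_card_independent unfolding ordered_basis_def by metis
    then show ?thesis using vs ws unfolding ordered_basis_def n_def by (simp add: distinct_card)
  qed
  have "\<exists>c. ws ! i = (\<Sum>j<n. scaleQ (c j) (vs ! j))" if "i < n" for i
  proof -
    have "ws ! i \<in> QM.span (set vs)"
      using vs ws that len unfolding ordered_basis_def by (metis QM.span_base nth_mem)
    then obtain u where "ws ! i = (\<Sum>v\<in>set vs. scaleQ (u v) v)"
      unfolding QM.span_finite[OF finite_set] by blast
    also have "\<dots> = (\<Sum>j<n. scaleQ (u (vs ! j)) (vs ! j))"
      using vs unfolding ordered_basis_def n_def
      by (intro sum.reindex_bij_betw[symmetric] bij_betw_nth) auto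
    finally show ?thesis by (intro exI[of _ "\<lambda>j. u (vs ! j)"])
  qed
  then have "\<forall>i. \<exists>c. i < n \<longrightarrow> ws ! i = (\<Sum>j<n. scaleQ (c j) (vs ! j))" by blast
  then have "\<exists>c. \<forall>i. i < n \<longrightarrow> ws ! i = (\<Sum>j<n. scaleQ (c i j) (vs ! j))" by (rule choice)
  then obtain c where c: "\<And>i. i < n \<Longrightarrow> ws ! i = (\<Sum>j<n. scaleQ (c i j) (vs ! j))" by blast
  define T where "T = mat n n (\<lambda>(i, j). c i j)"
  define G where "G = gram_matrix b vs"
  have T: "T \<in> carrier_mat n n" and G: "G \<in> carrier_mat n n"
    by (simp_all add: T_def G_def gram_matrix_def n_def)
  have "gram_matrix b ws = T * G * transpose_mat T"
  proof (rule eq_matI)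
    fix i j assume ij: "i < dim_row (T * G * transpose_mat T)" "j < dim_col (T * G * transpose_mat T)"
    then have ij: "i < n" "j < n" using T by auto
    have "gram_matrix b ws $$ (i, j) = b (ws ! i) (ws ! j)" using ij by (simp add: gram_matrix_def len)
    also have "\<dots> = (\<Sum>l<n. c j l * (\<Sum>k<n. c i k * b (vs ! k) (vs ! l)))"
      by (simp only: c ij bilinQ_sum[OF b])
    also have "\<dots> = (T * G * transpose_mat T) $$ (i, j)"
      using ij T G
      by (simp add: times_mat_def scalar_prod_def T_def G_def gram_matrix_def n_def[symmetric]
          atLeast0LessThan mult.commute)
    finally show "gram_matrix b ws $$ (i, j) = (T * G * transpose_mat T) $$ (i, j)" .
  qed (use T len in \<open>auto simp: gram_matrix_def\<close>)
  then have "det (gram_matrix b ws) = det (T * G) * det (transpose_mat T)"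
    using T G by (simp add: det_mult[of _ n])
  also have "\<dots> = det G * det T ^ 2"
    using T G by (simp add: det_mult[of _ n] det_transpose power2_eq_square)
  finally show ?thesis using that unfolding G_def by blast
qed

text \<open>\<open>form_det\<close> is a union over all bases; it reduces to one coset because two
  Gram determinants differ by a nonzero square.\<close>

lemma form_det_eq:
  assumes "bilinQ b" "ordered_basis V vs" "det (gram_matrix b vs) \<noteq> 0"
  shows "form_det V b = square_class (det (gram_matrix b vs))"
proof -
  have "square_class (det (gram_matrix b ws)) = square_class (det (gram_matrix b vs))"
    if ws: "ordered_basis V ws" for ws
  proof -
    obtain t where t: "det (gram_matrix b ws) = det (gram_matrix b vs) * t ^ 2"
      using det_gram_change[OF assms(1,2) ws] .
    obtain s where "det (gram_matrix b vs) = det (gram_matrix b ws) * s ^ 2"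
      using det_gram_change[OF assms(1) ws assms(2)] .
    \<comment> \<open>Going to the other basis and back multiplies the determinant by t^2 s^2; as it
      is nonzero, so is t.\<close>
    then have "t \<noteq> 0" using assms(3) t by auto
    then show ?thesis unfolding t by (rule square_class_mult_square)
  qed
  then show ?thesis using assms(2) unfolding form_det_def by blast
qed

lemma det_gram_orthogonal:
  assumes "\<And>i j. i < length vs \<Longrightarrow> j < length vs \<Longrightarrow> b (vs ! i) (vs ! j) = (if i = j then q i else 0)"
  shows "det (gram_matrix b vs) = (\<Prod>i<length vs. q i)"
proof -
  let ?G = "gram_matrix b vs"
  have G: "?G \<in> carrier_mat (length vs) (length vs)" by (simp add: gram_matrix_def)
  have "upper_triangular ?G" using assms by (auto simp: gram_matrix_def upper_triangular_def)
  then have "det ?G = prod_list (diag_mat ?G)" using G by (rule det_upper_triangular)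
  also have "diag_mat ?G = map q [0..<length vs]"
    using assms by (auto simp: diag_mat_def gram_matrix_def intro!: nth_equalityI)
  also have "prod_list \<dots> = (\<Prod>i<length vs. q i)"
    by (simp add: prod.distinct_set_conv_list[symmetric] atLeast0LessThan)
  finally show ?thesis .
qed

lemma ordered_basis_units:
  fixes P :: "nat \<Rightarrow> 'w idx"
  assumes inj: "inj P" and m: "\<And>i. i < k \<Longrightarrow> modulus g (P i) = [:- r, 1:]"
  shows "ordered_basis (to_ambient ` coords.coord (modulus g) (P ` {..<k}))
     (map (\<lambda>i. to_ambient (unit_coord (P i))) [0..<k])"
proof -
  interpret coords "modulus g" .
  have unit_inj: "unit_coord i = unit_coord j \<longleftrightarrow> i = j" for i j :: "'w idx"
  proof
    assume "unit_coord i = unit_coord j"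
    then have "coeff (unit_coord i i) 0 = coeff (unit_coord j i) 0" by simp
    then show "i = j" by (simp add: coeff_unit_coord split: if_splits)
  qed simp
  let ?U = "(\<lambda>i. unit_coord (P i)) ` {..<k}"
  have injU: "inj_on (\<lambda>i. unit_coord (P i)) {..<k}"
    using inj by (auto simp: inj_on_def unit_inj)
  have sumU: "(\<Sum>v\<in>?U. u v \<odot> v) = (\<Sum>i<k. u (unit_coord (P i)) \<odot> unit_coord (P i))" for u
    using sum.reindex[OF injU, of "\<lambda>v. u v \<odot> v"] by simp
  have coeffsum: "coeff ((\<Sum>i<k. c i \<odot> unit_coord (P i)) (P j)) 0 = c j" if "j < k" for c j
  proof -
    have "coeff ((\<Sum>i\<in>I. c i \<odot> unit_coord (P i)) (P j)) 0 = (\<Sum>i\<in>I. if i = j then c j else 0)" for I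
      by (induction I rule: infinite_finite_induct)
        (auto simp: coeff_unit_coord inj_eq[OF inj])
    then show ?thesis using that by simp
  qed
  have indep: "\<not> QF.dependent ?U"
    unfolding QF.dependent_finite[OF finite_imageI[OF finite_lessThan]]
  proof
    assume "\<exists>u. (\<exists>v\<in>?U. u v \<noteq> 0) \<and> (\<Sum>v\<in>?U. u v \<odot> v) = 0"
    then obtain u j where u: "j < k" "u (unit_coord (P j)) \<noteq> 0" "(\<Sum>v\<in>?U. u v \<odot> v) = 0" by auto
    then show False using coeffsum[OF u(1), of "\<lambda>i. u (unit_coord (P i))"] unfolding sumU by simp
  qed
  have span: "QF.span ?U = coord (P ` {..<k})"
  proof
    show "QF.span ?U \<subseteq> coord (P ` {..<k})"
      using m by (intro QF_span_coord) (auto intro!: unit_coord_coord)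
    show "coord (P ` {..<k}) \<subseteq> QF.span ?U"
    proof
      fix x assume x: "x \<in> coord (P ` {..<k})"
      have "x = (\<Sum>i<k. coeff (x (P i)) 0 \<odot> unit_coord (P i))" (is "_ = ?s")
      proof (rule ext)
        fix j
        show "x j = ?s j"
        proof (cases "j \<in> P ` {..<k}")
          case True
          then obtain i where i: "i < k" "j = P i" by blast
          have s: "?s \<in> coord (P ` {..<k})"
            using m by (intro QF.subspace_sum[OF subspace_coord] coord_closed) (auto intro!: unit_coord_coord)
          have "x j = [:coeff (x j) 0:]" "?s j = [:coeff (?s j) 0:]"
            using coord_linear(1)[OF m[OF i(1)] x] coord_linear(1)[OF m[OF i(1)] s] i by auto
          then show ?thesis using coeffsum[OF i(1), of "\<lambda>i. coeff (x (P i)) 0"] i(2) by metis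
        next
          case False
          have "(\<Sum>i\<in>I. c i \<odot> unit_coord (P i)) j = 0" if "I \<subseteq> {..<k}" for I and c :: "nat \<Rightarrow> two_adic"
            using finite_subset[OF that finite_lessThan] that
            by (induction I rule: finite_induct) (use False in \<open>auto simp: unit_coord_def scaleF_def\<close>)
          then show ?thesis using False x by (simp add: coord_def)
        qed
      qed
      also have "\<dots> \<in> QF.span ?U" by (intro QF.span_sum QF.span_scale QF.span_base) auto
      finally show "x \<in> QF.span ?U" .
    qed
  qed
  have set: "set (map (\<lambda>i. to_ambient (unit_coord (P i))) [0..<k]) = to_ambient ` ?U"
    by (auto simp: image_image)
  show ?thesis
    unfolding ordered_basis_def set
  proof (intro conjI)
    show "distinct (map (\<lambda>i. to_ambient (unit_coord (P i))) [0..<k])"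
      using inj by (auto simp: distinct_map inj_on_def unit_inj inj_eq[OF inj_to_ambient])
    show "\<not> QM.dependent (to_ambient ` ?U)" by (rule to_Q.independent_inj_image[OF indep inj_to_ambient])
    show "QM.span (to_ambient ` ?U) = to_ambient ` coord (P ` {..<k})"
      unfolding to_Q.span_image span ..
  qed
qed

lemma M_plus_eq:
  fixes g :: "'w \<Rightarrow> two_adic poly"
  shows "M_plus k = to_ambient ` coords.coord (modulus g) (PI ` {..<k})"
proof (rule Set.set_eqI)
  fix v :: "'w ambient"
  obtain x y z where v: "v = (x, y, z)" by (cases v)
  have "v \<in> M_plus k \<longleftrightarrow> of_ambient v \<in> coords.coord (modulus g) (PI ` {..<k})"
  proof -
    have M: "(x, y, z) \<in> M_plus k \<longleftrightarrow> x \<in> power_module [:- 1, 1:] k \<and> y = 0 \<and> z = 0"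
      by (auto simp: M_plus_def)
    have mem: "PI i \<in> PI ` {..<k} \<longleftrightarrow> i < k" "MI i \<notin> PI ` {..<k}" "WI w i \<notin> PI ` {..<k}" for i and w :: 'w
      by auto
    show ?thesis unfolding v M
      by (auto simp: coords.coord_def power_module_def of_ambient_def quotient_ring_iff fun_eq_iff idx_all mem not_less)
  qed
  then show "v \<in> M_plus k \<longleftrightarrow> v \<in> to_ambient ` coords.coord (modulus g) (PI ` {..<k})"
    by (simp only: to_ambient_image_iff)
qed

lemma M_minus_eq:
  fixes g :: "'w \<Rightarrow> two_adic poly"
  shows "M_minus k = to_ambient ` coords.coord (modulus g) (MI ` {..<k})"
proof (rule Set.set_eqI)
  fix v :: "'w ambient"
  obtain x y z where v: "v = (x, y, z)" by (cases v)
  have "v \<in> M_minus k \<longleftrightarrow> of_ambient v \<in> coords.coord (modulus g) (MI ` {..<k})"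
  proof -
    have M: "(x, y, z) \<in> M_minus k \<longleftrightarrow> y \<in> power_module [:1, 1:] k \<and> x = 0 \<and> z = 0"
      by (auto simp: M_minus_def)
    have mem: "MI i \<in> MI ` {..<k} \<longleftrightarrow> i < k" "PI i \<notin> MI ` {..<k}" "WI w i \<notin> MI ` {..<k}" for i and w :: 'w
      by auto
    show ?thesis unfolding v M
      by (auto simp: coords.coord_def power_module_def of_ambient_def quotient_ring_iff fun_eq_iff idx_all mem not_less)
  qed
  then show "v \<in> M_minus k \<longleftrightarrow> v \<in> to_ambient ` coords.coord (modulus g) (MI ` {..<k})"
    by (simp only: to_ambient_image_iff)
qed

lemma form_det_units:
  fixes P :: "nat \<Rightarrow> 'w idx"
  assumes "inj P" "\<And>i. i < k \<Longrightarrow> modulus g (P i) = [:- r, 1:]" "bilin b"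
    "\<And>i j. i < k \<Longrightarrow> j < k \<Longrightarrow> b (unit_coord (P i)) (unit_coord (P j)) = (if i = j then 2 * q i else 0)"
    "\<And>i. i < k \<Longrightarrow> q i \<noteq> 0"
  shows "form_det (to_ambient ` coords.coord (modulus g) (P ` {..<k})) (\<lambda>u v. b (of_ambient u) (of_ambient v))
    = square_class (\<Prod>i<k. 2 * q i)"
proof -
  let ?vs = "map (\<lambda>i. to_ambient (unit_coord (P i))) [0..<k]"
  let ?b = "\<lambda>u v. b (of_ambient u) (of_ambient v)"
  have B: "bilinQ ?b"
    unfolding bilinQ_def by (auto simp: of_ambient_add of_ambient_scale bilinD[OF assms(3)] bilin_sym[OF assms(3)])
  have "det (gram_matrix ?b ?vs) = (\<Prod>i<length ?vs. 2 * q i)"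
    by (rule det_gram_orthogonal) (simp add: assms(4))
  then have d: "det (gram_matrix ?b ?vs) = (\<Prod>i<k. 2 * q i)" by simp
  then have "det (gram_matrix ?b ?vs) \<noteq> 0" using assms(5) by simp
  from form_det_eq[OF B ordered_basis_units[OF assms(1,2)] this] show ?thesis unfolding d .
qed

section \<open>Star-symmetric factorizations\<close>

text \<open>A nonzero combination of least degree divides every combination, in particular a and b.
  If it were associated to a, then a would divide b; so it is a unit.\<close>

lemma bezout_irreducible:
  assumes "irreducible a" "\<not> a dvd b"
  shows "bezout a b"
proof -
  define I where "I k \<longleftrightarrow> (\<exists>u v. u * a + v * b \<noteq> 0 \<and> degree (u * a + v * b) = k)" for k
  have "1 * a + 0 * b \<noteq> 0" using assms(1) by auto
  then have "I (degree (1 * a + 0 * b))" unfolding I_def by blast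
  then have "I (LEAST k. I k)" by (rule LeastI)
  then obtain u v where uv: "u * a + v * b \<noteq> 0" "degree (u * a + v * b) = (LEAST k. I k)" unfolding I_def by blast
  define g where "g = u * a + v * b"
  have dvd: "g dvd u' * a + v' * b" for u' v'
  proof (rule ccontr)
    assume "\<not> g dvd u' * a + v' * b"
    then have nz: "(u' * a + v' * b) mod g \<noteq> 0" by (simp add: dvd_eq_mod_eq_0)
    define q where "q = (u' * a + v' * b) div g"
    have e: "(u' * a + v' * b) mod g = (u' - q * u) * a + (v' - q * v) * b"
      using minus_div_mult_eq_mod[of "u' * a + v' * b" g, folded q_def]
      by (simp add: g_def algebra_simps)
    have "I (degree ((u' * a + v' * b) mod g))" unfolding I_def using nz e by metis
    then have "(LEAST k. I k) \<le> degree ((u' * a + v' * b) mod g)" by (rule Least_le)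
    then show False using degree_mod_less[of g "u' * a + v' * b"] nz uv unfolding g_def[symmetric] by auto
  qed
  have ga: "g dvd a" and gb: "g dvd b" using dvd[of 1 0] dvd[of 0 1] by simp_all
  then obtain c where c: "a = g * c" by (elim dvdE)
  have "g dvd 1 \<or> c dvd 1" using assms(1) c irreducibleD by blast
  moreover have "\<not> c dvd 1"
  proof
    assume "c dvd 1"
    then have "a dvd g" unfolding c by (simp add: mult_unit_dvd_iff)
    then show False using gb assms(2) dvd_trans by blast
  qed
  ultimately obtain e where "1 = g * e" by (auto elim: dvdE)
  then have "(e * u) * a + (e * v) * b = 1" by (simp add: g_def algebra_simps)
  then show ?thesis unfolding bezout_def by blast
qed

lemma monic_irreducible_dvd_eq:
  assumes "irreducible (a :: two_adic poly)" "irreducible b" "lead_coeff a = 1" "lead_coeff b = 1" "a dvd b"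
  shows "a = b"
proof -
  obtain c where c: "b = a * c" using assms(5) by (elim dvdE)
  have "\<not> a dvd 1" using assms(1) irreducible_not_unit by blast
  then have "c dvd 1" using assms(2) c irreducibleD by blast
  then obtain k where k: "c = [:k:]" by (auto simp: is_unit_poly_iff)
  have "lead_coeff b = lead_coeff a * lead_coeff c" unfolding c by (rule lead_coeff_mult)
  then have "k = 1" using assms(3,4) k by simp
  then show ?thesis using c k by (simp add: one_pCons[symmetric])
qed

lemma bezout_monic_irreducible:
  assumes "irreducible a" "irreducible b" "lead_coeff a = 1" "lead_coeff b = 1" "a \<noteq> b"
  shows "bezout a b"
  using bezout_irreducible monic_irreducible_dvd_eq assms by blast

lemma star_poly_props:
  assumes "coeff p 0 \<noteq> (0 :: two_adic)"
  shows "lead_coeff (star_poly p) = 1" "coeff (star_poly p) 0 = lead_coeff p / coeff p 0"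
    "degree (star_poly p) = degree p"
proof -
  show d: "degree (star_poly p) = degree p"
    using assms by (simp add: star_poly_def poly_0_coeff_0)
  show "lead_coeff (star_poly p) = 1"
    unfolding d using assms by (simp add: star_poly_def poly_0_coeff_0 coeff_reflect_poly)
  show "coeff (star_poly p) 0 = lead_coeff p / coeff p 0"
    by (simp add: star_poly_def poly_0_coeff_0 coeff_reflect_poly field_simps)
qed

lemma star_poly_star_poly:
  assumes "coeff p 0 \<noteq> (0 :: two_adic)" "lead_coeff p = 1"
  shows "star_poly (star_poly p) = p"
proof -
  have "poly (star_poly p) 0 = inverse (coeff p 0)"
    using star_poly_props(2)[OF assms(1)] assms(2) by (simp add: poly_0_coeff_0 divide_inverse)
  then have "star_poly (star_poly p) = smult (coeff p 0) (reflect_poly (star_poly p))"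
    by (simp add: star_poly_def[of "star_poly p"])
  also have "\<dots> = p"
    using assms(1) by (simp add: star_poly_def reflect_poly_smult poly_0_coeff_0)
  finally show ?thesis .
qed

lemma star_poly_mult: "star_poly (p * q) = star_poly p * star_poly (q :: two_adic poly)"
  by (simp add: star_poly_def reflect_poly_mult mult.commute)

text \<open>\<open>star_poly\<close> is multiplicative, keeps the degree when the constant term is
  nonzero, and is an involution on monic such polynomials, so a factorization of the image yields
  one of \<open>p\<close>.\<close>

lemma star_poly_irreducible:
  assumes "irreducible (p :: two_adic poly)" "coeff p 0 \<noteq> 0" "lead_coeff p = 1"
  shows "irreducible (star_poly p)"
proof (rule irreducibleI)
  show "star_poly p \<noteq> 0" using star_poly_props(1)[OF assms(2)] by auto
  have "degree p \<noteq> 0" using assms(1) by (auto simp: irreducible_def is_unit_iff_degree)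
  then show "\<not> star_poly p dvd 1"
    using \<open>star_poly p \<noteq> 0\<close> star_poly_props(3)[OF assms(2)] by (simp add: is_unit_iff_degree)
  fix a b assume ab: "star_poly p = a * b"
  have "coeff (star_poly p) 0 \<noteq> 0" using star_poly_props(2)[OF assms(2)] assms(2,3) by simp
  then have a0: "coeff a 0 \<noteq> 0" "coeff b 0 \<noteq> 0" by (auto simp: ab coeff_mult)
  have "p = star_poly a * star_poly b"
    using star_poly_star_poly[OF assms(2,3)] unfolding ab star_poly_mult by simp
  then have "star_poly a dvd 1 \<or> star_poly b dvd 1" using assms(1) irreducibleD by blast
  then have "degree (star_poly a) = 0 \<or> degree (star_poly b) = 0" by (auto simp: is_unit_poly_iff)
  then have "degree a = 0 \<or> degree b = 0" using star_poly_props(3) a0 by simp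
  moreover have "a \<noteq> 0" "b \<noteq> 0" using a0 by auto
  ultimately show "a dvd 1 \<or> b dvd 1" by (simp add: is_unit_iff_degree)
qed

text \<open>The reversal of p is p(0) p. Evaluation at 1 gives p(0) = 1, and evaluation at -1 then
  gives (-1)^deg = 1.\<close>

lemma star_fixed_reflect:
  assumes "star_poly p = (p :: two_adic poly)" "coeff p 0 \<noteq> 0" "poly p 1 \<noteq> 0" "poly p (- 1) \<noteq> 0"
  shows "reflect_poly p = p" "even (degree p)"
proof -
  have r: "reflect_poly p = smult (coeff p 0) p"
    using arg_cong[OF assms(1), of "smult (coeff p 0)"] assms(2)
    by (simp add: star_poly_def poly_0_coeff_0)
  have "poly (reflect_poly p) 1 = poly p 1" by (simp add: poly_reflect_poly_nz)
  then have "coeff p 0 * poly p 1 = poly p 1" unfolding r by simp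
  then have "coeff p 0 = 1" using assms(3) by simp
  then show "reflect_poly p = p" using r by simp
  then have "poly p (- 1) = (- 1) ^ degree p * poly p (- 1)"
    using poly_reflect_poly_nz[of "- 1" p] by simp
  then have "(- 1 :: two_adic) ^ degree p = 1" using assms(4) by simp
  then show "even (degree p)" by (cases "even (degree p)") auto
qed

text \<open>Multiplying a factor by its star makes each modulus symmetric. Different moduli are
  coprime because the irreducible polynomials in them, the factors and their stars, are pairwise
  distinct.\<close>

lemma assembly_of_star_factorization:
  assumes sf: "star_factorization f Wsp Wsd fw nw" and f: "poly f 1 * poly f (- 1) \<noteq> 0"
  defines "g \<equiv> \<lambda>w. E_modulus (fw w)" and "W \<equiv> Wsp \<union> Wsd"
  shows "assembly W g (\<lambda>w. degree (g w) div 2)"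
    "fract_poly f = (\<Prod>w\<in>W. g w ^ nw w)"
    "\<And>w. w \<in> W \<Longrightarrow> degree (g w) = 2 * (degree (g w) div 2)"
proof -
  define p where "p w = fract_poly (fw w)" for w
  note s = sf[unfolded star_factorization_def, folded p_def]
  have pair: "\<forall>w\<in>W. \<forall>w'\<in>W. w \<noteq> w' \<longrightarrow> fw w \<noteq> fw w' \<and> p w \<noteq> star_poly (p w')"
    unfolding W_def using s by (elim conjE)
  have fin: "finite Wsp" "finite Wsd" "Wsp \<inter> Wsd = {}" using s by blast+
  have irr: "irreducible (fw w)" "lead_coeff (fw w) = 1" "0 < nw w" if "w \<in> W" for w
    using s that unfolding W_def by blast+
  have pirr: "irreducible (p w)" if "w \<in> W" for w
    unfolding p_def by (rule irreducible_fract_poly[OF irr(1,2)[OF that]])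
  have plc: "lead_coeff (p w) = 1" if "w \<in> W" for w
    using irr(2)[OF that] by (simp add: p_def degree_map_poly coeff_map_poly)
  have gsp: "g w = p w * star_poly (p w)" if "w \<in> Wsp" for w
    using s that unfolding g_def E_modulus_def p_def by auto
  have gsd: "g w = p w" "star_poly (p w) = p w" if "w \<in> Wsd" for w
    using s that unfolding g_def E_modulus_def p_def by auto
  have "(\<Prod>w\<in>W. g w ^ nw w) = (\<Prod>w\<in>Wsp. g w ^ nw w) * (\<Prod>w\<in>Wsd. g w ^ nw w)"
    unfolding W_def using fin by (rule prod.union_disjoint)
  also have "(\<Prod>w\<in>Wsp. g w ^ nw w) = (\<Prod>w\<in>Wsp. (p w * star_poly (p w)) ^ nw w)"
    by (intro prod.cong refl) (simp only: gsp)
  also have "(\<Prod>w\<in>Wsd. g w ^ nw w) = (\<Prod>w\<in>Wsd. p w ^ nw w)"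
    by (intro prod.cong refl) (simp only: gsd)
  finally show fprod: "fract_poly f = (\<Prod>w\<in>W. g w ^ nw w)" using s by simp
  have finW: "finite W" using fin by (simp add: W_def)
  have pf: "poly (fract_poly f) (to_fract x) = to_fract (poly f x)" for x
    by (induction f) (simp_all add: map_poly_pCons)
  have "poly (fract_poly f) 1 = to_fract (poly f 1)" "poly (fract_poly f) (- 1) = to_fract (poly f (- 1))"
    using pf[of 1] pf[of "- 1"] by simp_all
  then have nz: "poly (fract_poly f) 1 \<noteq> 0" "poly (fract_poly f) (- 1) \<noteq> 0" using f by auto
  have gnz: "poly (g w) 1 \<noteq> 0" "poly (g w) (- 1) \<noteq> 0" if "w \<in> W" for w
    using nz that finW irr(3)[OF that] unfolding fprod poly_prod poly_power by auto
  \<comment> \<open>Division by zero yields zero: if p(0) = 0, the star is the zero polynomial, and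
    \<open>g w\<close> would vanish at 1.\<close>
  have p0: "coeff (p w) 0 \<noteq> 0" if w: "w \<in> W" for w
  proof
    assume "coeff (p w) 0 = 0"
    then have "star_poly (p w) = 0" by (simp add: star_poly_def poly_0_coeff_0)
    then have "g w = 0" using w gsp gsd unfolding W_def by fastforce
    then show False using gnz[OF w] by simp
  qed
  note sp = star_poly_props[OF p0] star_poly_star_poly[OF p0 plc] star_poly_irreducible[OF pirr p0 plc]
  have glc: "lead_coeff (g w) = 1" if "w \<in> W" for w
  proof (cases "w \<in> Wsp")
    case True
    show ?thesis unfolding gsp[OF True] lead_coeff_mult plc[OF that] sp(1)[OF that] by simp
  next
    case False
    then show ?thesis using that plc gsd(1) unfolding W_def by auto
  qed
  have gstar: "star_poly (g w) = g w" if w: "w \<in> W" for w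
  proof (cases "w \<in> Wsp")
    case True
    then show ?thesis using sp(4)[OF w w] by (simp add: gsp star_poly_mult mult.commute)
  next
    case False
    then show ?thesis using w gsd unfolding W_def by auto
  qed
  have g0: "coeff (g w) 0 \<noteq> 0" if w: "w \<in> W" for w
  proof
    assume "coeff (g w) 0 = 0"
    then have "star_poly (g w) = 0" by (simp add: star_poly_def poly_0_coeff_0)
    then show False using gstar[OF w] glc[OF w] by auto
  qed
  note refl = star_fixed_reflect[OF gstar g0 gnz]
  show ev: "degree (g w) = 2 * (degree (g w) div 2)" if "w \<in> W" for w
    using refl(2)[OF that that that that] by simp
  \<comment> \<open>The star divides by the constant term, so integrality is not visible. It follows
    from Gauss's lemma, as \<open>g w\<close> is a monic factor of f with monic cofactor.\<close>
  have zg: "zpoly (g w)" if w: "w \<in> W" for w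
  proof (rule zpoly_monic_factor[OF glc[OF w]])
    let ?q = "g w ^ (nw w - 1) * (\<Prod>w\<in>W-{w}. g w ^ nw w)"
    have "g w * ?q = g w ^ nw w * (\<Prod>w\<in>W-{w}. g w ^ nw w)"
      using irr(3)[OF w] by (simp add: mult.assoc[symmetric] power_eq_if)
    also have "\<dots> = fract_poly f" unfolding fprod using finW w by (simp add: prod.remove)
    finally have q: "g w * ?q = fract_poly f" .
    show "zpoly (g w * ?q)" unfolding q by simp
    have "lead_coeff (\<Prod>w\<in>V. g w ^ nw w) = 1" if "V \<subseteq> W" for V
      using finite_subset[OF that finW] that
      by (induction V rule: finite_induct) (auto simp only: prod.insert prod.empty lead_coeff_mult
        lead_coeff_power glc insert_subset power_one lead_coeff_1 mult_1 not_False_eq_True)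
    then show "lead_coeff ?q = 1" by (simp only: lead_coeff_mult lead_coeff_power glc[OF w] power_one mult_1 Diff_subset)
  qed
  have dpos: "degree (g w) > 0" if w: "w \<in> W" for w
  proof -
    have "degree (p w) > 0" using pirr[OF w] by (auto simp: irreducible_def is_unit_iff_degree)
    moreover have "degree (g w) = degree (p w) + degree (star_poly (p w)) \<or> degree (g w) = degree (p w)"
    proof (cases "w \<in> Wsp")
      case True
      have "p w \<noteq> 0" "star_poly (p w) \<noteq> 0" using plc[OF w] sp(1)[OF w] by auto
      then show ?thesis by (simp add: gsp True degree_mult_eq)
    next
      case False
      then show ?thesis using w gsd unfolding W_def by auto
    qed
    ultimately show ?thesis by auto
  qed
  show "assembly W g (\<lambda>w. degree (g w) div 2)"
  proof (rule assembly.intro)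
    show "finite W" by (rule finW)
  next
    fix w assume w: "w \<in> W"
    show "sym_poly (g w) (degree (g w) div 2)"
      using zg[OF w] glc[OF w] ev[OF w] dpos[OF w] refl(1)[OF w w w w] gnz[OF w]
      by (intro sym_poly.intro) auto
  next
    fix w w' assume w: "w \<in> W" "w' \<in> W" "w \<noteq> w'"
    have ne: "fw w \<noteq> fw w'" "p w \<noteq> star_poly (p w')" "p w' \<noteq> star_poly (p w)"
      using pair[rule_format, OF w] pair[rule_format, OF w(2,1) w(3)[symmetric]] by simp_all
    have ne1: "p w \<noteq> p w'" using ne(1) by (simp add: p_def fract_poly_eq_iff)
    have ne2: "star_poly (p w) \<noteq> star_poly (p w')"
      using ne1 sp(4)[OF w(1,1)] sp(4)[OF w(2,2)] by metis
    have b: "bezout (p w) (p w')" "bezout (p w) (star_poly (p w'))"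
      "bezout (star_poly (p w)) (p w')" "bezout (star_poly (p w)) (star_poly (p w'))"
      by (rule bezout_monic_irreducible[OF pirr[OF w(1)] pirr[OF w(2)] plc[OF w(1)] plc[OF w(2)] ne1]
          bezout_monic_irreducible[OF pirr[OF w(1)] sp(5)[OF w(2) w(2) w(2)] plc[OF w(1)] sp(1)[OF w(2)] ne(2)]
          bezout_monic_irreducible[OF sp(5)[OF w(1) w(1) w(1)] pirr[OF w(2)] sp(1)[OF w(1)] plc[OF w(2)] ne(3)[symmetric]]
          bezout_monic_irreducible[OF sp(5)[OF w(1) w(1) w(1)] sp(5)[OF w(2) w(2) w(2)] sp(1)[OF w(1)] sp(1)[OF w(2)] ne2])+
    have g: "g v = p v * star_poly (p v) \<or> g v = p v" if "v \<in> W" for v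
      using that gsp gsd unfolding W_def by blast
    have "bezout a (g w')" if "a = p w \<or> a = star_poly (p w)" for a
      using g[OF w(2)] that b by (auto intro: bezout_mult)
    then have "bezout (g w') (p w)" "bezout (g w') (star_poly (p w))" by (auto intro: bezout_sym)
    then have "bezout (g w') (g w)" using g[OF w(1)] by (auto intro: bezout_mult)
    then show "bezout (g w) (g w')" by (rule bezout_sym)
  qed
qed

section \<open>Comparison of f with its squarefree odd part\<close>

context assembly
begin

text \<open>The root of the square part of f. At 1 and -1, f and \<open>fodd\<close> thus differ by
  nonzero squares, so valuation parities and square classes carry over.\<close>

definition hsq :: "two_adic poly" where "hsq = (\<Prod>w\<in>W. g w ^ (nw w div 2))"

lemma prod_eq_fodd_square: "(\<Prod>w\<in>W. g w ^ nw w) = fodd * hsq ^ 2"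
proof -
  have "fodd = (\<Prod>w\<in>W. g w ^ (nw w mod 2))"
    unfolding fodd_def Wodd_def using finite_W
    by (intro prod.mono_neutral_cong_left) (auto simp: odd_iff_mod_2_eq_one)
  then have "fodd * hsq ^ 2 = (\<Prod>w\<in>W. g w ^ (nw w mod 2) * (g w ^ (nw w div 2)) ^ 2)"
    by (simp add: hsq_def prod_power_distrib prod.distrib)
  also have "\<dots> = (\<Prod>w\<in>W. g w ^ nw w)"
    by (intro prod.cong refl) (metis mod_mult_div_eq power_add power_mult mult.commute)
  finally show ?thesis ..
qed

text \<open>The left side is half the degree of f. It lets the sign (-1)^n of the theorem be
  compared with the sign (-1)^dodd of the glue values.\<close>

lemma dodd_parity: "even (\<Sum>w\<in>W. nw w * d w) \<longleftrightarrow> even dodd"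
proof -
  have "(\<Sum>w\<in>W. nw w * d w) = (\<Sum>w\<in>W. (nw w mod 2) * d w) + 2 * (\<Sum>w\<in>W. (nw w div 2) * d w)"
    unfolding sum_distrib_left sum.distrib[symmetric]
    by (intro sum.cong refl) (metis add_mult_distrib mod_mult_div_eq mult.assoc)
  moreover have "dodd = (\<Sum>w\<in>W. (nw w mod 2) * d w)"
    unfolding dodd_def Wodd_def using finite_W
    by (intro sum.mono_neutral_cong_left) (auto simp: odd_iff_mod_2_eq_one)
  ultimately show ?thesis by simp
qed

lemma hsq_nz: "poly hsq 1 \<noteq> 0" "poly hsq (- 1) \<noteq> 0" "poly fodd 1 \<noteq> 0" "poly fodd (- 1) \<noteq> 0"
proof -
  have nz: "poly (g w) 1 \<noteq> 0" "poly (g w) (- 1) \<noteq> 0" if "w \<in> W" for w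
    using sym[OF that] by (simp_all add: sym_poly_def)
  show "poly hsq 1 \<noteq> 0" "poly hsq (- 1) \<noteq> 0" "poly fodd 1 \<noteq> 0" "poly fodd (- 1) \<noteq> 0"
    using finite_W nz by (auto simp: hsq_def fodd_def Wodd_def poly_prod)
qed

end

section \<open>The theorem\<close>

text \<open>The lines other than the first come in m pairs, each contributing -4. The single factor
  2 of the first line remains; it is the factor 2 in the determinant for odd n_+.\<close>

lemma alternating_prod_odd:
  "(\<Prod>i<2*m+1. 2 * (if i = 0 then c else if odd i then 1 else - 1)) = 2 * c * (- 1) ^ m * (2 ^ m) ^ 2"
  for c :: two_adic
  by (induction m) (simp_all add: power2_eq_square)

text \<open>Two special lines contribute 4 c \<nu>, and 4 is a square.\<close>

lemma alternating_prod_even: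
  "(\<Prod>i<2*m+2. 2 * (if i = 0 then c else if i = 1 then \<nu> else if even i then 1 else - 1))
    = c * \<nu> * (- 1) ^ m * (2 ^ (m + 1)) ^ 2"
  for c \<nu> :: two_adic
  by (induction m) (simp_all add: power2_eq_square)

lemma square_class_eqI: "a = c * t ^ 2 \<Longrightarrow> t \<noteq> 0 \<Longrightarrow> square_class a = square_class c"
  using square_class_mult_square by blast

lemma even_v2_decompose:
  assumes "x \<noteq> 0" "even (v2 x)"
  obtains k u where "to_fract x = (2 ^ k) ^ 2 * to_fract u" "u dvd 1"
proof -
  obtain j u where ju: "x = 2 ^ j * u" "u dvd 1" using assms(1) by (rule two_adic_int_decompose)
  then have "even j" using assms(2) v2_pow2_unit by simp
  then obtain k where "j = 2 * k" by (elim evenE)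
  moreover have "to_fract (2 ^ i) = (2 :: two_adic) ^ i" for i by (induction i) simp_all
  ultimately have "to_fract x = (2 ^ k) ^ 2 * to_fract u"
    unfolding ju(1) to_fract_mult by (simp only: power_mult[symmetric] mult.commute[of 2])
  then show ?thesis using ju(2) that by blast
qed

text \<open>Here s is a unit, so s^2 and v^2 are 1 modulo 4. From e u v = s^2 it follows that v = e
  u modulo 4; divide by u v.\<close>

lemma Z2_unit_two_squares:
  assumes u: "Z2_unit u" "Z2_unit v" and e: "e = 1 \<or> e = - 1" and s: "e * u * v = s ^ 2"
  shows "(1 / u - e * (1 / v)) / 4 \<in> Z2"
proof -
  have us: "Z2_unit (s ^ 2)" unfolding s[symmetric] using u e by (auto intro: Z2_unit_mult)
  then have s0: "s \<noteq> 0" by (auto simp: Z2_unit_def)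
  have "s \<in> Z2" using Z2_square_unit_mult[of s 1] us by (simp add: Z2_unit_def)
  moreover have "inverse s \<in> Z2"
    using Z2_square_unit_mult[of "inverse s" 1] us by (simp add: Z2_unit_def power_inverse)
  ultimately have "Z2_unit s" using s0 by (simp add: Z2_unit_def)
  then have 1: "(s ^ 2 - 1) / 4 \<in> Z2" by (rule Z2_unit_square)
  have 2: "(v ^ 2 - 1) / 4 \<in> Z2" using u(2) by (rule Z2_unit_square)
  have Z: "inverse u \<in> Z2" "inverse v \<in> Z2" "u \<in> Z2" "v \<in> Z2" "u \<noteq> 0" "v \<noteq> 0" "e \<in> Z2"
    using u e by (auto simp: Z2_unit_def)
  have "inverse u * inverse v * (e * u * ((v ^ 2 - 1) / 4) - v * ((s ^ 2 - 1) / 4)) \<in> Z2"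
    using Z 1 2 by (intro Z2_mult Z2_diff)
  also have "inverse u * inverse v * (e * u * ((v ^ 2 - 1) / 4) - v * ((s ^ 2 - 1) / 4))
      = (1 / u - e * (1 / v)) / 4"
    unfolding s[symmetric] using Z by (simp add: field_simps power2_eq_square)
  finally show ?thesis .
qed

theorem theorem4p16:
  fixes F f :: "two_adic_int poly"
    and n n_plus n_minus :: nat
    and Wsp Wsd :: "'w set"
    and fw :: "'w \<Rightarrow> two_adic_int poly"
    and nw :: "'w \<Rightarrow> nat"
  assumes "star_symmetric (fract_poly F)"
    and "degree F = 2 * n"
    and "even (v2 (poly F 1))" and "even (v2 (poly F (- 1)))"
    and "poly F 1 * poly F (- 1) \<noteq> 0 \<longrightarrow>
           square_class (to_fract ((- 1) ^ n * poly F 1 * poly F (- 1))) = square_class 1"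
    and "F = [:- 1, 1:] ^ n_plus * [:1, 1:] ^ n_minus * f"
    and "poly f 1 * poly f (- 1) \<noteq> 0"
    and "star_factorization f Wsp Wsd fw nw"
  defines "M \<equiv> M_module n_plus n_minus (Wsp \<union> Wsd) fw nw"
  shows "(\<exists>b. has_stable_even_unimodular M (alpha fw) b) \<and>
    (poly F 1 = 0 \<and> poly F (- 1) = 0 \<longrightarrow>
      (\<forall>u_plus u_minus. u_plus dvd 1 \<and> u_minus dvd 1 \<and> u_plus * u_minus = (- 1) ^ n \<longrightarrow>
        (\<exists>b. has_stable_even_unimodular M (alpha fw) b \<and>
          form_det (M_plus n_plus) b =
            square_class (to_fract (if even n_plus then u_plus * poly f 1
                                    else 2 * u_plus * poly f 1)) \<and>
          form_det (M_minus n_minus) b =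
            square_class (to_fract (if even n_plus then u_minus * poly f (- 1)
                                    else 2 * u_minus * poly f (- 1))))))"
proof -
  define g where "g w = E_modulus (fw w)" for w
  define d where "d w = degree (g w) div 2" for w
  let ?W = "Wsp \<union> Wsd"
  note asm = assembly_of_star_factorization[OF assms(8,7), folded g_def, folded d_def]
  interpret assembly ?W g d nw by (rule asm(1))
  have M: "M = M_module n_plus n_minus ?W fw nw" by (simp add: M_def)
  have stable: "has_stable_even_unimodular M (alpha fw) (\<lambda>u v. b (of_ambient u) (of_ambient v))"
    if "good (J n_plus n_minus) b S" for b S
    unfolding M by (rule good_has_stable[OF that]) (simp add: g_def)
  have exists: "\<exists>b. has_stable_even_unimodular M (alpha fw) b" if "admits a (J n_plus n_minus)" for a
    using that stable unfolding admits_def by blast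
  have fr: "fract_poly f = fodd * hsq ^ 2" unfolding asm(2) by (rule prod_eq_fodd_square)
  have pf: "poly (fract_poly f) (to_fract x) = to_fract (poly f x)" for x
    by (induction f) (simp_all add: map_poly_pCons)
  have f1: "to_fract (poly f 1) = poly fodd 1 * poly hsq 1 ^ 2"
    and fm1: "to_fract (poly f (- 1)) = poly fodd (- 1) * poly hsq (- 1) ^ 2"
    using pf[of 1] pf[of "- 1"] unfolding fr by simp_all
  have f0: "poly f 1 \<noteq> 0" "poly f (- 1) \<noteq> 0" using assms(7) by auto
  have g0: "g w \<noteq> 0" if "w \<in> ?W" for w using sym[OF that] by (auto simp: sym_poly_def)
  have degf: "degree f = 2 * (\<Sum>w\<in>?W. nw w * d w)"
  proof -
    have "degree f = degree (fract_poly f)" by (simp add: degree_map_poly)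
    also have "\<dots> = (\<Sum>w\<in>?W. degree (g w ^ nw w))"
      unfolding asm(2) using g0 by (intro degree_prod_eq_sum_degree) auto
    also have "\<dots> = (\<Sum>w\<in>?W. 2 * (nw w * d w))"
      using asm(3) g0 by (intro sum.cong refl) (auto simp: degree_power_eq)
    finally show ?thesis by (simp add: sum_distrib_left)
  qed
  have "2 * n = n_plus + n_minus + degree f"
  proof -
    have "f \<noteq> 0" using f0 by auto
    then have "degree F = degree ([:- 1, 1:] ^ n_plus :: two_adic_int poly) + degree ([:1, 1:] ^ n_minus :: two_adic_int poly) + degree f"
      unfolding assms(6) by (subst degree_mult_eq, simp, simp)+ simp
    then show ?thesis using assms(2) by (simp add: degree_power_eq)
  qed
  then have npm: "n_plus + n_minus = 2 * (n - (\<Sum>w\<in>?W. nw w * d w))" "n \<ge> (\<Sum>w\<in>?W. nw w * d w)"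
    unfolding degf by simp_all
  then have parity: "even n_plus \<longleftrightarrow> even n_minus" by presburger
  \<comment> \<open>The glue values carry (-1)^dodd and the theorem (-1)^n; half the number of lines
    accounts for the difference.\<close>
  have sgn_n: "(- 1 :: two_adic) ^ n = (- 1) ^ ((n_plus + n_minus) div 2 + dodd)"
  proof -
    have "n = (n_plus + n_minus) div 2 + (\<Sum>w\<in>?W. nw w * d w)" using npm by simp
    then have "even n \<longleftrightarrow> even ((n_plus + n_minus) div 2 + dodd)" using dodd_parity by (metis even_add)
    then show ?thesis by (simp only: minus_one_power_iff)
  qed
  have F1: "poly F 1 = 0 ^ n_plus * 2 ^ n_minus * poly f 1"
    and Fm1: "poly F (- 1) = (- 2) ^ n_plus * 0 ^ n_minus * poly f (- 1)"
    unfolding assms(6) by simp_all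
  \<comment> \<open>Besides the claim on determinants, this settles existence whenever both
    eigenvalues occur, with the units 1 and (-1)^n.\<close>
  have both: "\<exists>b. has_stable_even_unimodular M (alpha fw) b \<and>
      form_det (M_plus n_plus) b = square_class (to_fract (if even n_plus then u_plus * poly f 1
                                    else 2 * u_plus * poly f 1)) \<and>
      form_det (M_minus n_minus) b = square_class (to_fract (if even n_plus then u_minus * poly f (- 1)
                                    else 2 * u_minus * poly f (- 1)))"
    if np: "n_plus > 0" "n_minus > 0" and u: "u_plus dvd 1" "u_plus * u_minus = (- 1) ^ n" for u_plus u_minus
  proof -
    let ?U = "to_fract u_plus" and ?V = "to_fract u_minus"
    define \<phi>1 \<phi>2 h1 h2 where "\<phi>1 = poly fodd 1" and "\<phi>2 = poly fodd (- 1)"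
      and "h1 = poly hsq 1" and "h2 = poly hsq (- 1)"
    note abbr = \<phi>1_def[symmetric] \<phi>2_def[symmetric] h1_def[symmetric] h2_def[symmetric]
    have nz: "\<phi>1 \<noteq> 0" "\<phi>2 \<noteq> 0" "h1 \<noteq> 0" "h2 \<noteq> 0"
      using hsq_nz by (simp_all add: \<phi>1_def \<phi>2_def h1_def h2_def)
    have Uu: "Z2_unit ?U" using u(1) by (rule Z2_unit_to_fract)
    then have U0: "?U \<noteq> 0" by (simp add: Z2_unit_def)
    have "to_fract ((- 1) ^ k) = (- 1 :: two_adic) ^ k" for k by (cases "even k") simp_all
    then have UV: "?U * ?V = (- 1) ^ n" using arg_cong[OF u(2), of to_fract] by simp
    have sq: "(- 1 :: two_adic) ^ k * (- 1) ^ k = 1" for k by (cases "even k") simp_all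
    \<comment> \<open>The glued lines carry 1/fodd while the theorem speaks of f = fodd hsq^2; the
      two differ by the square of \<phi> h.\<close>
    have H: "square_class (c / \<phi> * r ^ 2) = square_class (c * (\<phi> * h ^ 2))"
      if "\<phi> \<noteq> 0" "h \<noteq> 0" "r \<noteq> 0" for c \<phi> h r :: two_adic
      by (rule square_class_eqI[of _ _ "r / (\<phi> * h)"])
        (use that in \<open>simp_all add: power_divide power_mult_distrib power2_eq_square\<close>)
    have fin: "\<exists>b. has_stable_even_unimodular M (alpha fw) b \<and>
        form_det (M_plus n_plus) b = square_class (\<Prod>i<n_plus. 2 * a (PI i)) \<and>
        form_det (M_minus n_minus) b = square_class (\<Prod>i<n_minus. 2 * a (MI i))"
      if adm: "admits a (J n_plus n_minus)"
        and a: "\<And>i. a (PI i) \<noteq> 0" "\<And>i. a (MI i) \<noteq> 0" for a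
    proof -
      obtain b S where b: "good (J n_plus n_minus) b S"
        and v: "\<And>i j. i \<in> J n_plus n_minus \<inter> (range PI \<union> range MI) \<Longrightarrow> j \<in> J n_plus n_minus \<inter> (range PI \<union> range MI) \<Longrightarrow>
          b (unit_coord i) (unit_coord j) = (if i = j then 2 * a i else 0)"
        using adm unfolding admits_def by blast
      have "form_det (to_ambient ` coord (PI ` {..<n_plus})) (\<lambda>u v. b (of_ambient u) (of_ambient v))
          = square_class (\<Prod>i<n_plus. 2 * a (PI i))"
        by (rule form_det_units[where r = 1, OF _ _ goodD(1)[OF b]]) (use a in \<open>auto simp: v\<close>)
      moreover have "form_det (to_ambient ` coord (MI ` {..<n_minus})) (\<lambda>u v. b (of_ambient u) (of_ambient v))
          = square_class (\<Prod>i<n_minus. 2 * a (MI i))"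
        by (rule form_det_units[where r = "- 1", OF _ _ goodD(1)[OF b]]) (use a in \<open>auto simp: v inj_def\<close>)
      ultimately show ?thesis
        using stable[OF b] unfolding M_plus_eq[of n_plus g] M_minus_eq[of n_minus g] by blast
    qed
    show ?thesis
    proof (cases "even n_plus")
      case False
      then obtain m m' where m: "n_plus = 2 * m + 1" "n_minus = 2 * m' + 1"
        using parity by (metis oddE)
      \<comment> \<open>Solves -\<kappa> (-1)^m = u_plus, so that the determinant on M^+ comes out
        right.\<close>
      define \<kappa> where "\<kappa> = - ((- 1) ^ m * ?U)"
      have ku: "Z2_unit \<kappa>" using Uu by (cases "even m") (simp_all add: \<kappa>_def)
      then have k0: "\<kappa> \<noteq> 0" by (simp add: Z2_unit_def)
      have adm: "odd n_plus" "odd n_minus" using m by simp_all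
      have P: "(\<Prod>i<n_plus. 2 * (if i = 0 then - \<kappa> / \<phi>1 else if odd i then 1 else - 1)) = (2 * ?U) / \<phi>1 * (2 ^ m) ^ 2"
        unfolding m(1) alternating_prod_odd using sq[of m] by (simp add: \<kappa>_def mult_ac)
      have "(- 1 :: two_adic) ^ n = - ((- 1) ^ m * (- 1) ^ m' * (- 1) ^ dodd)"
        unfolding sgn_n m by (simp add: power_add)
      then have "2 * (\<kappa> * (- 1) ^ dodd / \<phi>2) * (- 1) ^ m' = 2 * ((- 1) ^ n * ?U) / \<phi>2"
        by (simp add: \<kappa>_def mult_ac)
      \<comment> \<open>Since u_plus u_minus = (-1)^n, the factor (-1)^n u_plus is u_minus times the
        square of u_plus: the determinant on M^- is right as well.\<close>
      then have Q: "(\<Prod>i<n_minus. 2 * (if i = 0 then \<kappa> * (- 1) ^ dodd / \<phi>2 else if odd i then 1 else - 1))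
          = (2 * ?V) / \<phi>2 * (2 ^ m' * ?U) ^ 2"
        unfolding m(2) alternating_prod_odd by (simp add: UV[symmetric] power2_eq_square mult_ac)
      define a :: "'w idx \<Rightarrow> two_adic" where "a = case_sum (\<lambda>i. if i = 0 then - \<kappa> / \<phi>1 else if odd i then 1 else - 1)
        (case_sum (\<lambda>i. if i = 0 then \<kappa> * (- 1) ^ dodd / \<phi>2 else if odd i then 1 else - 1) (\<lambda>_. 0))"
      have adm': "admits a (J n_plus n_minus)" unfolding a_def \<phi>1_def \<phi>2_def by (rule admits_both_odd[OF adm ku])
      have aP: "a (PI i) = (if i = 0 then - \<kappa> / \<phi>1 else if odd i then 1 else - 1)" and aM: "a (MI i) = (if i = 0 then \<kappa> * (- 1) ^ dodd / \<phi>2 else if odd i then 1 else - 1)" for i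
        by (simp_all add: a_def)
      have nzA: "a (PI i) \<noteq> 0" "a (MI i) \<noteq> 0" for i using k0 nz by (simp_all add: aP aM)
      have S1: "square_class (\<Prod>i<n_plus. 2 * a (PI i)) = square_class (to_fract (2 * u_plus * poly f 1))"
        unfolding aP P using H[OF nz(1,3), of "2 ^ m" "2 * ?U"] by (simp add: f1 abbr)
      have S2: "square_class (\<Prod>i<n_minus. 2 * a (MI i)) = square_class (to_fract (2 * u_minus * poly f (- 1)))"
        unfolding aM Q using H[OF nz(2,4), of "2 ^ m' * ?U" "2 * ?V"] U0 by (simp add: fm1 abbr)
      show ?thesis using fin[OF adm' nzA] False unfolding S1 S2 by simp
    next
      case True
      then obtain m m' where m: "n_plus = 2 * m + 2" "n_minus = 2 * m' + 2"
      proof -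
        have "even n_minus" using True parity by simp
        with True obtain k k' where "n_plus = 2 * k" "n_minus = 2 * k'" by (elim evenE)
        then show ?thesis using np that[of "k - 1" "k' - 1"] by simp
      qed
      \<comment> \<open>Solves -\<nu> (-1)^m = u_plus.\<close>
      define \<nu> where "\<nu> = - ((- 1) ^ m * ?U)"
      have nu: "Z2_unit \<nu>" using Uu by (cases "even m") (simp_all add: \<nu>_def)
      then have n0: "\<nu> \<noteq> 0" by (simp add: Z2_unit_def)
      have ev: "even n_minus" using True parity by simp
      have P: "(\<Prod>i<n_plus. 2 * (if i = 0 then - 1 / \<phi>1 else if i = 1 then \<nu> else if even i then 1 else - 1))
          = ?U / \<phi>1 * (2 ^ (m + 1)) ^ 2"
        unfolding m(1) alternating_prod_even using sq[of m] by (simp add: \<nu>_def mult_ac)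
      have "(- 1 :: two_adic) ^ n = (- 1) ^ m * (- 1) ^ m' * (- 1) ^ dodd"
        unfolding sgn_n m by (simp add: power_add)
      then have "(- 1) ^ dodd / \<phi>2 * (- \<nu>) * (- 1) ^ m' = ((- 1) ^ n * ?U) / \<phi>2"
        by (simp add: \<nu>_def mult_ac)
      then have Q: "(\<Prod>i<n_minus. 2 * (if i = 0 then (- 1) ^ dodd / \<phi>2 else if i = 1 then - \<nu> else if even i then 1 else - 1))
          = ?V / \<phi>2 * (2 ^ (m' + 1) * ?U) ^ 2"
        unfolding m(2) alternating_prod_even by (simp add: UV[symmetric] power2_eq_square mult_ac)
      define a :: "'w idx \<Rightarrow> two_adic" where "a = case_sum (\<lambda>i. if i = 0 then - 1 / \<phi>1 else if i = 1 then \<nu> else if even i then 1 else - 1)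
        (case_sum (\<lambda>i. if i = 0 then (- 1) ^ dodd / \<phi>2 else if i = 1 then - \<nu> else if even i then 1 else - 1) (\<lambda>_. 0))"
      have adm': "admits a (J n_plus n_minus)" unfolding a_def \<phi>1_def \<phi>2_def by (rule admits_both_even[OF True ev np nu])
      have aP: "a (PI i) = (if i = 0 then - 1 / \<phi>1 else if i = 1 then \<nu> else if even i then 1 else - 1)" and aM: "a (MI i) = (if i = 0 then (- 1) ^ dodd / \<phi>2 else if i = 1 then - \<nu> else if even i then 1 else - 1)" for i
        by (simp_all add: a_def)
      have nzA: "a (PI i) \<noteq> 0" "a (MI i) \<noteq> 0" for i using n0 nz by (simp_all add: aP aM)
      have S1: "square_class (\<Prod>i<n_plus. 2 * a (PI i)) = square_class (to_fract (u_plus * poly f 1))"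
        unfolding aP P using H[OF nz(1,3), of "2 ^ (m + 1)" "?U"] by (simp add: f1 abbr)
      have S2: "square_class (\<Prod>i<n_minus. 2 * a (MI i)) = square_class (to_fract (u_minus * poly f (- 1)))"
        unfolding aM Q using H[OF nz(2,4), of "2 ^ (m' + 1) * ?U" "?V"] U0 by (simp add: fm1 abbr)
      show ?thesis using fin[OF adm' nzA] True unfolding S1 S2 by simp
    qed
  qed
  \<comment> \<open>If f has valuation 2k at the point, t = 2^k / hsq makes t^2 / fodd a unit there.
    \<open>\<rho>\<close> and \<open>\<rho>'\<close> stand for the same number in the field and in
    the ring.\<close>
  have t: "\<exists>t u. Z2_unit u \<and> t ^ 2 / poly fodd \<rho> = 1 / u \<and> to_fract (poly f \<rho>') = t ^ 2 * poly hsq \<rho> ^ 2 * u \<and> t \<noteq> 0"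
    if x: "to_fract (poly f \<rho>') = poly fodd \<rho> * poly hsq \<rho> ^ 2" "even (v2 (poly f \<rho>'))" "poly f \<rho>' \<noteq> 0"
      "poly hsq \<rho> \<noteq> 0" "poly fodd \<rho> \<noteq> 0" for \<rho> \<rho>'
  proof -
    obtain k u where ku: "to_fract (poly f \<rho>') = (2 ^ k) ^ 2 * to_fract u" "u dvd 1"
      using even_v2_decompose[OF x(3,2)] .
    have uu: "Z2_unit (to_fract u)" using ku(2) by (rule Z2_unit_to_fract)
    define t where "t = 2 ^ k / poly hsq \<rho>"
    have e: "to_fract (poly f \<rho>') = t ^ 2 * poly hsq \<rho> ^ 2 * to_fract u"
      using x(4) by (simp add: ku(1) t_def power_divide)
    then have "poly fodd \<rho> = t ^ 2 * to_fract u" using x(1,4) by (simp add: mult_ac)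
    then have "t ^ 2 / poly fodd \<rho> = 1 / to_fract u"
      using x(4) by (simp add: t_def)
    then show ?thesis using uu e x(4) by (rule_tac exI[of _ t], rule_tac exI[of _ "to_fract u"]) (simp add: t_def)
  qed
  note tp = t[of 1 1, OF f1 _ f0(1) hsq_nz(1,3)] and tm = t[of "- 1" "- 1", OF fm1 _ f0(2) hsq_nz(2,4)]
  \<comment> \<open>If only one eigenvalue occurs, the nonzero one of F(1) and F(-1) is f there
    times an even power of 2 or -2, so (a) passes to f.\<close>
  have v2_mult: "even (v2 x)" if a: "even (v2 (e ^ k * x))" "even k" "e = 2 \<or> e = - 2" "x \<noteq> 0" for x e and k :: nat
  proof -
    obtain j u where ju: "x = 2 ^ j * u" "u dvd 1" using a(4) by (rule two_adic_int_decompose)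
    have ek: "e ^ k = 2 ^ k" using a(2,3) by auto
    have "e ^ k * x = 2 ^ (k + j) * u" unfolding ek ju(1) power_add by (simp only: mult.assoc)
    then have "even (k + j)" using a(1) v2_pow2_unit[OF ju(2)] by simp
    then show ?thesis using a(2) v2_pow2_unit[OF ju(2)] ju(1) by simp
  qed
  have first: "\<exists>b. has_stable_even_unimodular M (alpha fw) b"
  proof (cases "n_plus > 0"; cases "n_minus > 0")
    assume "n_plus > 0" "n_minus > 0"
    then show ?thesis using both[of 1 "(- 1) ^ n"] by auto
  next
    assume np: "n_plus > 0" "\<not> n_minus > 0"
    then have ev: "even n_plus" using parity by simp
    have "even (v2 ((- 2) ^ n_plus * poly f (- 1)))" using assms(4) np(2) unfolding Fm1 by simp
    then have "even (v2 (poly f (- 1)))" by (rule v2_mult[OF _ ev _ f0(2)]) simp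
    then obtain t u where "Z2_unit u" "t ^ 2 / poly fodd (- 1) = 1 / u" using tm by blast
    then have "Z2_unit (t ^ 2 / poly fodd (- 1))" by (simp add: divide_inverse)
    then show ?thesis using admits_plus[OF ev np(1)] exists np(2) by auto
  next
    assume nm: "\<not> n_plus > 0" "n_minus > 0"
    then have ev: "even n_minus" using parity by simp
    have "even (v2 (2 ^ n_minus * poly f 1))" using assms(3) nm(1) unfolding F1 by simp
    then have "even (v2 (poly f 1))" by (rule v2_mult[OF _ ev _ f0(1)]) simp
    then obtain t u where "Z2_unit u" "t ^ 2 / poly fodd 1 = 1 / u" using tp by blast
    then have "Z2_unit (t ^ 2 / poly fodd 1)" by (simp add: divide_inverse)
    then show ?thesis using admits_minus[OF ev nm(2)] exists nm(1) by auto
  next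
    assume n0: "\<not> n_plus > 0" "\<not> n_minus > 0"
    then have Ff: "poly F 1 = poly f 1" "poly F (- 1) = poly f (- 1)" using F1 Fm1 by simp_all
    obtain t1 u1 where 1: "Z2_unit u1" "t1 ^ 2 / poly fodd 1 = 1 / u1"
      "to_fract (poly f 1) = t1 ^ 2 * poly hsq 1 ^ 2 * u1" "t1 \<noteq> 0" using tp assms(3) Ff by auto
    obtain t2 u2 where 2: "Z2_unit u2" "t2 ^ 2 / poly fodd (- 1) = 1 / u2"
      "to_fract (poly f (- 1)) = t2 ^ 2 * poly hsq (- 1) ^ 2 * u2" "t2 \<noteq> 0" using tm assms(4) Ff by auto
    have en: "(- 1 :: two_adic) ^ n = (- 1) ^ dodd" using sgn_n n0 by simp
    have "to_fract ((- 1) ^ k) = (- 1 :: two_adic) ^ k" for k by (cases "even k") simp_all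
    then have F': "to_fract ((- 1) ^ n * poly F 1 * poly F (- 1)) = (- 1) ^ dodd * to_fract (poly f 1) * to_fract (poly f (- 1))"
      by (simp add: Ff en)
    have "poly F 1 * poly F (- 1) \<noteq> 0" using Ff f0 by simp
    then have "square_class ((- 1) ^ dodd * to_fract (poly f 1) * to_fract (poly f (- 1))) = square_class 1"
      using assms(5) unfolding F' by blast
    moreover have "(- 1) ^ dodd * to_fract (poly f 1) * to_fract (poly f (- 1)) \<in>
        square_class ((- 1) ^ dodd * to_fract (poly f 1) * to_fract (poly f (- 1)))"
      unfolding square_class_def by (intro CollectI exI[of _ 1]) simp
    ultimately obtain s where s: "(- 1) ^ dodd * to_fract (poly f 1) * to_fract (poly f (- 1)) = s ^ 2"
      unfolding square_class_def by auto
    \<comment> \<open>The square factors of f(1) f(-1) = u1 u2 r^2; dividing (b) by r^2 shows that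
      (-1)^dodd u1 u2 is a square.\<close>
    define r where "r = t1 * poly hsq 1 * (t2 * poly hsq (- 1))"
    have r0: "r \<noteq> 0" using 1 2 hsq_nz by (simp add: r_def)
    have "(- 1) ^ dodd * u1 * u2 * r ^ 2 = s ^ 2"
      unfolding s[symmetric] 1(3) 2(3) r_def by (simp add: power_mult_distrib mult_ac)
    then have e: "(- 1) ^ dodd * u1 * u2 = (s / r) ^ 2" using r0 by (simp add: power_divide field_simps)
    have "(1 / u1 - (- 1) ^ dodd * (1 / u2)) / 4 \<in> Z2"
      by (rule Z2_unit_two_squares[OF 1(1) 2(1) _ e]) (cases "even dodd"; simp)
    then have "(t1 ^ 2 / poly fodd 1 - (- 1) ^ dodd * t2 ^ 2 / poly fodd (- 1)) / 4 \<in> Z2"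
      using 1(2) 2(2) by (metis times_divide_eq_right)
    moreover have "Z2_unit (t1 ^ 2 / poly fodd 1)" "Z2_unit (t2 ^ 2 / poly fodd (- 1))"
      using 1(1,2) 2(1,2) by (simp_all add: divide_inverse)
    ultimately show ?thesis using admits_none exists n0 by auto
  qed
  show ?thesis
  proof (intro conjI impI allI first)
    fix u_plus u_minus :: two_adic_int
    assume F0: "poly F 1 = 0 \<and> poly F (- 1) = 0" and u: "u_plus dvd 1 \<and> u_minus dvd 1 \<and> u_plus * u_minus = (- 1) ^ n"
    have "n_plus > 0" using F0 F1 f0 by (cases "n_plus = 0") auto
    moreover have "n_minus > 0" using F0 Fm1 f0 by (cases "n_minus = 0") auto
    ultimately show "\<exists>b. has_stable_even_unimodular M (alpha fw) b \<and>
          form_det (M_plus n_plus) b =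
            square_class (to_fract (if even n_plus then u_plus * poly f 1
                                    else 2 * u_plus * poly f 1)) \<and>
          form_det (M_minus n_minus) b =
            square_class (to_fract (if even n_plus then u_minus * poly f (- 1)
                                    else 2 * u_minus * poly f (- 1)))"
      using both[of u_plus u_minus] u by blast
  qed
qed

end
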